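(* Let $(G_n,X_n)_{n\ge 1}$ be a sequence of finite transitive permutation groups with uniformly bounded number of generators, i.e. there is a constant $m$ such that every $G_n$ can be generated by at most $m$ elements. Then the profinite group $W=\ldots\wr G_2\wr G_1$ (the infinitely iterated permutational wreath product) is topologically finitely generated if and only if the profinite abelian group $\prod_{n\ge 1} G_n/G_n'$ is topologically finitely generated.
   Context: All actions are faithful: a permutation group $(G,X)$ is a group $G$ acting faithfully on a set $X$; it is a finite transitive permutation group if $X$ is finite and nonempty and $G$ acts transitively on $X$. $G'$ denotes the commutator subgroup of $G$. For permutation groups $(G,X)$ and $(H,Y)$, the permutational wreath product $H\wr G$ is the semidirect product $H^{|X|}\rtimes G$ (one copy of $H$ for each element of $X$, with $G$ permuting the copies via its action on $X$), with its natural faithful action on $X\times Y$; equivalently, it is the group of all permutations of $X\times Y$ of the form $(x,y)\mapsto (g(x),h_x(y))$ with $g\in G$ and $h_x\in H$ for $x\in X$. This operation is associative, so $G_n\wr\ldots\wr G_2\wr G_1$ is a permutation group on $X_1\times\ldots\times X_n$. The infinitely iterated wreath product $\ldots\wr G_2\wr G_1$ is the profinite group $W=\varprojlim_n\,(G_n\wr\ldots\wr G_2\wr G_1)$, where the connecting maps $G_{n+1}\wr G_n\wr\ldots\wr G_1\to G_n\wr\ldots\wr G_1$ are the natural projections (the induced action on the first $n$ coordinates). The group $\prod_{n\ge1}G_n/G_n'$ carries the product topology of finite discrete groups. A profinite group is topologically finitely generated if it contains a finitely generated dense subgroup. *)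

theory Defs
  imports
    "HOL-Analysis.Function_Topology"
    "HOL-Algebra.Group_Action"
    "HOL-Algebra.Generated_Groups"
    "HOL-Algebra.Product_Groups"
begin

section \<open>Permutation groups\<close>

definition finite_transitive_perm_group ::
  "('g, 'm) monoid_scheme \<Rightarrow> 'a set \<Rightarrow> ('g \<Rightarrow> 'a \<Rightarrow> 'a) \<Rightarrow> bool"
  where "finite_transitive_perm_group G X \<phi> \<longleftrightarrow>
    finite X \<and> X \<noteq> {} \<and> faithful_action G X \<phi> \<and> transitive_action G X \<phi>"

definition generated_by_at_most :: "nat \<Rightarrow> ('g, 'm) monoid_scheme \<Rightarrow> bool"
  where "generated_by_at_most m G \<longleftrightarrow>
    (\<exists>S. S \<subseteq> carrier G \<and> finite S \<and> card S \<le> m \<and> generate G S = carrier G)"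

definition abelianization :: "('g, 'm) monoid_scheme \<Rightarrow> 'g set monoid"
  where "abelianization G = G Mod (derived G (carrier G))"

definition perm_group :: "'a set \<Rightarrow> ('a \<Rightarrow> 'a) set \<Rightarrow> ('a \<Rightarrow> 'a) monoid"
  where "perm_group X P = BijGroup X \<lparr>carrier := P\<rparr>"


section \<open>Wreath products\<close>

text \<open>
  For permutation groups on \<open>X\<close> and \<open>Y\<close> with underlying sets of permutations \<open>P\<close> and \<open>Q\<close>,
  the set of permutations of \<open>X \<times> Y\<close> underlying the wreath product \<open>Q \<wr> P\<close>, with \<open>P\<close> on top.
\<close>

definition wreath ::
  "'a set \<Rightarrow> ('a \<Rightarrow> 'a) set \<Rightarrow> 'b set \<Rightarrow> ('b \<Rightarrow> 'b) set \<Rightarrow> ('a \<times> 'b \<Rightarrow> 'a \<times> 'b) set"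
  where "wreath X P Y Q =
    {(\<lambda>(x, y) \<in> X \<times> Y. (g x, h x y)) | g h. g \<in> P \<and> h \<in> X \<rightarrow> Q}"

text \<open>
  Sequences are indexed from 0, and \<open>X 0 \<times> \<dots> \<times> X (n - 1)\<close> is represented by words of length
  \<open>n\<close>, so that all these products live in one type. The bijection \<open>(u, x) \<mapsto> u @ [x]\<close> identifies
  \<open>words X n \<times> X n\<close> with \<open>words X (Suc n)\<close>; \<open>snoc_conj\<close> is conjugation by it.
\<close>

definition words :: "(nat \<Rightarrow> 'a set) \<Rightarrow> nat \<Rightarrow> 'a list set"
  where "words X n = {u. length u = n \<and> (\<forall>i<n. u ! i \<in> X i)}"

definition snoc_conj ::
  "'a list set \<Rightarrow> ('a list \<times> 'a \<Rightarrow> 'a list \<times> 'a) \<Rightarrow> 'a list \<Rightarrow> 'a list"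
  where "snoc_conj U f = (\<lambda>u\<in>U. (\<lambda>(v, x). v @ [x]) (f (butlast u, last u)))"

primrec iter_wreath_perms ::
  "(nat \<Rightarrow> ('g, 'm) monoid_scheme) \<Rightarrow> (nat \<Rightarrow> 'a set) \<Rightarrow> (nat \<Rightarrow> 'g \<Rightarrow> 'a \<Rightarrow> 'a) \<Rightarrow>
    nat \<Rightarrow> ('a list \<Rightarrow> 'a list) set"
  where
    "iter_wreath_perms G X \<phi> 0 = carrier (BijGroup (words X 0))"
  | "iter_wreath_perms G X \<phi> (Suc n) = snoc_conj (words X (Suc n)) `
       wreath (words X n) (iter_wreath_perms G X \<phi> n) (X n) (\<phi> n ` carrier (G n))"

text \<open>\<open>iter_wreath G X \<phi> n\<close> is the group \<open>G (n - 1) \<wr> \<dots> \<wr> G 0\<close>; for \<open>n = 0\<close> it is trivial.\<close>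

definition iter_wreath ::
  "(nat \<Rightarrow> ('g, 'm) monoid_scheme) \<Rightarrow> (nat \<Rightarrow> 'a set) \<Rightarrow> (nat \<Rightarrow> 'g \<Rightarrow> 'a \<Rightarrow> 'a) \<Rightarrow>
    nat \<Rightarrow> ('a list \<Rightarrow> 'a list) monoid"
  where "iter_wreath G X \<phi> n = perm_group (words X n) (iter_wreath_perms G X \<phi> n)"

text \<open>
  The permutation of the first \<open>n\<close> coordinates induced by an element of level \<open>Suc n\<close>. The letter
  appended to \<open>u\<close> does not matter, see \<open>butlast_iter_wreath\<close> below.
\<close>

definition iter_wreath_proj ::
  "(nat \<Rightarrow> 'a set) \<Rightarrow> nat \<Rightarrow> ('a list \<Rightarrow> 'a list) \<Rightarrow> 'a list \<Rightarrow> 'a list"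
  where "iter_wreath_proj X n w = (\<lambda>u\<in>words X n. butlast (w (u @ [SOME x. x \<in> X n])))"


section \<open>Inverse limits and products of discrete groups\<close>

definition inverse_limit ::
  "(nat \<Rightarrow> ('g, 'm) monoid_scheme) \<Rightarrow> (nat \<Rightarrow> 'g \<Rightarrow> 'g) \<Rightarrow> (nat \<Rightarrow> 'g) monoid"
  where "inverse_limit G p = product_group UNIV G
    \<lparr>carrier := {w \<in> carrier (product_group UNIV G). \<forall>n. p n (w (Suc n)) = w n}\<rparr>"

definition prodiscrete_topology :: "(nat \<Rightarrow> ('g, 'm) monoid_scheme) \<Rightarrow> (nat \<Rightarrow> 'g) topology"
  where "prodiscrete_topology G = product_topology (\<lambda>n. discrete_topology (carrier (G n))) UNIV"

definition inverse_limit_topology ::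
  "(nat \<Rightarrow> ('g, 'm) monoid_scheme) \<Rightarrow> (nat \<Rightarrow> 'g \<Rightarrow> 'g) \<Rightarrow> (nat \<Rightarrow> 'g) topology"
  where "inverse_limit_topology G p =
    subtopology (prodiscrete_topology G) (carrier (inverse_limit G p))"

definition topologically_finitely_generated :: "('g, 'm) monoid_scheme \<Rightarrow> 'g topology \<Rightarrow> bool"
  where "topologically_finitely_generated G T \<longleftrightarrow>
    (\<exists>S. finite S \<and> S \<subseteq> carrier G \<and> T closure_of (generate G S) = topspace T)"

definition infinite_wreath ::
  "(nat \<Rightarrow> ('g, 'm) monoid_scheme) \<Rightarrow> (nat \<Rightarrow> 'a set) \<Rightarrow> (nat \<Rightarrow> 'g \<Rightarrow> 'a \<Rightarrow> 'a) \<Rightarrow>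
    (nat \<Rightarrow> 'a list \<Rightarrow> 'a list) monoid"
  where "infinite_wreath G X \<phi> = inverse_limit (iter_wreath G X \<phi>) (iter_wreath_proj X)"

definition infinite_wreath_topology ::
  "(nat \<Rightarrow> ('g, 'm) monoid_scheme) \<Rightarrow> (nat \<Rightarrow> 'a set) \<Rightarrow> (nat \<Rightarrow> 'g \<Rightarrow> 'a \<Rightarrow> 'a) \<Rightarrow>
    (nat \<Rightarrow> 'a list \<Rightarrow> 'a list) topology"
  where "infinite_wreath_topology G X \<phi> =
    inverse_limit_topology (iter_wreath G X \<phi>) (iter_wreath_proj X)"


section \<open>Well-definedness\<close>

lemma mult_BijGroup: "f \<in> Bij S \<Longrightarrow> g \<in> Bij S \<Longrightarrow> f \<otimes>\<^bsub>BijGroup S\<^esub> g = compose S f g"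
  and one_BijGroup: "\<one>\<^bsub>BijGroup S\<^esub> = (\<lambda>x\<in>S. x)"
  by (simp_all add: BijGroup_def)

lemma subgroup_wreath:
  assumes P: "subgroup P (BijGroup X)" and Q: "subgroup Q (BijGroup Y)"
  shows "subgroup (wreath X P Y Q) (BijGroup (X \<times> Y))"
proof -
  interpret BX: group "BijGroup X" by (rule group_BijGroup)
  interpret BY: group "BijGroup Y" by (rule group_BijGroup)
  interpret BXY: group "BijGroup (X \<times> Y)" by (rule group_BijGroup)
  define E where "E g h = (\<lambda>(x, y) \<in> X \<times> Y. (g x, h x y))"
    for g :: "'a \<Rightarrow> 'a" and h :: "'a \<Rightarrow> 'b \<Rightarrow> 'b"
  have W: "wreath X P Y Q = {E g h | g h. g \<in> P \<and> h \<in> X \<rightarrow> Q}"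
    by (simp add: wreath_def E_def)
  have PB: "g \<in> Bij X" if "g \<in> P" for g
    using subgroup.mem_carrier[OF P that] by (simp add: BijGroup_def)
  have QB: "h \<in> Bij Y" if "h \<in> Q" for h
    using subgroup.mem_carrier[OF Q that] by (simp add: BijGroup_def)
  have Pm: "compose X g g' \<in> P" if "g \<in> P" "g' \<in> P" for g g'
    using subgroup.m_closed[OF P that] PB that by (simp add: BijGroup_def)
  have Qm: "compose Y h h' \<in> Q" if "h \<in> Q" "h' \<in> Q" for h h'
    using subgroup.m_closed[OF Q that] QB that by (simp add: BijGroup_def)
  have P1: "(\<lambda>x\<in>X. x) \<in> P" and Q1: "(\<lambda>y\<in>Y. y) \<in> Q"
    using subgroup.one_closed[OF P] subgroup.one_closed[OF Q] by (simp_all add: BijGroup_def)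
  have PX: "g x \<in> X" if "g \<in> P" "x \<in> X" for g x
    using PB[OF that(1)] that(2) Bij_imp_funcset by blast
  have QY: "h y \<in> Y" if "h \<in> Q" "y \<in> Y" for h y
    using QB[OF that(1)] that(2) Bij_imp_funcset by blast
  have E_comp: "compose (X \<times> Y) (E g h) (E g' h') =
      E (compose X g g') (\<lambda>x. compose Y (h (g' x)) (h' x))"
    if "g \<in> P" "g' \<in> P" "h \<in> X \<rightarrow> Q" "h' \<in> X \<rightarrow> Q" for g g' h h'
  proof -
    have "g' x \<in> X" "h' x y \<in> Y" if "x \<in> X" "y \<in> Y" for x y
      using that PX QY \<open>g' \<in> P\<close> \<open>h' \<in> X \<rightarrow> Q\<close> by blast+
    then show ?thesis
      by (auto simp: E_def compose_def restrict_def fun_eq_iff)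
  qed
  have inverse: "\<exists>g' h'. g' \<in> P \<and> h' \<in> X \<rightarrow> Q \<and>
      compose (X \<times> Y) (E g' h') (E g h) = (\<lambda>z\<in>X \<times> Y. z) \<and>
      compose (X \<times> Y) (E g h) (E g' h') = (\<lambda>z\<in>X \<times> Y. z)"
    if g: "g \<in> P" and h: "h \<in> X \<rightarrow> Q" for g h
  proof -
    define g' where "g' = inv\<^bsub>BijGroup X\<^esub> g"
    define k where "k x = inv\<^bsub>BijGroup Y\<^esub> (h x)" for x
    define h' where "h' x = k (g' x)" for x
    have g'P: "g' \<in> P" using subgroup.m_inv_closed[OF P g] by (simp add: g'_def)
    have kQ: "k x \<in> Q" if "x \<in> X" for x
      using subgroup.m_inv_closed[OF Q] h that by (auto simp: k_def)
    have h'Q: "h' \<in> X \<rightarrow> Q" using kQ PX[OF g'P] by (auto simp: h'_def)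
    have gg: "compose X g' g = (\<lambda>x\<in>X. x)" "compose X g g' = (\<lambda>x\<in>X. x)"
      using BX.l_inv[OF subgroup.mem_carrier[OF P g]] BX.r_inv[OF subgroup.mem_carrier[OF P g]]
        PB[OF g] PB[OF g'P] by (simp_all add: g'_def[symmetric] mult_BijGroup one_BijGroup)
    have kh: "compose Y (k x) (h x) = (\<lambda>y\<in>Y. y)" "compose Y (h x) (k x) = (\<lambda>y\<in>Y. y)"
      if "x \<in> X" for x
    proof -
      have hx: "h x \<in> Q" using h that by blast
      show "compose Y (k x) (h x) = (\<lambda>y\<in>Y. y)" "compose Y (h x) (k x) = (\<lambda>y\<in>Y. y)"
        using BY.l_inv[OF subgroup.mem_carrier[OF Q hx]] BY.r_inv[OF subgroup.mem_carrier[OF Q hx]]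
          QB[OF hx] QB[OF kQ[OF that]] by (simp_all add: k_def[symmetric] mult_BijGroup one_BijGroup)
    qed
    have g'g: "g' (g x) = x" "g (g' x) = x" if "x \<in> X" for x
      using fun_cong[OF gg(1), of x] fun_cong[OF gg(2), of x] that by (simp_all add: compose_def)
    have kh': "k x (h x y) = y" "h x (k x y) = y" if "x \<in> X" "y \<in> Y" for x y
      using fun_cong[OF kh(1)[OF that(1)], of y] fun_cong[OF kh(2)[OF that(1)], of y] that
      by (simp_all add: compose_def)
    have "compose (X \<times> Y) (E g' h') (E g h) = (\<lambda>z\<in>X \<times> Y. z)"
      unfolding E_comp[OF g'P g h'Q h]
      by (auto simp: E_def h'_def compose_def restrict_def fun_eq_iff g'g kh')
    moreover have "compose (X \<times> Y) (E g h) (E g' h') = (\<lambda>z\<in>X \<times> Y. z)"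
      unfolding E_comp[OF g g'P h h'Q]
      using PX[OF g'P] by (auto simp: E_def h'_def compose_def restrict_def fun_eq_iff g'g kh')
    ultimately show ?thesis using g'P h'Q by blast
  qed
  have E_fun: "E g h \<in> X \<times> Y \<rightarrow> X \<times> Y" if "g \<in> P" "h \<in> X \<rightarrow> Q" for g h
  proof -
    have "g x \<in> X" "h x y \<in> Y" if "x \<in> X" "y \<in> Y" for x y
      using that PX QY \<open>g \<in> P\<close> \<open>h \<in> X \<rightarrow> Q\<close> by blast+
    then show ?thesis by (auto simp: E_def)
  qed
  have EB: "E g h \<in> Bij (X \<times> Y)" if gh: "g \<in> P" "h \<in> X \<rightarrow> Q" for g h
  proof -
    obtain g' h' where *: "g' \<in> P" "h' \<in> X \<rightarrow> Q"
      "compose (X \<times> Y) (E g' h') (E g h) = (\<lambda>z\<in>X \<times> Y. z)"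
      "compose (X \<times> Y) (E g h) (E g' h') = (\<lambda>z\<in>X \<times> Y. z)"
      using inverse[OF gh] by blast
    have "E g' h' (E g h z) = z" "E g h (E g' h' z) = z" if "z \<in> X \<times> Y" for z
      using fun_cong[OF *(3), of z] fun_cong[OF *(4), of z] that by (simp_all add: compose_def)
    then have "bij_betw (E g h) (X \<times> Y) (X \<times> Y)"
      using E_fun[OF gh] E_fun[OF *(1,2)]
      by (intro bij_betw_byWitness[where f' = "E g' h'"]) blast+
    moreover have "E g h \<in> extensional (X \<times> Y)" by (simp add: E_def)
    ultimately show ?thesis by (simp add: Bij_def)
  qed
  show ?thesis
  proof (rule BXY.subgroupI)
    show "wreath X P Y Q \<subseteq> carrier (BijGroup (X \<times> Y))"
      using EB by (auto simp: W BijGroup_def)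
    show "wreath X P Y Q \<noteq> {}"
      using P1 Q1 by (auto simp: W intro!: exI[of _ "\<lambda>x\<in>X. x"] exI[of _ "\<lambda>_. \<lambda>y\<in>Y. y"])
  next
    fix a assume "a \<in> wreath X P Y Q"
    then obtain g h where a: "a = E g h" and gh: "g \<in> P" "h \<in> X \<rightarrow> Q" by (auto simp: W)
    obtain g' h' where *: "g' \<in> P" "h' \<in> X \<rightarrow> Q"
      "compose (X \<times> Y) (E g' h') (E g h) = (\<lambda>z\<in>X \<times> Y. z)"
      using inverse[OF gh] by blast
    have "inv\<^bsub>BijGroup (X \<times> Y)\<^esub> a = E g' h'"
      using *(3) EB[OF gh] EB[OF *(1,2)]
      by (intro BXY.inv_equality) (auto simp: a BijGroup_def)
    then show "inv\<^bsub>BijGroup (X \<times> Y)\<^esub> a \<in> wreath X P Y Q" using * by (auto simp: W)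
  next
    fix a b assume "a \<in> wreath X P Y Q" "b \<in> wreath X P Y Q"
    then obtain g h g' h' where a: "a = E g h" and gh: "g \<in> P" "h \<in> X \<rightarrow> Q"
      and b: "b = E g' h'" and gh': "g' \<in> P" "h' \<in> X \<rightarrow> Q" by (auto simp: W)
    have "(\<lambda>x. compose Y (h (g' x)) (h' x)) \<in> X \<rightarrow> Q"
      using Qm gh gh' PX[OF gh'(1)] by blast
    moreover have "a \<otimes>\<^bsub>BijGroup (X \<times> Y)\<^esub> b =
        E (compose X g g') (\<lambda>x. compose Y (h (g' x)) (h' x))"
      using EB[OF gh] EB[OF gh'] E_comp[OF gh(1) gh'(1) gh(2) gh'(2)]
      by (simp add: a b BijGroup_def)
    ultimately show "a \<otimes>\<^bsub>BijGroup (X \<times> Y)\<^esub> b \<in> wreath X P Y Q"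
      using Pm[OF gh(1) gh'(1)] by (auto simp: W)
  qed
qed

lemma words_Suc: "u \<in> words X (Suc n) \<longleftrightarrow> (\<exists>v x. u = v @ [x] \<and> v \<in> words X n \<and> x \<in> X n)"
proof
  assume "u \<in> words X (Suc n)"
  then show "\<exists>v x. u = v @ [x] \<and> v \<in> words X n \<and> x \<in> X n"
    by (cases u rule: rev_cases) (auto simp: words_def nth_append less_Suc_eq)
qed (auto simp: words_def nth_append less_Suc_eq)

lemma snoc_conj_hom:
  "snoc_conj (words X (Suc n)) \<in> hom (BijGroup (words X n \<times> X n)) (BijGroup (words X (Suc n)))"
proof -
  let ?A = "words X n \<times> X n" and ?B = "words X (Suc n)"
  let ?s = "\<lambda>(v, x). v @ [x]" and ?t = "\<lambda>u. (butlast u, last u)"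
  have s: "bij_betw ?s ?A ?B"
    by (rule bij_betw_byWitness[where f' = ?t]) (auto simp: words_Suc)
  have t: "bij_betw ?t ?B ?A"
    by (rule bij_betw_byWitness[where f' = ?s]) (auto simp: words_Suc)
  have conj: "snoc_conj ?B f = (\<lambda>u\<in>?B. (?s \<circ> (f \<circ> ?t)) u)" for f
    by (simp add: snoc_conj_def)
  have Bij: "snoc_conj ?B f \<in> Bij ?B" if "f \<in> Bij ?A" for f
  proof -
    have "bij_betw (?s \<circ> (f \<circ> ?t)) ?B ?B"
      using that by (intro bij_betw_trans[OF bij_betw_trans[OF t] s]) (simp add: Bij_def)
    then show ?thesis by (simp only: conj Bij_def) (simp cong: bij_betw_cong)
  qed
  show ?thesis
  proof (rule homI)
    fix f assume "f \<in> carrier (BijGroup ?A)"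
    then show "snoc_conj ?B f \<in> carrier (BijGroup ?B)" using Bij by (simp add: BijGroup_def)
  next
    fix f g assume "f \<in> carrier (BijGroup ?A)" "g \<in> carrier (BijGroup ?A)"
    then have fg: "f \<in> Bij ?A" "g \<in> Bij ?A" by (simp_all add: BijGroup_def)
    have "snoc_conj ?B (compose ?A f g) = compose ?B (snoc_conj ?B f) (snoc_conj ?B g)"
    proof (rule extensionalityI[of _ ?B])
      fix u assume u: "u \<in> ?B"
      then have tu: "?t u \<in> ?A" by (auto simp: words_Suc)
      then have "g (?t u) \<in> ?A" using Bij_imp_funcset[OF fg(2)] by blast
      then obtain v x where "g (?t u) = (v, x)" "v \<in> words X n" "x \<in> X n" by blast
      moreover from this have "v @ [x] \<in> ?B" by (auto simp: words_Suc)
      ultimately show "snoc_conj ?B (compose ?A f g) u =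
          compose ?B (snoc_conj ?B f) (snoc_conj ?B g) u"
        using u tu by (simp add: snoc_conj_def compose_def)
    qed (simp_all add: snoc_conj_def)
    then show "snoc_conj ?B (f \<otimes>\<^bsub>BijGroup ?A\<^esub> g) =
        snoc_conj ?B f \<otimes>\<^bsub>BijGroup ?B\<^esub> snoc_conj ?B g"
      using fg Bij by (simp add: BijGroup_def)
  qed
qed

lemma subgroup_iter_wreath_perms:
  assumes "\<And>n. group_action (G n) (X n) (\<phi> n)"
  shows "subgroup (iter_wreath_perms G X \<phi> n) (BijGroup (words X n))"
proof (induction n)
  case 0
  show ?case by (simp add: group.subgroup_self[OF group_BijGroup])
next
  case (Suc n)
  have "group_hom (G n) (BijGroup (X n)) (\<phi> n)"
    using assms by (simp add: group_action_def)
  then have "subgroup (\<phi> n ` carrier (G n)) (BijGroup (X n))"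
    by (rule group_hom.img_is_subgroup)
  moreover have "group_hom (BijGroup (words X n \<times> X n)) (BijGroup (words X (Suc n)))
      (snoc_conj (words X (Suc n)))"
    by (simp add: group_hom_def group_hom_axioms_def group_BijGroup snoc_conj_hom)
  ultimately show ?case
    using subgroup_wreath[OF Suc] group_hom.subgroup_img_is_subgroup by fastforce
qed

lemma group_iter_wreath:
  assumes "\<And>n. group_action (G n) (X n) (\<phi> n)"
  shows "group (iter_wreath G X \<phi> n)"
  unfolding iter_wreath_def perm_group_def
  by (rule subgroup.subgroup_is_group[OF subgroup_iter_wreath_perms[where G = G and X = X and \<phi> = \<phi>, OF assms] group_BijGroup])

lemma iter_wreath_perms_Suc_cases:
  assumes "\<And>n. group_action (G n) (X n) (\<phi> n)"
    and "w \<in> iter_wreath_perms G X \<phi> (Suc n)"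
  obtains g h where "g \<in> iter_wreath_perms G X \<phi> n"
    "h \<in> words X n \<rightarrow> \<phi> n ` carrier (G n)"
    "w \<in> extensional (words X (Suc n))"
    "\<And>u x. u \<in> words X n \<Longrightarrow> x \<in> X n \<Longrightarrow> w (u @ [x]) = g u @ [h u x]"
    "\<And>u. X n \<noteq> {} \<Longrightarrow> u \<in> words X n \<Longrightarrow> iter_wreath_proj X n w u = g u"
proof -
  obtain g h where gh: "g \<in> iter_wreath_perms G X \<phi> n" "h \<in> words X n \<rightarrow> \<phi> n ` carrier (G n)"
    and w: "w = snoc_conj (words X (Suc n)) (\<lambda>(x, y) \<in> words X n \<times> X n. (g x, h x y))"
    using assms(2) by (auto simp: wreath_def)
  have *: "w (u @ [x]) = g u @ [h u x]" if "u \<in> words X n" "x \<in> X n" for u x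
    using that by (auto simp: w snoc_conj_def words_Suc)
  moreover have "iter_wreath_proj X n w u = g u" if "X n \<noteq> {}" "u \<in> words X n" for u
    using that *[OF that(2)] some_in_eq[of "X n"] by (simp add: iter_wreath_proj_def)
  moreover have "w \<in> extensional (words X (Suc n))" by (simp add: w snoc_conj_def)
  ultimately show thesis using that gh by blast
qed

lemma butlast_iter_wreath:
  assumes act: "\<And>n. group_action (G n) (X n) (\<phi> n)"
    and w: "w \<in> iter_wreath_perms G X \<phi> (Suc n)" and u: "u \<in> words X (Suc n)"
  shows "butlast (w u) = iter_wreath_proj X n w (butlast u)"
proof -
  obtain v x where v: "u = v @ [x]" "v \<in> words X n" "x \<in> X n"
    using u by (auto simp: words_Suc)
  then have "X n \<noteq> {}" by blast
  then show ?thesis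
    using v by (rule_tac iter_wreath_perms_Suc_cases[where G = G and X = X and \<phi> = \<phi>, OF act w]) simp
qed

lemma iter_wreath_proj_hom:
  assumes act: "\<And>n. group_action (G n) (X n) (\<phi> n)" and X: "X n \<noteq> {}"
  shows "iter_wreath_proj X n \<in> hom (iter_wreath G X \<phi> (Suc n)) (iter_wreath G X \<phi> n)"
proof -
  have sub: "subgroup (iter_wreath_perms G X \<phi> k) (BijGroup (words X k))" for k
    by (rule subgroup_iter_wreath_perms[where G = G and X = X and \<phi> = \<phi>, OF act])
  have B: "w \<in> Bij (words X k)" if "w \<in> iter_wreath_perms G X \<phi> k" for w k
    using subgroup.mem_carrier[OF sub that] by (simp add: BijGroup_def)
  have p: "iter_wreath_proj X n w \<in> iter_wreath_perms G X \<phi> n"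
    if w: "w \<in> iter_wreath_perms G X \<phi> (Suc n)" for w
  proof -
    obtain g where g: "g \<in> iter_wreath_perms G X \<phi> n"
      "\<And>u. u \<in> words X n \<Longrightarrow> iter_wreath_proj X n w u = g u"
      using X by (rule_tac iter_wreath_perms_Suc_cases[where G = G and X = X and \<phi> = \<phi>, OF act w]) blast
    have "iter_wreath_proj X n w = g"
      using g B[OF g(1)] by (intro extensionalityI[of _ "words X n"])
        (auto simp: iter_wreath_proj_def Bij_def)
    then show ?thesis using g by simp
  qed
  show ?thesis
  proof (rule homI)
    fix w assume "w \<in> carrier (iter_wreath G X \<phi> (Suc n))"
    then show "iter_wreath_proj X n w \<in> carrier (iter_wreath G X \<phi> n)"
      using p by (simp add: iter_wreath_def perm_group_def)
  next
    fix a b assume "a \<in> carrier (iter_wreath G X \<phi> (Suc n))" "b \<in> carrier (iter_wreath G X \<phi> (Suc n))"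
    then have ab: "a \<in> iter_wreath_perms G X \<phi> (Suc n)" "b \<in> iter_wreath_perms G X \<phi> (Suc n)"
      by (simp_all add: iter_wreath_def perm_group_def)
    have "iter_wreath_proj X n (compose (words X (Suc n)) a b) =
        compose (words X n) (iter_wreath_proj X n a) (iter_wreath_proj X n b)"
    proof (rule extensionalityI[of _ "words X n"])
      fix u assume u: "u \<in> words X n"
      let ?v = "u @ [SOME x. x \<in> X n]"
      have v: "?v \<in> words X (Suc n)" using u X some_in_eq[of "X n"] by (auto simp: words_Suc)
      then have "b ?v \<in> words X (Suc n)" using Bij_imp_funcset[OF B[OF ab(2)]] by blast
      then show "iter_wreath_proj X n (compose (words X (Suc n)) a b) u =
          compose (words X n) (iter_wreath_proj X n a) (iter_wreath_proj X n b) u"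
        using u v butlast_iter_wreath[where G = G and X = X and \<phi> = \<phi>, OF act ab(1)] butlast_iter_wreath[where G = G and X = X and \<phi> = \<phi>, OF act ab(2) v]
        by (simp add: compose_def) (simp add: iter_wreath_proj_def)
    qed (simp_all add: iter_wreath_proj_def)
    then show "iter_wreath_proj X n (a \<otimes>\<^bsub>iter_wreath G X \<phi> (Suc n)\<^esub> b) =
        iter_wreath_proj X n a \<otimes>\<^bsub>iter_wreath G X \<phi> n\<^esub> iter_wreath_proj X n b"
      using ab B p by (simp add: iter_wreath_def perm_group_def BijGroup_def)
  qed
qed

lemma subgroup_inverse_limit:
  assumes G: "\<And>n. group (G n)" and p: "\<And>n. p n \<in> hom (G (Suc n)) (G n)"
  shows "subgroup (carrier (inverse_limit G p)) (product_group UNIV G)"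
proof -
  have hom: "group_hom (G (Suc n)) (G n) (p n)" for n
    using G p by (simp add: group_hom_def group_hom_axioms_def)
  note simps = inverse_limit_def PiE_UNIV_domain Pi_iff group.inv_closed[OF G]
    monoid.m_closed[OF group.is_monoid[OF G]] monoid.one_closed[OF group.is_monoid[OF G]]
    hom_mult[OF p] group_hom.hom_inv[OF hom] group_hom.hom_one[OF hom] G
  show ?thesis
  proof (rule group.subgroupI)
    show "carrier (inverse_limit G p) \<noteq> {}"
      by (auto simp: simps intro!: exI[of _ "\<lambda>n. \<one>\<^bsub>G n\<^esub>"])
  qed (auto simp: simps)
qed

lemma group_infinite_wreath:
  assumes "\<And>n. finite_transitive_perm_group (G n) (X n) (\<phi> n)"
  shows "group (infinite_wreath G X \<phi>)"
proof -
  have act: "group_action (G n) (X n) (\<phi> n)" and ne: "X n \<noteq> {}" for n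
    using assms by (simp_all add: finite_transitive_perm_group_def faithful_action_def)
  have gr: "group (iter_wreath G X \<phi> n)" for n
    by (rule group_iter_wreath[where G = G and X = X and \<phi> = \<phi>, OF act])
  have "group (product_group UNIV (iter_wreath G X \<phi>))"
    using gr by simp
  moreover have "subgroup (carrier (infinite_wreath G X \<phi>)) (product_group UNIV (iter_wreath G X \<phi>))"
    unfolding infinite_wreath_def
    using subgroup_inverse_limit[where G = "iter_wreath G X \<phi>" and p = "iter_wreath_proj X"]
      gr iter_wreath_proj_hom[where G = G and X = X and \<phi> = \<phi>] act ne by blast
  ultimately have "group (product_group UNIV (iter_wreath G X \<phi>)
      \<lparr>carrier := carrier (infinite_wreath G X \<phi>)\<rparr>)"
    by (simp add: subgroup.subgroup_is_group)
  then show ?thesis by (simp add: infinite_wreath_def inverse_limit_def)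
qed

lemma topspace_prodiscrete_topology [simp]:
  "topspace (prodiscrete_topology G) = carrier (product_group UNIV G)"
  by (simp add: prodiscrete_topology_def)

lemma topspace_infinite_wreath_topology [simp]:
  "topspace (infinite_wreath_topology G X \<phi>) = carrier (infinite_wreath G X \<phi>)"
  by (auto simp: infinite_wreath_topology_def infinite_wreath_def inverse_limit_topology_def
      inverse_limit_def)

end

theory Submission
  imports Defs "HOL-Algebra.FiniteProduct"
begin

text \<open>
  Multiplying the classes of the local permutations on each level gives a continuous epimorphism
  from the iterated wreath product \<open>W\<close> onto the product of the groups \<open>G\<^sub>n/G\<^sub>n'\<close>, which settles
  one direction.

  For the other direction, cut the levels into blocks with exactly two non-singleton alphabets.
  (If only finitely many alphabets are not singletons, then \<open>W\<close> is finite.) Take the finite wreath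
  product of the first block together with directed automorphisms along a fixed spine, built from
  finitely many sequences \<open>(g\<^sub>n)\<close> that generate every \<open>G\<^sub>n\<close> and generate \<open>\<Prod> G\<^sub>n\<close> modulo \<open>\<Prod> G\<^sub>n'\<close>.
  Modulo the levels beyond a given block these generate everything, by induction on the number of
  blocks. Let \<open>T\<close> be the group acting below a vertex \<open>x\<close> at the end of the first block. Conjugating
  by the first block and using the induction hypothesis, every element of \<open>T\<close> occurs as the
  section at \<open>x\<close> of a generated automorphism supported below \<open>x\<close> and a set \<open>S\<close> of other vertices,
  and also with \<open>S\<close> replaced by a disjoint set \<open>S'\<close>; this is where two nontrivial levels per block
  are needed. Commutators of such elements are supported below \<open>x\<close> alone, so the commutator
  subgroup of \<open>T\<close> is generated below \<open>x\<close>. Hence all directed automorphisms coming from \<open>\<Prod> G\<^sub>n'\<close>,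
  and therefore those coming from \<open>\<Prod> G\<^sub>n\<close>, are generated. Choosing such sequences with trivial
  entries isolates the sections of directed automorphisms at \<open>x\<close>, and the induction hypothesis
  yields all of \<open>T\<close> below \<open>x\<close>.
\<close>

section \<open>Groups of transformations\<close>

abbreviation inverse_map :: "('b \<Rightarrow> 'b) \<Rightarrow> 'b \<Rightarrow> 'b"
  where "inverse_map f \<equiv> inv_into UNIV f"

text \<open>Permutation groups are bare sets of maps on a whole type. That some maps generate a
  group is then expressed by saying that every such set containing the maps contains the
  group.\<close>

definition transf_group :: "('b \<Rightarrow> 'b) set \<Rightarrow> bool"
  where "transf_group H \<longleftrightarrow>
    id \<in> H \<and> (\<forall>f\<in>H. \<forall>g\<in>H. f \<circ> g \<in> H) \<and> (\<forall>f\<in>H. bij f \<and> inverse_map f \<in> H)"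

lemma transf_groupD:
  assumes "transf_group H"
  shows "id \<in> H" "f \<in> H \<Longrightarrow> g \<in> H \<Longrightarrow> f \<circ> g \<in> H" "f \<in> H \<Longrightarrow> bij f"
    "f \<in> H \<Longrightarrow> inverse_map f \<in> H"
  using assms by (auto simp: transf_group_def)

lemma bij_comp_inverse_map:
  assumes "bij f"
  shows "f \<circ> inverse_map f = id" "inverse_map f \<circ> f = id"
    "f (inverse_map f x) = x" "inverse_map f (f x) = x"
  using assms
  by (simp_all add: bij_is_inj bij_is_surj surj_f_inv_f inv_f_f surj_iff[symmetric] inj_iff[symmetric])

lemma inverse_map_id: "inverse_map id = id"
  by (rule inv_unique_comp) simp_all

text \<open>The order of the factors is that of the commutators in \<open>derived_set\<close>, so
  homomorphisms carry those to these maps.\<close>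

definition commutator_map :: "('b \<Rightarrow> 'b) \<Rightarrow> ('b \<Rightarrow> 'b) \<Rightarrow> 'b \<Rightarrow> 'b"
  where "commutator_map f g = f \<circ> g \<circ> inverse_map f \<circ> inverse_map g"

lemma commutator_map_in:
  "transf_group H \<Longrightarrow> f \<in> H \<Longrightarrow> g \<in> H \<Longrightarrow> commutator_map f g \<in> H"
  by (simp add: commutator_map_def transf_groupD)


lemma commutator_map_id: "commutator_map f id = id" "commutator_map id f = id" if "bij f"
  using that by (simp_all add: commutator_map_def inverse_map_id bij_comp_inverse_map)

section \<open>Tree automorphisms\<close>

text \<open>
  Automorphisms are total functions on lists, with portrait \<open>p\<close>. The local permutations used below
  fix the letters outside the alphabet, so that no restriction to words is needed.
\<close>

primrec aut :: "('a list \<Rightarrow> 'a \<Rightarrow> 'a) \<Rightarrow> 'a list \<Rightarrow> 'a list"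
  where
    "aut p [] = []"
  | "aut p (x # w) = p [] x # aut (\<lambda>u. p (x # u)) w"

lemma length_aut [simp]: "length (aut p w) = length w"
  by (induction w arbitrary: p) auto

text \<open>Identifies sections: below \<open>v\<close> the action is given by the portrait shifted
  by \<open>v\<close>.\<close>

lemma aut_append: "aut p (v @ w) = aut p v @ aut (\<lambda>u. p (v @ u)) w"
  by (induction v arbitrary: p) auto

lemma take_aut: "take n (aut p w) = aut p (take n w)"
proof -
  have "aut p w = aut p (take n w) @ aut (\<lambda>u. p (take n w @ u)) (drop n w)"
    by (metis append_take_drop_id aut_append)
  then show ?thesis by (simp add: min_def)
qed

lemma nth_aut: "i < length w \<Longrightarrow> aut p w ! i = p (take i w) (w ! i)"
proof (induction w arbitrary: p i)
  case (Cons x w)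
  then show ?case by (cases i) auto
qed simp

lemma aut_cong:
  assumes "\<And>i. i < length w \<Longrightarrow> p (take i w) = p' (take i w)"
  shows "aut p w = aut p' w"
  by (rule nth_equalityI) (auto simp: nth_aut assms)

lemma aut_id [simp]: "aut (\<lambda>_. id) = id"
proof
  show "aut (\<lambda>_. id) w = id w" for w :: "'a list" by (induction w) auto
qed

lemma aut_fixes:
  assumes "\<And>i. i < length u \<Longrightarrow> p (take i u) = id"
  shows "aut p u = u"
  using aut_cong[of u p "\<lambda>_. id"] assms by simp

text \<open>The cocycle rule for portraits: the left factor meets \<open>u\<close> only after the
  right one has moved it.\<close>

lemma aut_comp: "aut p \<circ> aut p' = aut (\<lambda>u. p (aut p' u) \<circ> p' u)"
proof
  show "(aut p \<circ> aut p') w = aut (\<lambda>u. p (aut p' u) \<circ> p' u) w" for w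
    by (rule nth_equalityI) (auto simp: nth_aut take_aut)
qed

lemma bij_aut:
  assumes "\<And>u. bij (p u)"
  shows "bij (aut p)"
proof (rule bijI)
  have "w = w'" if "aut p w = aut p w'" "\<And>u. bij (p u)" for w w' p
    using that
  proof (induction w arbitrary: p w')
    case Nil
    then show ?case by (metis length_aut length_0_conv)
  next
    case (Cons x w)
    then obtain x' v where w': "w' = x' # v" by (cases w') auto
    from Cons.prems(1) w' have "p [] x = p [] x'" by simp
    then have x: "x = x'" using Cons.prems(2)[of "[]"] by (simp add: bij_is_inj inj_eq)
    show ?case using Cons.IH[of "\<lambda>u. p (x # u)" v] Cons.prems w' x by simp
  qed
  then show "inj (aut p)" using assms by (intro injI) blast
  have "\<exists>v. aut p v = w" if "\<And>u. bij (p u)" for w p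
    using that
  proof (induction w arbitrary: p)
    case Nil
    show ?case by (rule exI[of _ "[]"]) simp
  next
    case (Cons x w)
    obtain y where "p [] y = x" using Cons.prems[of "[]"] by (metis bij_pointE)
    moreover obtain v where "aut (\<lambda>u. p (y # u)) v = w"
      using Cons.IH[of "\<lambda>u. p (y # u)"] Cons.prems by blast
    ultimately show ?case by (intro exI[of _ "y # v"]) simp
  qed
  from this[of p] show "surj (aut p)" using assms unfolding surj_def by metis
qed

text \<open>The portrait is the one forced by \<open>aut_comp\<close>. The inverse occurs on both
  sides; the point is that it is again \<open>aut\<close> of a portrait, with values inverse to
  values of \<open>p\<close>.\<close>

lemma inverse_aut:
  assumes "\<And>u. bij (p u)"
  shows "inverse_map (aut p) = aut (\<lambda>u. inverse_map (p (inverse_map (aut p) u)))"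
proof -
  note b = bij_aut[of p, OF assms]
  let ?q = "\<lambda>u. inverse_map (p (inverse_map (aut p) u))"
  have "aut ?q \<circ> aut p = id"
    by (simp add: aut_comp bij_comp_inverse_map[OF b] bij_comp_inverse_map[OF assms])
  then have "aut ?q \<circ> aut p \<circ> inverse_map (aut p) = inverse_map (aut p)" by simp
  then show ?thesis by (simp add: comp_assoc bij_comp_inverse_map[OF b])
qed


section \<open>Maps acting separately below the vertices of one level\<close>

definition spread :: "nat \<Rightarrow> ('a list \<Rightarrow> 'a list \<Rightarrow> 'a list) \<Rightarrow> 'a list \<Rightarrow> 'a list"
  where "spread c h w = (if length w < c then w else take c w @ h (take c w) (drop c w))"

lemma spread_cong:
  "(\<And>v. length v = c \<Longrightarrow> h v = h' v) \<Longrightarrow> spread c h = spread c h'"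
  by (rule ext) (simp add: spread_def)

lemma spread_id: "(\<And>v. length v = c \<Longrightarrow> h v = id) \<Longrightarrow> spread c h = id"
  by (rule ext) (simp add: spread_def)

lemma spread_comp: "spread c h \<circ> spread c h' = spread c (\<lambda>v. h v \<circ> h' v)"
  by (rule ext) (simp add: spread_def)

lemma bij_spread:
  assumes "\<And>v. bij (h v)"
  shows "bij (spread c h)" "inverse_map (spread c h) = spread c (\<lambda>v. inverse_map (h v))"
proof -
  have *: "spread c (\<lambda>v. inverse_map (h v)) \<circ> spread c h = id"
    "spread c h \<circ> spread c (\<lambda>v. inverse_map (h v)) = id"
    by (simp_all add: spread_comp bij_comp_inverse_map[OF assms] spread_id)
  then show "bij (spread c h)" by (rule o_bij)
  show "inverse_map (spread c h) = spread c (\<lambda>v. inverse_map (h v))"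
    by (rule inv_unique_comp) (simp_all add: *)
qed

lemma commutator_spread:
  assumes "\<And>v. bij (h v)" "\<And>v. bij (h' v)"
  shows "commutator_map (spread c h) (spread c h') = spread c (\<lambda>v. commutator_map (h v) (h' v))"
  by (simp add: commutator_map_def bij_spread assms spread_comp)

lemma aut_eq_spread:
  assumes "\<And>u. length u < c \<Longrightarrow> p u = id"
  shows "aut p = spread c (\<lambda>v. aut (\<lambda>u. p (v @ u)))"
proof
  fix w
  have short: "aut p v = v" if "length v \<le> c" for v
    using aut_cong[of v p "\<lambda>_. id"] assms that by simp
  show "aut p w = spread c (\<lambda>v. aut (\<lambda>u. p (v @ u))) w"
  proof (cases "length w < c")
    case False
    have "aut p w = aut p (take c w) @ aut (\<lambda>u. p (take c w @ u)) (drop c w)"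
      by (metis append_take_drop_id aut_append)
    then show ?thesis using False short[of "take c w"] by (simp add: spread_def)
  qed (simp add: spread_def short)
qed

lemma aut_append_shallow:
  assumes "\<And>u. c \<le> length u \<Longrightarrow> p u = id" "length v = c"
  shows "aut p (v @ w) = aut p v @ w"
  using assms by (simp add: aut_append)

text \<open>A map that is trivial from level \<open>c\<close> on permutes the words of length
  \<open>c\<close> and copies what follows them, so conjugation relabels the sections without
  twisting them.\<close>

lemma aut_conj_spread:
  assumes p: "\<And>u. c \<le> length u \<Longrightarrow> p u = id" and b: "\<And>u. bij (p u)"
  shows "aut p \<circ> spread c h \<circ> inverse_map (aut p) = spread c (\<lambda>v. h (inverse_map (aut p) v))"
proof -
  note ba = bij_aut[of p, OF b]
  have "aut p \<circ> spread c h = spread c (\<lambda>v. h (inverse_map (aut p) v)) \<circ> aut p"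
  proof
    fix w
    show "(aut p \<circ> spread c h) w = (spread c (\<lambda>v. h (inverse_map (aut p) v)) \<circ> aut p) w"
    proof (cases "length w < c")
      case False
      then have "aut p w = aut p (take c w) @ drop c w"
        using aut_append_shallow[of c p "take c w" "drop c w", OF p] by simp
      then show ?thesis using False
        by (simp add: spread_def take_aut aut_append_shallow[of c p, OF p] bij_comp_inverse_map[OF ba])
    qed (simp add: spread_def)
  qed
  then show ?thesis by (simp add: comp_assoc bij_comp_inverse_map[OF ba])
qed

text \<open>The semidirect decomposition into a stabilizer of level \<open>c\<close> and a part
  trivial from level \<open>c\<close> on. The latter acts first, so the section used at
  \<open>v\<close> comes from the preimage of \<open>v\<close>.\<close>

lemma aut_split:
  fixes c :: nat
  assumes b: "\<And>u. bij (p u)"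
  defines "p0 \<equiv> \<lambda>u. if length u < c then p u else id"
  shows "aut p = spread c (\<lambda>v. aut (\<lambda>u. p (inverse_map (aut p0) v @ u))) \<circ> aut p0"
proof
  fix w
  have b0: "bij (aut p0)" by (rule bij_aut) (simp add: p0_def b)
  have short: "aut p v = aut p0 v" if "length v \<le> c" for v
    by (rule aut_cong) (use that in \<open>simp add: p0_def\<close>)
  show "aut p w = (spread c (\<lambda>v. aut (\<lambda>u. p (inverse_map (aut p0) v @ u))) \<circ> aut p0) w"
  proof (cases "length w < c")
    case False
    have "aut p w = aut p (take c w) @ aut (\<lambda>u. p (take c w @ u)) (drop c w)"
      by (metis append_take_drop_id aut_append)
    moreover have "drop c (aut p0 w) = drop c w"
      using aut_append_shallow[of c p0 "take c w" "drop c w"] False by (simp add: p0_def)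
    ultimately show ?thesis using False
      by (simp add: spread_def take_aut bij_comp_inverse_map[OF b0] short)
  qed (simp add: spread_def short)
qed

section \<open>Automorphisms with prescribed local groups\<close>

text \<open>These maps make up the rigid stabilizer of \<open>v\<close>.\<close>

definition at_vertex :: "'a list \<Rightarrow> ('a list \<Rightarrow> 'a list) \<Rightarrow> 'a list \<Rightarrow> 'a list"
  where "at_vertex v t = spread (length v) (\<lambda>w. if w = v then t else id)"

lemma at_vertex_aut:
  fixes f :: "'a \<Rightarrow> 'a"
  shows "at_vertex v (aut (\<lambda>u. if u = [] then f else id)) = aut (\<lambda>u. if u = v then f else id)"
proof -
  have "aut (\<lambda>u. if u = v then f else id) =
      spread (length v) (\<lambda>w. aut (\<lambda>u. if w @ u = v then f else id))"
    by (rule aut_eq_spread) auto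
  also have "\<dots> = at_vertex v (aut (\<lambda>u. if u = [] then f else id))"
    unfolding at_vertex_def
  proof (rule spread_cong)
    fix w :: "'a list" assume "length w = length v"
    then have "w @ u = v \<longleftrightarrow> w = v \<and> u = []" for u by auto
    then show "aut (\<lambda>u. if w @ u = v then f else id) =
        (if w = v then aut (\<lambda>u. if u = [] then f else id) else id)"
      by simp
  qed
  finally show ?thesis ..
qed

lemma at_vertex_comp: "at_vertex x s \<circ> at_vertex x t = at_vertex x (s \<circ> t)"
  unfolding at_vertex_def spread_comp by (rule spread_cong) simp

lemma at_vertex_id: "at_vertex x id = id"
  unfolding at_vertex_def by (rule spread_id) simp

lemma at_vertex_inverse: "bij s \<Longrightarrow> inverse_map (at_vertex x s) = at_vertex x (inverse_map s)"
  by (rule inv_unique_comp)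
    (simp_all add: at_vertex_comp at_vertex_id bij_comp_inverse_map)

section \<open>Words over a shifted sequence of alphabets\<close>

lemma words_append:
  "v @ u \<in> words (\<lambda>i. X (k + i)) (length v + length u) \<longleftrightarrow>
    v \<in> words (\<lambda>i. X (k + i)) (length v) \<and> u \<in> words (\<lambda>i. X (k + length v + i)) (length u)"
proof -
  have "(\<forall>i<length v + length u. (v @ u) ! i \<in> X (k + i)) \<longleftrightarrow>
      (\<forall>i<length v. v ! i \<in> X (k + i)) \<and> (\<forall>i<length u. u ! i \<in> X (k + length v + i))"
    (is "?L \<longleftrightarrow> ?R")
  proof
    assume L: ?L
    have "u ! i \<in> X (k + length v + i)" if "i < length u" for i
      using L[rule_format, of "length v + i"] that by (simp add: nth_append add.assoc)
    moreover have "v ! i \<in> X (k + i)" if "i < length v" for i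
      using L[rule_format, of i] that by (simp add: nth_append)
    ultimately show ?R by blast
  next
    assume R: ?R
    show ?L
    proof (intro allI impI)
      fix i assume "i < length v + length u"
      then show "(v @ u) ! i \<in> X (k + i)"
        using R[THEN conjunct1, rule_format, of i] R[THEN conjunct2, rule_format, of "i - length v"]
        by (auto simp: nth_append)
    qed
  qed
  then show ?thesis by (simp add: words_def)
qed

lemma finite_words: "(\<And>n. finite (X n)) \<Longrightarrow> finite (words X n)"
proof (induction n)
  case 0
  have "words X 0 = {[]}" by (auto simp: words_def)
  then show ?case by simp
next
  case (Suc n)
  have "words X (Suc n) = (\<lambda>(v, x). v @ [x]) ` (words X n \<times> X n)"
    by (auto simp: words_Suc image_iff)
  then show ?case using Suc by simp
qed

lemma map_upt_in_words:
  assumes "\<And>i. k \<le> i \<Longrightarrow> i < n \<Longrightarrow> f i \<in> X i"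
  shows "map f [k..<n] \<in> words (\<lambda>i. X (k + i)) (n - k)"
  using assms by (simp add: words_def)

locale perm_tower =
  fixes G :: "nat \<Rightarrow> ('g, 'm) monoid_scheme" and X :: "nat \<Rightarrow> 'a set"
    and \<phi> :: "nat \<Rightarrow> 'g \<Rightarrow> 'a \<Rightarrow> 'a"
  assumes perm: "finite_transitive_perm_group (G n) (X n) (\<phi> n)"
begin

section \<open>Local permutations and their extension to all letters\<close>

lemma action: "group_action (G n) (X n) (\<phi> n)"
  and inj_action: "inj_on (\<phi> n) (carrier (G n))"
  and finite_X: "finite (X n)" and X_nonempty: "X n \<noteq> {}"
  and transitive: "x \<in> X n \<Longrightarrow> y \<in> X n \<Longrightarrow> \<exists>g\<in>carrier (G n). \<phi> n g x = y"
  using perm[of n]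
  by (simp_all add: finite_transitive_perm_group_def faithful_action_def faithful_action_axioms_def
      transitive_action_def transitive_action_axioms_def)

lemma group_hom_action: "group_hom (G n) (BijGroup (X n)) (\<phi> n)"
  using action by (simp add: group_action_def)

lemma group_G: "group (G n)"
  using group_hom_action group_hom.axioms(1) by blast

lemmas G_closed = monoid.m_closed[OF group.is_monoid[OF group_G]]
  monoid.one_closed[OF group.is_monoid[OF group_G]] group.inv_closed[OF group_G]

lemma action_Bij: "g \<in> carrier (G n) \<Longrightarrow> \<phi> n g \<in> Bij (X n)"
  using group_action.bij_prop0[OF action] .

lemma finite_G: "finite (carrier (G n))"
proof -
  have "\<phi> n g \<in> (\<Pi>\<^sub>E i\<in>X n. X n)" if "g \<in> carrier (G n)" for g
    using Bij_imp_extensional[OF action_Bij[OF that]] Bij_imp_funcset[OF action_Bij[OF that]]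
    by (simp add: PiE_def)
  then have "\<phi> n ` carrier (G n) \<subseteq> (\<Pi>\<^sub>E i\<in>X n. X n)" by blast
  then have "finite (\<phi> n ` carrier (G n))"
    by (rule finite_subset) (intro finite_PiE finite_X)
  then show ?thesis using inj_action finite_image_iff by blast
qed

text \<open>Elements of \<open>BijGroup (X n)\<close> take the value \<open>undefined\<close>
  outside \<open>X n\<close>. Extension by the identity yields bijections of the whole letter type,
  for which plain composition and inversion can be used.\<close>

definition act :: "nat \<Rightarrow> 'g \<Rightarrow> 'a \<Rightarrow> 'a"
  where "act n g x = (if x \<in> X n then \<phi> n g x else x)"

lemma restrict_act: "g \<in> carrier (G n) \<Longrightarrow> restrict (act n g) (X n) = \<phi> n g"
  using action_Bij[of g n]
  by (auto simp: fun_eq_iff act_def Bij_def extensional_def)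

lemma act_one: "act n \<one>\<^bsub>G n\<^esub> = id"
  using group_hom.hom_one[OF group_hom_action, of n]
  by (auto simp: fun_eq_iff act_def one_BijGroup)

lemma act_mult:
  assumes "g \<in> carrier (G n)" "h \<in> carrier (G n)"
  shows "act n (g \<otimes>\<^bsub>G n\<^esub> h) = act n g \<circ> act n h"
proof -
  have "\<phi> n (g \<otimes>\<^bsub>G n\<^esub> h) = compose (X n) (\<phi> n g) (\<phi> n h)"
    using group_hom.hom_mult[OF group_hom_action] assms action_Bij mult_BijGroup by metis
  moreover have "\<phi> n h x \<in> X n" if "x \<in> X n" for x
    using that Bij_imp_funcset[OF action_Bij[OF assms(2)]] by blast
  ultimately show ?thesis by (auto simp: fun_eq_iff act_def compose_def)
qed

lemma act_inverse:
  assumes g: "g \<in> carrier (G n)"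
  shows "bij (act n g)" "act n (inv\<^bsub>G n\<^esub> g) = inverse_map (act n g)"
proof -
  interpret group "G n" by (rule group_G)
  have *: "act n (inv\<^bsub>G n\<^esub> g) \<circ> act n g = id" "act n g \<circ> act n (inv\<^bsub>G n\<^esub> g) = id"
    using g by (simp_all add: act_mult[symmetric] act_one)
  then show "bij (act n g)" by (rule o_bij)
  show "act n (inv\<^bsub>G n\<^esub> g) = inverse_map (act n g)"
    using * by (intro inv_unique_comp[symmetric])
qed

lemma act_in_iff: "g \<in> carrier (G n) \<Longrightarrow> act n g x \<in> X n \<longleftrightarrow> x \<in> X n"
  using Bij_imp_funcset[OF action_Bij] by (auto simp: act_def)

lemma act_singleton:
  assumes g: "g \<in> carrier (G n)" and X: "X n = {x}"
  shows "act n g = id"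
proof -
  have "act n g y = y" for y
    using act_in_iff[OF g, of y] X by (cases "y \<in> X n") (auto simp: act_def)
  then show ?thesis by auto
qed

lemma act_transitive: "x \<in> X n \<Longrightarrow> y \<in> X n \<Longrightarrow> \<exists>g\<in>carrier (G n). act n g x = y"
  using transitive by (simp add: act_def)

lemma id_in_act: "id \<in> act n ` carrier (G n)"
  using act_one[of n] G_closed by (metis imageI)

abbreviation W :: "nat \<Rightarrow> nat \<Rightarrow> 'a list set"
  where "W k n \<equiv> words (\<lambda>i. X (k + i)) n"

lemma finite_W: "finite (W k n)"
  by (intro finite_words finite_X)

text \<open>A word \<open>u\<close> stands at level \<open>k + length u\<close> of the whole tree,
  so one notion serves all subtrees. Triviality off the legal words leaves only finitely many
  portraits with a given bound on the depth.\<close>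

definition portrait :: "nat \<Rightarrow> ('a list \<Rightarrow> 'a \<Rightarrow> 'a) \<Rightarrow> bool"
  where "portrait k p \<longleftrightarrow> (\<forall>u. p u \<in> act (k + length u) ` carrier (G (k + length u)) \<and>
    (u \<notin> W k (length u) \<longrightarrow> p u = id))"

text \<open>
  In \<open>T k N\<close>, the automorphisms of the subtree below a vertex of level \<open>k\<close> that are trivial from
  level \<open>N\<close> on, levels are counted in the whole tree.
\<close>

definition T :: "nat \<Rightarrow> nat \<Rightarrow> ('a list \<Rightarrow> 'a list) set"
  where "T k N = {aut p | p. portrait k p \<and> (\<forall>u. N \<le> k + length u \<longrightarrow> p u = id)}"

lemma aut_in_T:
  "portrait k p \<Longrightarrow> (\<And>u. N \<le> k + length u \<Longrightarrow> p u = id) \<Longrightarrow> aut p \<in> T k N"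
  unfolding T_def by blast

lemma portraitD:
  assumes "portrait k p"
  shows "bij (p u)" "u \<notin> W k (length u) \<Longrightarrow> p u = id"
    "\<exists>g\<in>carrier (G (k + length u)). p u = act (k + length u) g"
    "p u x \<in> X (k + length u) \<longleftrightarrow> x \<in> X (k + length u)"
proof -
  show *: "\<exists>g\<in>carrier (G (k + length u)). p u = act (k + length u) g"
    using assms by (auto simp: portrait_def)
  show "bij (p u)" "p u x \<in> X (k + length u) \<longleftrightarrow> x \<in> X (k + length u)"
    using * act_inverse(1) act_in_iff by metis+
  show "u \<notin> W k (length u) \<Longrightarrow> p u = id" using assms by (auto simp: portrait_def)
qed

section \<open>Portraits under composition, inversion and passage to sections\<close>

lemma portrait_id: "portrait k (\<lambda>_. id)"
  by (simp add: portrait_def id_in_act)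

lemma bij_aut_portrait: "portrait k p \<Longrightarrow> bij (aut p)"
  using bij_aut portraitD(1) by blast

lemma aut_in_W:
  assumes "portrait k p"
  shows "aut p u \<in> W k n \<longleftrightarrow> u \<in> W k n"
proof -
  have "aut p u ! i \<in> X (k + i) \<longleftrightarrow> u ! i \<in> X (k + i)" if "i < length u" for i
    using portraitD(4)[OF assms, of "take i u" "u ! i"] that by (simp add: nth_aut)
  then show ?thesis by (auto simp: words_def)
qed

lemma inverse_aut_W:
  assumes "portrait k p"
  shows "length (inverse_map (aut p) u) = length u"
    "inverse_map (aut p) u \<in> W k n \<longleftrightarrow> u \<in> W k n"
  using bij_comp_inverse_map(3)[OF bij_aut_portrait[OF assms], of u]
    length_aut[of p "inverse_map (aut p) u"] aut_in_W[OF assms, of "inverse_map (aut p) u" n]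
  by simp_all

lemma portrait_comp:
  assumes p: "portrait k p" and q: "portrait k q"
  shows "portrait k (\<lambda>u. p (aut q u) \<circ> q u)"
  unfolding portrait_def
proof (intro allI conjI impI)
  fix u
  obtain g h where "g \<in> carrier (G (k + length u))" "p (aut q u) = act (k + length u) g"
      "h \<in> carrier (G (k + length u))" "q u = act (k + length u) h"
    using portraitD(3)[OF p, of "aut q u"] portraitD(3)[OF q, of u] by auto
  then show "p (aut q u) \<circ> q u \<in> act (k + length u) ` carrier (G (k + length u))"
    using G_closed(1) by (simp add: act_mult[symmetric])
next
  fix u assume "u \<notin> W k (length u)"
  then show "p (aut q u) \<circ> q u = id"
    using portraitD(2)[OF p, of "aut q u"] portraitD(2)[OF q, of u] aut_in_W[OF q] by simp
qed

lemma portrait_inverse: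
  assumes p: "portrait k p"
  shows "portrait k (\<lambda>u. inverse_map (p (inverse_map (aut p) u)))"
  unfolding portrait_def
proof (intro allI conjI impI)
  fix u
  obtain g where "g \<in> carrier (G (k + length u))" "p (inverse_map (aut p) u) = act (k + length u) g"
    using portraitD(3)[OF p, of "inverse_map (aut p) u"] inverse_aut_W[OF p] by auto
  then show "inverse_map (p (inverse_map (aut p) u)) \<in> act (k + length u) ` carrier (G (k + length u))"
    using G_closed(3) by (simp add: act_inverse(2)[symmetric])
next
  fix u assume "u \<notin> W k (length u)"
  then show "inverse_map (p (inverse_map (aut p) u)) = id"
    using portraitD(2)[OF p, of "inverse_map (aut p) u"] inverse_aut_W[OF p] by simp
qed

lemma transf_group_T: "transf_group (T k N)"
  unfolding transf_group_def
proof (intro conjI ballI)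
  have "aut (\<lambda>_. id) \<in> T k N" unfolding T_def using portrait_id by blast
  then show "id \<in> T k N" by simp
next
  fix f g assume "f \<in> T k N" "g \<in> T k N"
  then obtain p q where p: "f = aut p" "portrait k p" "\<forall>u. N \<le> k + length u \<longrightarrow> p u = id"
    and q: "g = aut q" "portrait k q" "\<forall>u. N \<le> k + length u \<longrightarrow> q u = id"
    by (auto simp: T_def)
  then show "f \<circ> g \<in> T k N"
    unfolding T_def
    by (auto simp: aut_comp portrait_comp intro!: exI[of _ "\<lambda>u. p (aut q u) \<circ> q u"])
next
  fix f assume "f \<in> T k N"
  then obtain p where p: "f = aut p" "portrait k p" "\<forall>u. N \<le> k + length u \<longrightarrow> p u = id"
    by (auto simp: T_def)
  then show "bij f" using bij_aut_portrait by simp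
  have "f = aut p" "inverse_map f = aut (\<lambda>u. inverse_map (p (inverse_map (aut p) u)))"
    using p(1) inverse_aut[of p, OF portraitD(1)[OF p(2)]] by simp_all
  then show "inverse_map f \<in> T k N"
    unfolding T_def using p portrait_inverse[OF p(2)] inverse_aut_W(1)[OF p(2)] by auto
qed

lemmas T_closed = transf_groupD[OF transf_group_T]

lemma T_trivial: "N \<le> k \<Longrightarrow> T k N \<subseteq> {id}"
proof
  fix f assume "N \<le> k" "f \<in> T k N"
  then obtain p where "f = aut p" "\<forall>u. p u = id" by (auto simp: T_def)
  then have "f = aut (\<lambda>_. id)" by (metis ext)
  then show "f \<in> {id}" by simp
qed

lemma portrait_section:
  assumes "portrait k p"
  shows "portrait (k + length v) (\<lambda>u. p (v @ u))"
    "v \<notin> W k (length v) \<Longrightarrow> p (v @ u) = id"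
proof -
  have "p (v @ u) = id" if "v \<notin> W k (length v) \<or> u \<notin> W (k + length v) (length u)" for u
    using portraitD(2)[OF assms, of "v @ u"] that words_append[of v u X k] by auto
  then show "portrait (k + length v) (\<lambda>u. p (v @ u))" "v \<notin> W k (length v) \<Longrightarrow> p (v @ u) = id"
    using portraitD(3)[OF assms, of "v @ u" for u] by (auto simp: portrait_def add.assoc)
qed

lemma T_section:
  assumes "portrait k p" "\<And>u. N \<le> k + length u \<Longrightarrow> p u = id"
  shows "aut (\<lambda>u. p (v @ u)) \<in> T (k + length v) N"
    "v \<notin> W k (length v) \<Longrightarrow> aut (\<lambda>u. p (v @ u)) = id"
proof -
  show "aut (\<lambda>u. p (v @ u)) \<in> T (k + length v) N"
    using portrait_section(1)[OF assms(1), of v] assms(2) by (auto simp: T_def)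
  assume "v \<notin> W k (length v)"
  then have "(\<lambda>u. p (v @ u)) = (\<lambda>_. id)" using portrait_section(2)[OF assms(1)] by blast
  then show "aut (\<lambda>u. p (v @ u)) = id" by simp
qed

lemma T_transitive:
  assumes v: "v \<in> W k n" and w: "w \<in> W k n"
  shows "\<exists>f\<in>T k (k + n). f v = w"
proof -
  have len: "length v = n" "length w = n" using v w by (auto simp: words_def)
  have "\<exists>g. g \<in> carrier (G (k + i)) \<and> act (k + i) g (v ! i) = w ! i" if "i < n" for i
    using act_transitive[of "v ! i" "k + i" "w ! i"] v w that by (auto simp: words_def)
  then obtain g where g: "\<And>i. i < n \<Longrightarrow> g i \<in> carrier (G (k + i))"
    "\<And>i. i < n \<Longrightarrow> act (k + i) (g i) (v ! i) = w ! i" by metis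
  \<comment> \<open>The image of \<open>v\<close> depends only on the portrait at proper prefixes of
    \<open>v\<close>, so one local permutation per level is placed there.\<close>
  define p where "p u = (if length u < n \<and> u = take (length u) v
    then act (k + length u) (g (length u)) else id)" for u
  have "take i v \<in> W k i" if "i \<le> n" for i
    using v that by (auto simp: words_def)
  then have "u \<in> W k (length u)" if "length u < n" "u = take (length u) v" for u
    using that by (metis less_imp_le)
  then have "portrait k p" using g(1) id_in_act by (auto simp: portrait_def p_def)
  moreover have "aut p v = w"
    by (rule nth_equalityI) (auto simp: len nth_aut p_def g(2))
  ultimately show ?thesis by (intro bexI[of _ "aut p"]) (auto simp: T_def p_def)
qed

lemma finite_T: "finite (T k N)"
proof -
  let ?A = "\<Union>n\<in>{..<N}. W k n" and ?B = "\<Union>n\<in>{..<N}. act n ` carrier (G n)"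
  let ?P = "{p. \<forall>u. (u \<in> ?A \<longrightarrow> p u \<in> insert id ?B) \<and> (u \<notin> ?A \<longrightarrow> p u = id)}"
  have "finite ?P"
    by (rule finite_set_of_finite_funs) (auto simp: finite_G finite_W)
  moreover have "T k N \<subseteq> aut ` ?P"
  proof
    fix f assume "f \<in> T k N"
    then obtain p where p: "f = aut p" "portrait k p" "\<And>u. N \<le> k + length u \<Longrightarrow> p u = id"
      by (auto simp: T_def)
    have "p u \<in> insert id ?B" for u
      using portraitD(3)[OF p(2), of u] p(3)[of u] by (cases "k + length u < N") auto
    moreover have "p u = id" if "u \<notin> ?A" for u
      using portraitD(2)[OF p(2), of u] p(3)[of u] that by (cases "k + length u < N") auto
    ultimately show "f \<in> aut ` ?P" using p(1) by blast
  qed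
  ultimately show ?thesis using finite_subset by blast
qed

section \<open>Moving sections between vertices and generation level by level\<close>

lemma T_conj_spread:
  assumes f: "f \<in> T k (k + c)"
  shows "f \<circ> spread c h \<circ> inverse_map f = spread c (\<lambda>v. h (inverse_map f v))"
proof -
  obtain p where p: "f = aut p" "portrait k p" "\<And>u. k + c \<le> k + length u \<Longrightarrow> p u = id"
    using f by (auto simp: T_def)
  show ?thesis unfolding p(1)
    by (rule aut_conj_spread) (use p portraitD(1)[OF p(2)] in auto)
qed

text \<open>Conjugate by an element of the top group that carries \<open>v\<close> to
  \<open>w\<close>; by \<open>T_conj_spread\<close> the section \<open>t\<close> arrives
  unchanged.\<close>

lemma at_vertex_transport:
  assumes H: "transf_group H" and top: "T k (k + c) \<subseteq> H"
    and v: "v \<in> W k c" and w: "w \<in> W k c" and t: "at_vertex v t \<in> H"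
  shows "at_vertex w t \<in> H"
proof -
  have len: "length v = c" "length w = c" using v w by (auto simp: words_def)
  obtain f where f: "f \<in> T k (k + c)" "f v = w" using T_transitive[OF v w] by blast
  have "inverse_map f u = v \<longleftrightarrow> u = w" for u
    using f bij_comp_inverse_map[OF T_closed(3)[OF f(1)]] by metis
  then have "f \<circ> at_vertex v t \<circ> inverse_map f = at_vertex w t"
    using T_conj_spread[OF f(1)] by (simp add: at_vertex_def len)
  moreover have "f \<in> H" using f(1) top by blast
  then have "f \<circ> at_vertex v t \<circ> inverse_map f \<in> H"
    by (intro transf_groupD(2)[OF H] transf_groupD(4)[OF H] t)
  ultimately show ?thesis by simp
qed

text \<open>The top group is transitive on the level, so free access below one vertex gives free
  access below all of them. Products of the resulting maps with the top group exhaust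
  \<open>T k N\<close>.\<close>

lemma T_subset_if_vertex:
  assumes H: "transf_group H" and top: "T k (k + c) \<subseteq> H" and v: "v \<in> W k c"
    and exact: "\<And>t. t \<in> T (k + c) N \<Longrightarrow> at_vertex v t \<in> H" and le: "k + c \<le> N"
  shows "T k N \<subseteq> H"
proof
  have fin: "spread c (\<lambda>w. if w \<in> F then h w else id) \<in> H"
    if "finite F" "F \<subseteq> W k c" "\<And>w. w \<in> F \<Longrightarrow> h w \<in> T (k + c) N" for F h
    using that
  proof (induction F)
    case empty
    have *: "spread c (\<lambda>w. if w \<in> {} then h w else id) = id" by (rule spread_id) simp
    show ?case unfolding * by (rule transf_groupD(1)[OF H])
  next
    case (insert w F)
    let ?f = "\<lambda>F. spread c (\<lambda>u. if u \<in> F then h u else id)"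
    have w: "w \<in> W k c" "length w = c" using insert.prems by (auto simp: words_def)
    have "at_vertex w (h w) \<in> H"
      using at_vertex_transport[OF H top v w(1)] exact insert.prems(2) by blast
    moreover have "?f F \<in> H" using insert.IH insert.prems by blast
    ultimately have "at_vertex w (h w) \<circ> ?f F \<in> H" by (rule transf_groupD(2)[OF H])
    moreover have eq: "at_vertex w (h w) \<circ> ?f F = ?f (insert w F)"
      unfolding at_vertex_def w(2) spread_comp
      by (rule spread_cong) (use insert.hyps in simp)
    ultimately show ?case by (simp only: eq)
  qed
  fix f assume "f \<in> T k N"
  then obtain p where p: "f = aut p" "portrait k p" "\<And>u. N \<le> k + length u \<Longrightarrow> p u = id"
    by (auto simp: T_def)
  define p0 where "p0 u = (if length u < c then p u else id)" for u
  define h where "h v = aut (\<lambda>u. p (inverse_map (aut p0) v @ u))" for v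
  have p0_eq: "p0 = (\<lambda>u. if length u < c then p u else id)" by (rule ext) (rule p0_def)
  have h_eq: "h = (\<lambda>v. aut (\<lambda>u. p (inverse_map (aut p0) v @ u)))" by (rule ext) (rule h_def)
  have f: "f = spread c h \<circ> aut p0"
    unfolding p(1) h_eq p0_eq by (rule aut_split) (rule portraitD(1)[OF p(2)])
  have p0: "portrait k p0"
    using p(2) by (auto simp: portrait_def p0_def id_in_act)
  then have "aut p0 \<in> T k (k + c)" by (auto simp: T_def p0_def)
  moreover have "spread c h \<in> H"
  proof -
    have "h w \<in> T (k + c) N" if "w \<in> W k c" for w
      using T_section(1)[OF p(2,3), where v = "inverse_map (aut p0) w"] that inverse_aut_W(1)[OF p0]
      by (simp add: h_def words_def)
    \<comment> \<open>Words outside the tree carry trivial sections, so a product over the finite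
      set \<open>W k c\<close> already gives \<open>spread c h\<close>.\<close>
    moreover have "h w = id" if "length w = c" "w \<notin> W k c" for w
      using T_section(2)[OF p(2,3), where v = "inverse_map (aut p0) w"] that inverse_aut_W[OF p0]
      by (simp add: h_def)
    then have "spread c h = spread c (\<lambda>w. if w \<in> W k c then h w else id)"
      by (intro spread_cong) auto
    ultimately show ?thesis using fin[OF finite_W subset_refl] by simp
  qed
  ultimately show "f \<in> H" using f top transf_groupD(2)[OF H] by blast
qed

lemma T_one_level:
  assumes "t \<in> T n (Suc n)"
  shows "\<exists>g\<in>carrier (G n). t = aut (\<lambda>u. if u = [] then act n g else id)"
proof -
  obtain p where p: "t = aut p" "portrait n p" "\<And>u. Suc n \<le> n + length u \<Longrightarrow> p u = id"
    using assms by (auto simp: T_def)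
  obtain g where "g \<in> carrier (G n)" "p [] = act n g" using portraitD(3)[OF p(2), of "[]"] by auto
  moreover from this have "p = (\<lambda>u. if u = [] then act n g else id)"
    using p(3) by (auto simp: fun_eq_iff Suc_le_eq)
  ultimately show ?thesis using p(1) by blast
qed

text \<open>One vertex per level is enough: by induction the earlier levels are available and act
  transitively, and they spread the permutations at one vertex over the whole last level.\<close>

lemma T_generated:
  assumes H: "transf_group H"
    and gen: "\<And>n. k \<le> n \<Longrightarrow> n < N \<Longrightarrow> \<exists>v\<in>W k (n - k). \<forall>g\<in>carrier (G n).
      aut (\<lambda>u. if u = v then act n g else id) \<in> H"
  shows "T k N \<subseteq> H"
  using gen
proof (induction N)
  case 0
  then show ?case using T_trivial[of 0 k] transf_groupD(1)[OF H] by auto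
next
  case (Suc N)
  show ?case
  proof (cases "k \<le> N")
    case True
    then obtain v where v: "v \<in> W k (N - k)"
      "\<And>g. g \<in> carrier (G N) \<Longrightarrow> aut (\<lambda>u. if u = v then act N g else id) \<in> H"
      using Suc.prems by blast
    show ?thesis
    proof (rule T_subset_if_vertex[OF H _ v(1)])
      show "T k (k + (N - k)) \<subseteq> H" using Suc True by simp
      show "at_vertex v t \<in> H" if t: "t \<in> T (k + (N - k)) (Suc N)" for t
      proof -
        obtain g where "g \<in> carrier (G N)" "t = aut (\<lambda>u. if u = [] then act N g else id)"
          using T_one_level[of t N] t True by auto
        then show ?thesis using v(2) by (simp only: at_vertex_aut)
      qed
    qed (use True in simp)
  next
    case False
    then show ?thesis using T_trivial[of "Suc N" k] transf_groupD(1)[OF H] by auto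
  qed
qed

end

section \<open>Directed automorphisms\<close>

text \<open>Block \<open>j\<close> consists of the levels \<open>c j, \<dots>, c (Suc j) - 1\<close>.\<close>

locale block_tower = perm_tower G X \<phi>
  for G :: "nat \<Rightarrow> ('g, 'm) monoid_scheme" and X :: "nat \<Rightarrow> 'a set"
    and \<phi> :: "nat \<Rightarrow> 'g \<Rightarrow> 'a \<Rightarrow> 'a" +
  fixes c a b :: "nat \<Rightarrow> nat" and o1 o2 :: "nat \<Rightarrow> 'a"
  assumes block_order: "c j \<le> a j" "a j < b j" "b j < c (Suc j)"
    and letters: "o1 n \<in> X n" "o2 n \<in> X n"
    and distinct_letters: "o1 (a j) \<noteq> o2 (a j)" "o1 (b j) \<noteq> o2 (b j)"
    and singleton: "c j \<le> n \<Longrightarrow> n < c (Suc j) \<Longrightarrow> n \<noteq> a j \<Longrightarrow> n \<noteq> b j \<Longrightarrow> X n = {o1 n}"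
begin

section \<open>Block boundaries and words along the spine\<close>

lemma c_less: "c j < c (Suc j)"
  using block_order[of j] by simp

lemma c_mono: "i \<le> j \<Longrightarrow> c i \<le> c j"
  by (rule lift_Suc_mono_le) (simp_all add: c_less less_imp_le)

lemma block_level:
  assumes "e \<in> {a, b}"
  shows "c j \<le> e j" "e j < c (Suc j)"
  using assms block_order[of j] by auto

lemma a_less_level:
  assumes "e \<in> {a, b}"
  shows "a i < e (Suc i)" "c i \<le> e (Suc i)"
  using block_level[OF assms, of "Suc i"] block_order[of i] by auto

definition spine :: "nat \<Rightarrow> nat \<Rightarrow> 'a list"
  where "spine k n = map o1 [k..<n]"

text \<open>If \<open>i\<close> lies outside the range this is the spine itself, so one formula
  describes a path before, at and after the level where it leaves the spine.\<close>

definition offspine :: "nat \<Rightarrow> nat \<Rightarrow> nat \<Rightarrow> 'a list"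
  where "offspine k i n = map (\<lambda>l. if l = i then o2 l else o1 l) [k..<n]"

lemma spine_in_W: "spine k n \<in> W k (n - k)"
  and offspine_in_W: "offspine k i n \<in> W k (n - k)"
  unfolding spine_def offspine_def by (rule map_upt_in_words; simp add: letters)+

lemma length_spine [simp]: "length (spine k n) = n - k" "length (offspine k i n) = n - k"
  by (simp_all add: spine_def offspine_def)

lemma nth_spine:
  "k \<le> l \<Longrightarrow> l < n \<Longrightarrow> spine k n ! (l - k) = o1 l"
  "k \<le> l \<Longrightarrow> l < n \<Longrightarrow> offspine k i n ! (l - k) = (if l = i then o2 l else o1 l)"
  by (simp_all add: spine_def offspine_def)

lemma offspine_append:
  assumes "k \<le> m" "m \<le> n"
  shows "offspine k i n = offspine k i m @ offspine m i n"
proof -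
  have "[k..<n] = [k..<m] @ [m..<n]" using assms upt_add_eq_append[of k m "n - m"] by simp
  then show ?thesis by (simp add: offspine_def)
qed

lemma offspine_eq_spine: "i < k \<or> n \<le> i \<Longrightarrow> offspine k i n = spine k n"
  by (auto simp: offspine_def spine_def)

lemma take_offspine: "take l (offspine k i n) = offspine k i (min (k + l) n)"
  by (cases "k + l \<le> n") (auto simp: offspine_def take_map min_def)

text \<open>At the end of block \<open>j\<close> the spine runs through \<open>x_word j\<close>. The
  path that leaves it at level \<open>a j\<close> runs through \<open>y_word j\<close>, below which
  directed automorphisms place their permutations of the next block.\<close>

abbreviation x_word :: "nat \<Rightarrow> 'a list"
  where "x_word j \<equiv> spine (c j) (c (Suc j))"

abbreviation y_word :: "nat \<Rightarrow> 'a list"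
  where "y_word j \<equiv> offspine (c j) (a j) (c (Suc j))"

lemma y_word_neq: "y_word j \<noteq> x_word j"
proof -
  have "c j \<le> a j" "a j < c (Suc j)" using block_order[of j] by auto
  then have "y_word j ! (a j - c j) \<noteq> x_word j ! (a j - c j)"
    using distinct_letters(1)[of j] by (simp add: nth_spine)
  then show ?thesis by metis
qed

lemma xy_in_W: "x_word j \<in> W (c j) (c (Suc j) - c j)" "y_word j \<in> W (c j) (c (Suc j) - c j)"
  by (rule spine_in_W, rule offspine_in_W)

text \<open>In use, \<open>e\<close> is \<open>a\<close> or \<open>b\<close> and selects one of the
  two nontrivial levels of a block.\<close>

definition root :: "(nat \<Rightarrow> nat) \<Rightarrow> nat \<Rightarrow> 'g \<Rightarrow> 'a list \<Rightarrow> 'a list"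
  where "root e j g = aut (\<lambda>u. if u = spine (c j) (e j) then act (e j) g else id)"

text \<open>\<open>I\<close> lists the blocks that may carry permutations: \<open>UNIV\<close> for
  an infinite directed automorphism, \<open>{..<J}\<close> for its truncation at level
  \<open>c J\<close>. The vertex used in block \<open>Suc i\<close> has left the spine one block
  earlier.\<close>

definition active :: "nat set \<Rightarrow> (nat \<Rightarrow> nat) \<Rightarrow> nat \<Rightarrow> 'a list \<Rightarrow> bool"
  where "active I e j u \<longleftrightarrow> (\<exists>i\<ge>j. Suc i \<in> I \<and> u = offspine (c j) (a i) (e (Suc i)))"

definition dir_portrait :: "nat set \<Rightarrow> (nat \<Rightarrow> nat) \<Rightarrow> nat \<Rightarrow> (nat \<Rightarrow> 'g) \<Rightarrow> 'a list \<Rightarrow> 'a \<Rightarrow> 'a"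
  where "dir_portrait I e j g u =
    (if active I e j u then act (c j + length u) (g (c j + length u)) else id)"

text \<open>
  The element \<open>dir I e j g\<close> follows the spine. Its portrait at level \<open>e (Suc i)\<close> sits on the
  vertex leaving the spine at level \<open>a i\<close>. Treating the levels \<open>a (Suc i)\<close> and \<open>b (Suc i)\<close> in
  separate elements makes these vertices pairwise incomparable, so that \<open>dir I e j\<close> is a
  homomorphism.
\<close>

definition dir :: "nat set \<Rightarrow> (nat \<Rightarrow> nat) \<Rightarrow> nat \<Rightarrow> (nat \<Rightarrow> 'g) \<Rightarrow> 'a list \<Rightarrow> 'a list"
  where "dir I e j g = aut (dir_portrait I e j g)"

abbreviation seqs :: "(nat \<Rightarrow> 'g) set"
  where "seqs \<equiv> {g. \<forall>n. g n \<in> carrier (G n)}"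

lemma root_mult:
  assumes "g \<in> carrier (G (e j))" "h \<in> carrier (G (e j))"
  shows "root e j (g \<otimes>\<^bsub>G (e j)\<^esub> h) = root e j g \<circ> root e j h"
proof -
  let ?s = "spine (c j) (e j)"
  have R: "root e j k = at_vertex ?s (aut (\<lambda>u. if u = [] then act (e j) k else id))" for k
    by (simp only: root_def at_vertex_aut)
  have "aut (\<lambda>u. if u = [] then act (e j) (g \<otimes>\<^bsub>G (e j)\<^esub> h) else id) =
      aut (\<lambda>u. if u = [] then act (e j) g else id) \<circ> aut (\<lambda>u. if u = [] then act (e j) h else id)"
    unfolding aut_comp
  proof (rule arg_cong[of _ _ aut], rule ext)
    fix u
    have "aut (\<lambda>u. if u = [] then act (e j) h else id) u = [] \<longleftrightarrow> u = []"
      by (metis length_aut length_0_conv)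
    then show "(if u = [] then act (e j) (g \<otimes>\<^bsub>G (e j)\<^esub> h) else id) =
        (if aut (\<lambda>u. if u = [] then act (e j) h else id) u = [] then act (e j) g else id) \<circ>
        (if u = [] then act (e j) h else id)"
      using act_mult[OF assms] by simp
  qed
  then show ?thesis
    unfolding R at_vertex_def spread_comp by (intro spread_cong) simp
qed

lemma portrait_vertex:
  assumes "v \<in> W k n" "g \<in> carrier (G (k + n))"
  shows "portrait k (\<lambda>u. if u = v then act (k + n) g else id)"
proof -
  have "length v = n" using assms(1) by (simp add: words_def)
  then show ?thesis using assms id_in_act by (auto simp: portrait_def)
qed

lemma vertex_in_T:
  assumes "v \<in> W k n" "g \<in> carrier (G (k + n))" "k + n < N"
  shows "aut (\<lambda>u. if u = v then act (k + n) g else id) \<in> T k N"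
proof -
  have "length v = n" using assms(1) by (simp add: words_def)
  then show ?thesis using portrait_vertex[OF assms(1,2)] assms(3) by (intro aut_in_T) auto
qed

lemma root_in_T:
  assumes e: "e \<in> {a, b}" and g: "g \<in> carrier (G (e j))" and N: "c (Suc j) \<le> N"
  shows "root e j g \<in> T (c j) N"
proof -
  have "c j + (e j - c j) = e j" using block_level[OF e, of j] by simp
  from vertex_in_T[OF spine_in_W[of "c j" "e j"], of g N, unfolded this] show ?thesis
    using block_level[OF e, of j] g N by (simp add: root_def)
qed

lemma active_level:
  assumes e: "e \<in> {a, b}" and u: "active I e j u"
  shows "\<exists>i\<ge>j. Suc i \<in> I \<and> c j + length u = e (Suc i) \<and> u = offspine (c j) (a i) (e (Suc i))"
proof -
  obtain i where i: "j \<le> i" "Suc i \<in> I" "u = offspine (c j) (a i) (e (Suc i))"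
    using u by (auto simp: active_def)
  then have "c j \<le> e (Suc i)" using c_mono[of j i] a_less_level(2)[OF e, of i] by simp
  then show ?thesis using i by auto
qed

lemma portrait_dir:
  assumes e: "e \<in> {a, b}" and g: "g \<in> seqs"
  shows "portrait (c j) (dir_portrait I e j g)"
proof -
  have "u \<in> W (c j) (length u)" if u: "active I e j u" for u
  proof -
    obtain i where "u = offspine (c j) (a i) (e (Suc i))" using u by (auto simp: active_def)
    then show ?thesis using offspine_in_W[of "c j" "a i" "e (Suc i)"] by simp
  qed
  then show ?thesis using g id_in_act by (auto simp: portrait_def dir_portrait_def)
qed

lemma dir_in_T:
  assumes e: "e \<in> {a, b}" and g: "g \<in> seqs"
  shows "dir {..<J} e j g \<in> T (c j) (c J)"
proof -
  have "dir_portrait {..<J} e j g u = id" if "c J \<le> c j + length u" for u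
  proof -
    have "\<not> active {..<J} e j u"
    proof
      assume "active {..<J} e j u"
      then obtain i where "Suc i < J" "c j + length u = e (Suc i)"
        using active_level[OF e] by blast
      then show False
        using that c_mono[of "Suc (Suc i)" J] block_level(2)[OF e, of "Suc i"] by simp
    qed
    then show ?thesis by (simp add: dir_portrait_def)
  qed
  then show ?thesis using portrait_dir[OF e g] by (auto simp: T_def dir_def)
qed

lemma dir_cong:
  assumes e: "e \<in> {a, b}" and gh: "\<And>i. j \<le> i \<Longrightarrow> Suc i \<in> I \<Longrightarrow> g (e (Suc i)) = h (e (Suc i))"
  shows "dir I e j g = dir I e j h"
proof -
  have "dir_portrait I e j g u = dir_portrait I e j h u" for u
    using active_level[OF e, of I j u] gh by (auto simp: dir_portrait_def)
  then show ?thesis by (metis dir_def ext)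
qed

text \<open>Nothing is moved on the way to an active vertex, because no proper prefix of it is
  active: such a prefix would have left the spine at a level where the vertex still follows
  it.\<close>

lemma dir_fixes_active:
  assumes e: "e \<in> {a, b}" and u: "active I e j u"
  shows "dir I' e j g u = u"
  unfolding dir_def
proof (rule aut_fixes)
  fix l assume l: "l < length u"
  obtain i where i: "i \<ge> j" "c j + length u = e (Suc i)" "u = offspine (c j) (a i) (e (Suc i))"
    using active_level[OF e u] by blast
  have "\<not> active I' e j (take l u)"
  proof
    assume "active I' e j (take l u)"
    then obtain i' where i': "i' \<ge> j" "c j + length (take l u) = e (Suc i')"
      "take l u = offspine (c j) (a i') (e (Suc i'))"
      using active_level[OF e] by blast
    have less: "e (Suc i') < e (Suc i)" using i(2) i'(2) l by simp
    have "i' < i"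
    proof (rule ccontr)
      assume "\<not> i' < i"
      then have "i' = i \<or> Suc i < Suc i'" by auto
      then show False
        using less block_level[OF e, of "Suc i"] block_level[OF e, of "Suc i'"]
          c_mono[of "Suc (Suc i)" "Suc i'"] by auto
    qed
    then have ai: "a i' < a i" using block_order[of i'] block_order[of i] c_mono[of "Suc i'" i] by auto
    have pos: "c j \<le> a i'" "a i' < e (Suc i')"
      using c_mono[OF i'(1)] block_order(1)[of i'] a_less_level(1)[OF e, of i'] by auto
    have "take l u ! (a i' - c j) = o2 (a i')"
      using i'(3) nth_spine(2)[OF pos] by simp
    moreover have "take l u ! (a i' - c j) = u ! (a i' - c j)"
      using pos i'(2) l by (intro nth_take) simp
    moreover have "u ! (a i' - c j) = o1 (a i')"
      using i(3) nth_spine(2)[of "c j" "a i'" "e (Suc i)" "a i"] pos less ai by simp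
    ultimately show False using distinct_letters(1)[of i'] by simp
  qed
  then show "dir_portrait I' e j g (take l u) = id" by (simp add: dir_portrait_def)
qed

text \<open>Active vertices are fixed, so the twist in \<open>aut_comp\<close> disappears and the
  local permutations multiply vertex by vertex.\<close>

lemma dir_mult:
  assumes e: "e \<in> {a, b}" and g: "g \<in> seqs" and h: "h \<in> seqs"
  shows "dir I e j (\<lambda>n. g n \<otimes>\<^bsub>G n\<^esub> h n) = dir I e j g \<circ> dir I e j h"
proof -
  have bij: "bij (dir I e j h)" unfolding dir_def by (rule bij_aut_portrait[OF portrait_dir[OF e h]])
  have "active I e j (dir I e j h u) \<longleftrightarrow> active I e j u" for u
  proof
    \<comment> \<open>An active image is a fixed point, and injectivity then forces it to equal
      \<open>u\<close>.\<close>
    assume *: "active I e j (dir I e j h u)"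
    have "dir I e j h (dir I e j h u) = dir I e j h u" by (rule dir_fixes_active[OF e *])
    then have "dir I e j h u = u" using bij by (simp add: bij_is_inj inj_eq)
    then show "active I e j u" using * by simp
  next
    assume "active I e j u"
    then show "active I e j (dir I e j h u)" using dir_fixes_active[OF e] by simp
  qed
  then have "dir_portrait I e j (\<lambda>n. g n \<otimes>\<^bsub>G n\<^esub> h n) u =
      dir_portrait I e j g (aut (dir_portrait I e j h) u) \<circ> dir_portrait I e j h u" for u
    using act_mult g h by (simp add: dir_portrait_def dir_def[symmetric]) (simp add: dir_def)
  then show ?thesis unfolding dir_def aut_comp by (metis ext)
qed

lemma dir_one: "dir I e j (\<lambda>n. \<one>\<^bsub>G n\<^esub>) = id"
proof -
  have "dir_portrait I e j (\<lambda>n. \<one>\<^bsub>G n\<^esub>) = (\<lambda>_. id)"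
    by (rule ext) (simp add: dir_portrait_def act_one)
  then show ?thesis by (simp add: dir_def)
qed

lemma root_one: "root e j \<one>\<^bsub>G (e j)\<^esub> = id"
proof -
  have "(\<lambda>u. if u = spine (c j) (e j) then act (e j) \<one>\<^bsub>G (e j)\<^esub> else id) = (\<lambda>_. id)"
    by (rule ext) (simp add: act_one)
  then show ?thesis by (simp add: root_def)
qed

definition branch :: "nat \<Rightarrow> ('a list \<Rightarrow> 'a list) \<Rightarrow> ('a list \<Rightarrow> 'a list) \<Rightarrow> 'a list \<Rightarrow> 'a list \<Rightarrow> 'a list"
  where "branch j s t v = (if v = x_word j then s else if v = y_word j then t else id)"

text \<open>The self-similarity of directed automorphisms. The active vertices of block
  \<open>Suc j\<close> leave the spine at level \<open>a j\<close>, hence lie below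
  \<open>y_word j\<close>; those of later blocks leave it later, hence lie below
  \<open>x_word j\<close>.\<close>

lemma dir_eq_spread:
  assumes e: "e \<in> {a, b}"
  shows "dir I e j g = spread (c (Suc j) - c j)
    (branch j (dir I e (Suc j) g) (if Suc j \<in> I then root e (Suc j) (g (e (Suc j))) else id))"
proof -
  let ?c = "c (Suc j) - c j"
  have cj: "c j \<le> c (Suc j)" using c_less[of j] by simp
  have "dir I e j g = spread ?c (\<lambda>v. aut (\<lambda>u. dir_portrait I e j g (v @ u)))"
    unfolding dir_def
  proof (rule aut_eq_spread)
    fix u :: "'a list" assume u: "length u < ?c"
    have "\<not> active I e j u"
    proof
      assume "active I e j u"
      then obtain i where "j \<le> i" "c j + length u = e (Suc i)" using active_level[OF e] by blast
      then show False
        using u block_level(1)[OF e, of "Suc i"] c_mono[of "Suc j" "Suc i"] by simp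
    qed
    then show "dir_portrait I e j g u = id" by (simp add: dir_portrait_def)
  qed
  also have "\<dots> = spread ?c
      (branch j (dir I e (Suc j) g) (if Suc j \<in> I then root e (Suc j) (g (e (Suc j))) else id))"
  proof (rule spread_cong)
    fix v :: "'a list" assume v: "length v = ?c"
    have split: "offspine (c j) (a i) (e (Suc i)) =
        offspine (c j) (a i) (c (Suc j)) @ offspine (c (Suc j)) (a i) (e (Suc i))" if "j \<le> i" for i
      by (rule offspine_append)
        (use cj that c_mono[of "Suc j" "Suc i"] block_level(1)[OF e, of "Suc i"] in auto)
    have later: "offspine (c j) (a i) (c (Suc j)) = x_word j" if "Suc j \<le> i" for i
      by (rule offspine_eq_spine) (use that c_mono[of "Suc j" i] block_order(1)[of i] in auto)
    have now: "offspine (c (Suc j)) (a j) n = spine (c (Suc j)) n" for n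
      by (rule offspine_eq_spine) (use block_order[of j] in auto)
    have act_iff: "active I e j (v @ u) \<longleftrightarrow>
        v = y_word j \<and> Suc j \<in> I \<and> u = spine (c (Suc j)) (e (Suc j)) \<or>
        v = x_word j \<and> active I e (Suc j) u" for u
    proof -
      have "active I e j (v @ u) \<longleftrightarrow> (\<exists>i\<ge>j. Suc i \<in> I \<and> v = offspine (c j) (a i) (c (Suc j)) \<and>
          u = offspine (c (Suc j)) (a i) (e (Suc i)))"
        unfolding active_def using v by (auto simp: split)
      also have "\<dots> \<longleftrightarrow> v = y_word j \<and> Suc j \<in> I \<and> u = spine (c (Suc j)) (e (Suc j)) \<or>
          (\<exists>i\<ge>Suc j. Suc i \<in> I \<and> v = offspine (c j) (a i) (c (Suc j)) \<and>
          u = offspine (c (Suc j)) (a i) (e (Suc i)))"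
        using now by (metis Suc_le_eq le_eq_less_or_eq)
      finally show ?thesis using later by (auto simp: active_def)
    qed
    have level: "c j + length (v @ u) = c (Suc j) + length u" for u
      using v cj by simp
    consider "v = x_word j" | "v = y_word j" | "v \<noteq> x_word j" "v \<noteq> y_word j" by blast
    then show "aut (\<lambda>u. dir_portrait I e j g (v @ u)) =
        branch j (dir I e (Suc j) g) (if Suc j \<in> I then root e (Suc j) (g (e (Suc j))) else id) v"
    proof cases
      case 1
      then have "(\<lambda>u. dir_portrait I e j g (v @ u)) = dir_portrait I e (Suc j) g"
        unfolding dir_portrait_def level act_iff using y_word_neq[of j] by auto
      then show ?thesis using 1 by (simp add: branch_def dir_def)
    next
      case 2
      then have "(\<lambda>u. dir_portrait I e j g (v @ u)) =
          (\<lambda>u. if Suc j \<in> I \<and> u = spine (c (Suc j)) (e (Suc j)) then act (e (Suc j)) (g (e (Suc j))) else id)"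
        unfolding dir_portrait_def level act_iff
        using y_word_neq[of j] block_level(1)[OF e, of "Suc j"] by (intro ext) auto
      then show ?thesis using 2 y_word_neq[of j] by (simp add: branch_def root_def)
    next
      case 3
      then have "(\<lambda>u. dir_portrait I e j g (v @ u)) = (\<lambda>_. id)"
        unfolding dir_portrait_def act_iff by auto
      then show ?thesis using 3 by (simp add: branch_def)
    qed
  qed
  finally show ?thesis .
qed

lemma spread_branch:
  "spread (c (Suc j) - c j) (branch j s t) = at_vertex (x_word j) s \<circ> at_vertex (y_word j) t"
  unfolding at_vertex_def length_spine spread_comp
  by (rule spread_cong) (use y_word_neq[of j] in \<open>auto simp: branch_def\<close>)

text \<open>\<open>T_generated\<close> asks for one vertex on each level. On levels other than
  \<open>a j\<close> and \<open>b j\<close> the alphabet is a singleton and the local permutations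
  are trivial.\<close>

lemma block_generated:
  assumes H: "transf_group H"
    and root: "\<And>e g. e \<in> {a, b} \<Longrightarrow> g \<in> carrier (G (e j)) \<Longrightarrow> root e j g \<in> H"
  shows "T (c j) (c (Suc j)) \<subseteq> H"
proof (rule T_generated[OF H])
  fix n assume n: "c j \<le> n" "n < c (Suc j)"
  have "aut (\<lambda>u. if u = spine (c j) n then act n g else id) \<in> H" if g: "g \<in> carrier (G n)" for g
  proof (cases "n = a j \<or> n = b j")
    case True
    then show ?thesis using root[of a g] root[of b g] g by (auto simp: root_def)
  next
    case False
    then have X: "X n = {o1 n}" using singleton[OF n] by blast
    have "act n g = id" by (rule act_singleton[OF g X])
    then have "(\<lambda>u. if u = spine (c j) n then act n g else id) = (\<lambda>_. id)" by (intro ext) simp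
    then show ?thesis using transf_groupD(1)[OF H] by simp
  qed
  then show "\<exists>v\<in>W (c j) (n - c j). \<forall>g\<in>carrier (G n). aut (\<lambda>u. if u = v then act n g else id) \<in> H"
    using spine_in_W by blast
qed

end

section \<open>Generation by the first block and the directed automorphisms\<close>

text \<open>Sections at \<open>x\<close> of elements of \<open>H\<close> that act separately below
  the vertices of that level, and nontrivially only below \<open>x\<close> and \<open>S\<close>. The
  set \<open>S\<close> records the error compared with acting below \<open>x\<close> alone.\<close>

definition reach ::
  "('a list \<Rightarrow> 'a list) set \<Rightarrow> ('a list \<Rightarrow> 'a list) set \<Rightarrow> 'a list \<Rightarrow> 'a list set \<Rightarrow>
    ('a list \<Rightarrow> 'a list) set"
  where "reach H K x S = {h x | h. spread (length x) h \<in> H \<and> (\<forall>v. h v \<in> K) \<and>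
    (\<forall>v. v \<notin> insert x S \<longrightarrow> h v = id)}"

lemma reachI:
  "spread (length x) h \<in> H \<Longrightarrow> (\<And>v. h v \<in> K) \<Longrightarrow> (\<And>v. v \<notin> insert x S \<Longrightarrow> h v = id) \<Longrightarrow>
    h x \<in> reach H K x S"
  unfolding reach_def by blast

lemma reachE:
  assumes "t \<in> reach H K x S"
  obtains h where "t = h x" "spread (length x) h \<in> H" "\<And>v. h v \<in> K"
    "\<And>v. v \<notin> insert x S \<Longrightarrow> h v = id"
  using assms unfolding reach_def by blast

lemma transf_group_reach:
  assumes H: "transf_group H" and K: "transf_group K"
  shows "transf_group (reach H K x S)"
  unfolding transf_group_def
proof (intro conjI ballI)
  have *: "spread (length x) (\<lambda>_. id) = id" by (rule spread_id) simp
  have "spread (length x) (\<lambda>_. id) \<in> H" unfolding * by (rule transf_groupD(1)[OF H])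
  then have "(\<lambda>_. id) x \<in> reach H K x S"
    by (rule reachI) (use transf_groupD(1)[OF K] in auto)
  then show "id \<in> reach H K x S" by simp
next
  fix s t assume "s \<in> reach H K x S" "t \<in> reach H K x S"
  then obtain h h' where h: "s = h x" "spread (length x) h \<in> H" "\<And>v. h v \<in> K"
      "\<And>v. v \<notin> insert x S \<Longrightarrow> h v = id"
    and h': "t = h' x" "spread (length x) h' \<in> H" "\<And>v. h' v \<in> K"
      "\<And>v. v \<notin> insert x S \<Longrightarrow> h' v = id"
    by (elim reachE) blast
  have "spread (length x) (\<lambda>v. h v \<circ> h' v) \<in> H"
    using transf_groupD(2)[OF H h(2) h'(2)] by (simp only: spread_comp)
  then have "(\<lambda>v. h v \<circ> h' v) x \<in> reach H K x S"
    by (rule reachI) (simp_all add: transf_groupD(2)[OF K h(3) h'(3)] h(4) h'(4))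
  then show "s \<circ> t \<in> reach H K x S" by (simp only: h(1) h'(1))
next
  fix s assume "s \<in> reach H K x S"
  then obtain h where h: "s = h x" "spread (length x) h \<in> H" "\<And>v. h v \<in> K"
      "\<And>v. v \<notin> insert x S \<Longrightarrow> h v = id"
    by (elim reachE) blast
  have bij: "bij (h v)" for v by (rule transf_groupD(3)[OF K h(3)])
  then show "bij s" by (simp only: h(1))
  have "spread (length x) (\<lambda>v. inverse_map (h v)) \<in> H"
    using transf_groupD(4)[OF H h(2)] by (simp only: bij_spread(2)[of h, OF bij])
  then have "(\<lambda>v. inverse_map (h v)) x \<in> reach H K x S"
    by (rule reachI) (simp_all add: transf_groupD(4)[OF K h(3)] h(4) inverse_map_id)
  then show "inverse_map s \<in> reach H K x S" by (simp only: h(1))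
qed

text \<open>At every vertex other than \<open>x\<close> one of the two maps has trivial section,
  because their error sets are disjoint. The commutator is therefore trivial there.\<close>

lemma commutator_reach:
  assumes H: "transf_group H" and K: "transf_group K"
    and s: "s \<in> reach H K x S" and t: "t \<in> reach H K x S'"
    and disj: "S \<inter> S' = {}"
  shows "at_vertex x (commutator_map s t) \<in> H"
proof -
  obtain h where h: "s = h x" "spread (length x) h \<in> H" "\<And>v. h v \<in> K"
      "\<And>v. v \<notin> insert x S \<Longrightarrow> h v = id"
    using s by (elim reachE) blast
  obtain h' where h': "t = h' x" "spread (length x) h' \<in> H" "\<And>v. h' v \<in> K"
      "\<And>v. v \<notin> insert x S' \<Longrightarrow> h' v = id"
    using t by (elim reachE) blast
  have bij: "bij (h v)" "bij (h' v)" for v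
    by (rule transf_groupD(3)[OF K h(3)], rule transf_groupD(3)[OF K h'(3)])
  have "commutator_map (h v) (h' v) = id" if "v \<noteq> x" for v
  proof -
    have "v \<notin> S \<or> v \<notin> S'" using disj by blast
    then show ?thesis
      using h(4)[of v] h'(4)[of v] that commutator_map_id[OF bij(1)] commutator_map_id[OF bij(2)]
      by auto
  qed
  then have "spread (length x) (\<lambda>v. commutator_map (h v) (h' v)) = at_vertex x (commutator_map s t)"
    unfolding at_vertex_def by (intro spread_cong) (auto simp: h(1) h'(1))
  then show ?thesis
    using commutator_map_in[OF H h(2) h'(2)] by (simp only: commutator_spread[of h h', OF bij])
qed

text \<open>This group takes the place of \<open>H\<close> when the induction over blocks moves one
  block down.\<close>

lemma transf_group_exact:
  assumes H: "transf_group H" and K: "transf_group K"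
  shows "transf_group {t \<in> K. at_vertex x t \<in> H}"
  unfolding transf_group_def
  using transf_groupD[OF H] transf_groupD[OF K]
  by (auto simp: at_vertex_id at_vertex_comp[symmetric] at_vertex_inverse[symmetric])

section \<open>Images of commutator subgroups\<close>

context perm_tower
begin

lemma hom_inverse:
  assumes K: "transf_group K" and closed: "\<And>g. g \<in> carrier (G n) \<Longrightarrow> f g \<in> K"
    and mult: "\<And>g h. g \<in> carrier (G n) \<Longrightarrow> h \<in> carrier (G n) \<Longrightarrow> f (g \<otimes>\<^bsub>G n\<^esub> h) = f g \<circ> f h"
  shows "f \<one>\<^bsub>G n\<^esub> = id" "g \<in> carrier (G n) \<Longrightarrow> f (inv\<^bsub>G n\<^esub> g) = inverse_map (f g)"
proof -
  interpret group "G n" by (rule group_G)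
  have "f \<one>\<^bsub>G n\<^esub> \<circ> f \<one>\<^bsub>G n\<^esub> = f \<one>\<^bsub>G n\<^esub>" using mult[OF one_closed one_closed] by simp
  then have "inverse_map (f \<one>\<^bsub>G n\<^esub>) \<circ> (f \<one>\<^bsub>G n\<^esub> \<circ> f \<one>\<^bsub>G n\<^esub>) = inverse_map (f \<one>\<^bsub>G n\<^esub>) \<circ> f \<one>\<^bsub>G n\<^esub>" by simp
  moreover have "inverse_map (f \<one>\<^bsub>G n\<^esub>) \<circ> f \<one>\<^bsub>G n\<^esub> = id"
    by (rule bij_comp_inverse_map) (rule transf_groupD(3)[OF K closed[OF one_closed]])
  ultimately show one: "f \<one>\<^bsub>G n\<^esub> = id" by (metis comp_assoc id_comp)
  assume g: "g \<in> carrier (G n)"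
  have "f g \<circ> f (inv\<^bsub>G n\<^esub> g) = id" "f (inv\<^bsub>G n\<^esub> g) \<circ> f g = id"
    using g one by (simp_all add: mult[symmetric])
  then show "f (inv\<^bsub>G n\<^esub> g) = inverse_map (f g)" by (intro inv_unique_comp[symmetric])
qed

text \<open>A homomorphism into \<open>K\<close> sends the generators of the commutator subgroup to
  commutators of elements of \<open>K\<close>, all of which lie in \<open>E\<close>.\<close>

lemma derived_hom_in:
  assumes K: "transf_group K" and closed: "\<And>g. g \<in> carrier (G n) \<Longrightarrow> f g \<in> K"
    and mult: "\<And>g h. g \<in> carrier (G n) \<Longrightarrow> h \<in> carrier (G n) \<Longrightarrow> f (g \<otimes>\<^bsub>G n\<^esub> h) = f g \<circ> f h"
    and E: "transf_group E" and comm: "\<And>s t. s \<in> K \<Longrightarrow> t \<in> K \<Longrightarrow> commutator_map s t \<in> E"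
    and g: "g \<in> derived (G n) (carrier (G n))"
  shows "f g \<in> E"
proof -
  interpret group "G n" by (rule group_G)
  note hom = hom_inverse[of K n f, OF K closed mult]
  have set: "h \<in> carrier (G n)" "f h \<in> E" if h: "h \<in> derived_set (G n) (carrier (G n))" for h
  proof -
    obtain s t where st: "s \<in> carrier (G n)" "t \<in> carrier (G n)" "h = s \<otimes>\<^bsub>G n\<^esub> t \<otimes>\<^bsub>G n\<^esub> inv\<^bsub>G n\<^esub> s \<otimes>\<^bsub>G n\<^esub> inv\<^bsub>G n\<^esub> t"
      using h by blast
    then show "h \<in> carrier (G n)" by simp
    have "f h = commutator_map (f s) (f t)"
      unfolding commutator_map_def using st by (simp add: mult hom(2))
    then show "f h \<in> E" using comm closed st by simp
  qed
  have "g \<in> generate (G n) (derived_set (G n) (carrier (G n)))"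
    using g by (simp add: derived_def)
  then have "g \<in> carrier (G n) \<and> f g \<in> E"
  proof induction
    case one
    have "f \<one>\<^bsub>G n\<^esub> \<in> E"
      by (rule ssubst[where P = "\<lambda>s. s \<in> E", OF hom(1) transf_groupD(1)[OF E]])
    then show ?case by simp
  next
    case (incl h)
    then show ?case using set by blast
  next
    case (inv h)
    then show ?case using set[OF inv] hom(2)[of h] transf_groupD(4)[OF E] by simp
  next
    case (eng h1 h2)
    then have "f h1 \<circ> f h2 \<in> E" using transf_groupD(2)[OF E] by blast
    then show ?case using eng.IH mult[of h1 h2] by (metis m_closed)
  qed
  then show ?thesis ..
qed

end

section \<open>Approximating sections at one vertex with two disjoint error sets\<close>

context block_tower
begin

text \<open>
  The sets \<open>S\<close> and \<open>S'\<close> are distinguished by the letter at level \<open>b j\<close>, and a permutation of that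
  letter off the spine moves \<open>S\<close> into \<open>S'\<close>.
\<close>

lemma separation:
  obtains S S' where "S \<inter> S' = {}"
    "\<And>R. R \<in> {S, S'} \<Longrightarrow> \<exists>r\<in>T (c j) (c (Suc j)). r (x_word j) = x_word j \<and> r (y_word j) \<in> R"
    "\<And>R. R \<in> {S, S'} \<Longrightarrow> \<exists>q\<in>T (c j) (c (Suc j)). q (y_word j) = x_word j \<and> q (x_word j) \<in> R"
proof -
  let ?k = "c j" and ?x = "x_word j" and ?y = "y_word j"
  let ?A = "a j - ?k" and ?B = "b j - ?k"
  let ?T = "T (c j) (c (Suc j))"
  have ord: "?k \<le> a j" "a j < b j" "b j < c (Suc j)" by (rule block_order)+
  \<comment> \<open>Being off the spine before level \<open>b j\<close> is part of \<open>S\<close>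
    so that a permutation at level \<open>b j\<close> can move \<open>S\<close> and still fix
    \<open>x_word j\<close>.\<close>
  define S where "S = {v. take ?B v \<noteq> spine ?k (b j) \<and> v ! ?B = o1 (b j)}"
  define S' where "S' = {v. v ! ?B \<noteq> o1 (b j)}"
  have nth: "?x ! l = o1 (?k + l)" "?y ! l = (if ?k + l = a j then o2 (?k + l) else o1 (?k + l))"
    if "l < c (Suc j) - ?k" for l
    using nth_spine[of ?k "?k + l" "c (Suc j)"] that by simp_all
  have take_x: "take l ?x = spine ?k (?k + l)" if "l \<le> c (Suc j) - ?k" for l
    using that c_less[of j] by (simp add: spine_def take_map)
  have take_y: "take l ?y = offspine ?k (a j) (?k + l)" if "l \<le> c (Suc j) - ?k" for l
  proof -
    have "c j + l \<le> c (Suc j)" using that c_less[of j] by linarith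
    then show ?thesis by (simp add: take_offspine min_def)
  qed

  obtain g where g: "g \<in> carrier (G (a j))" "act (a j) g (o2 (a j)) = o1 (a j)"
    using act_transitive[OF letters(2) letters(1)] by blast
  have ga: "act (a j) g (o1 (a j)) \<noteq> o1 (a j)"
    using g act_inverse(1)[OF g(1)] distinct_letters(1)[of j] by (metis bij_is_inj inj_eq)
  \<comment> \<open>This single permutation sends \<open>y_word j\<close> to \<open>x_word j\<close>
    and, by injectivity of \<open>act (a j) g\<close>, pushes \<open>x_word j\<close> off the
    spine.\<close>
  define p where "p u = (if u = spine ?k (a j) then act (a j) g else id)" for u
  have eqA: "?k + ?A = a j" using ord by simp
  have p: "portrait ?k p"
    using portrait_vertex[OF spine_in_W[of ?k "a j"], of g, unfolded eqA, OF g(1)]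
    unfolding p_def[abs_def] .
  have qT: "aut p \<in> ?T"
    by (rule aut_in_T[OF p]) (use ord in \<open>auto simp: p_def\<close>)
  have p_off: "p u = id" if "length u \<noteq> ?A" for u using that by (auto simp: p_def)
  have spine_yA: "offspine ?k (a j) (a j) = spine ?k (a j)" by (rule offspine_eq_spine) simp
  have qy: "aut p ?y = ?x"
  proof (rule nth_equalityI)
    fix l assume "l < length (aut p ?y)"
    then have l: "l < c (Suc j) - ?k" by simp
    show "aut p ?y ! l = ?x ! l"
    proof (cases "l = ?A")
      case True
      then show ?thesis using l g(2) eqA nth[OF l] take_y[of l] spine_yA by (simp add: nth_aut p_def)
    next
      case False
      then have "?k + l \<noteq> a j" using eqA by auto
      moreover have "p (take l ?y) = id" using p_off[of "take l ?y"] False l by simp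
      ultimately show ?thesis using l nth[OF l] by (simp add: nth_aut)
    qed
  qed simp
  have qx: "aut p ?x ! ?A = act (a j) g (o1 (a j))"
  proof -
    have l: "?A < c (Suc j) - ?k" using ord by simp
    then show ?thesis using eqA nth(1)[OF l] take_x[of ?A] by (simp add: nth_aut p_def)
  qed
  have qxB: "aut p ?x ! ?B = o1 (b j)"
  proof -
    have l: "?B < c (Suc j) - ?k" "?k + ?B = b j" "?B \<noteq> ?A" using ord by auto
    then have "p (take ?B ?x) = id" using p_off[of "take ?B ?x"] by simp
    then show ?thesis using l nth(1)[OF l(1)] by (simp add: nth_aut)
  qed
  have qx_S: "aut p ?x \<in> S"
  proof -
    have "take ?B (aut p ?x) ! ?A \<noteq> spine ?k (b j) ! ?A"
      using ga qx ord by (simp add: nth_spine)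
    then show ?thesis using qxB by (auto simp: S_def)
  qed
  have y_S: "?y \<in> S"
  proof -
    have "take ?B ?y ! ?A \<noteq> spine ?k (b j) ! ?A"
      using distinct_letters(1)[of j] ord nth(2)[of ?A] by (simp add: nth_spine)
    moreover have "?y ! ?B = o1 (b j)" using ord nth(2)[of ?B] by simp
    ultimately show ?thesis by (auto simp: S_def)
  qed

  obtain d where d: "d \<in> carrier (G (b j))" "act (b j) d (o1 (b j)) = o2 (b j)"
    using act_transitive[OF letters(1) letters(2)] by blast
  \<comment> \<open>The prefix of \<open>x_word j\<close> is exempt, so \<open>x_word j\<close>
    stays fixed; in words of \<open>S\<close> belonging to the tree the letter
    \<open>o1 (b j)\<close> becomes the different letter \<open>o2 (b j)\<close>.\<close>
  define p' where "p' u = (if u \<in> W ?k ?B \<and> u \<noteq> spine ?k (b j) then act (b j) d else id)" for u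
  have eqB: "?k + ?B = b j" using ord by simp
  have lenB: "length u = ?B" if "u \<in> W ?k ?B" for u using that by (simp add: words_def)
  have p': "portrait ?k p'"
    using d(1) eqB lenB id_in_act by (auto simp: portrait_def p'_def)
  have rT: "aut p' \<in> ?T"
  proof (rule aut_in_T[OF p'])
    fix u :: "'a list" assume "c (Suc j) \<le> ?k + length u"
    then show "p' u = id" using ord lenB[of u] by (auto simp: p'_def)
  qed
  have rx: "aut p' ?x = ?x"
  proof (rule aut_fixes)
    fix l assume "l < length ?x"
    then have l: "l < c (Suc j) - ?k" by simp
    show "p' (take l ?x) = id"
      using lenB[of "take l ?x"] take_x[of l] l eqB by (auto simp: p'_def)
  qed
  have rS: "aut p' v \<in> S'" if v: "v \<in> W ?k (c (Suc j) - ?k)" "v \<in> S" for v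
  proof -
    have l: "?B < length v" using v ord by (auto simp: words_def)
    have "take ?B v \<in> W ?k ?B" using v(1) l by (simp add: words_def)
    then have "p' (take ?B v) = act (b j) d" using v(2) by (simp add: p'_def S_def)
    then have "aut p' v ! ?B = o2 (b j)" using v(2) l d(2) by (simp add: nth_aut S_def)
    then show ?thesis using distinct_letters(2)[of j] by (simp add: S'_def)
  qed

  show thesis
  proof (rule that)
    show "S \<inter> S' = {}" by (auto simp: S_def S'_def)
    fix R assume "R \<in> {S, S'}"
    then consider "R = S" | "R = S'" by blast
    then show "\<exists>r\<in>?T. r ?x = ?x \<and> r ?y \<in> R"
    proof cases
      case 1
      then show ?thesis using y_S T_closed(1) by (intro bexI[of _ id]) auto
    next
      case 2
      then show ?thesis using rT rx rS[OF xy_in_W(2) y_S] by blast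
    qed
  next
    fix R assume "R \<in> {S, S'}"
    then consider "R = S" | "R = S'" by blast
    then show "\<exists>q\<in>?T. q ?y = ?x \<and> q ?x \<in> R"
    proof cases
      case 1
      then show ?thesis using qT qy qx_S by blast
    next
      case 2
      have "aut p ?x \<in> W ?k (c (Suc j) - ?k)" using aut_in_W[OF p] xy_in_W(1) by blast
      then have "aut p' (aut p ?x) \<in> S'" using rS qx_S by blast
      then show ?thesis
        using 2 T_closed(2)[OF rT qT] qy rx by (intro bexI[of _ "aut p' \<circ> aut p"]) auto
    qed
  qed
qed

text \<open>Conjugation by \<open>f\<close> moves the two sections to the images of
  \<open>x_word j\<close> and \<open>y_word j\<close>. The choice of \<open>f\<close> decides which
  of them arrives at \<open>x_word j\<close>, and the other one has to land in
  \<open>S\<close>.\<close>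

lemma branch_reach:
  assumes H: "transf_group H" and top: "T (c j) (c (Suc j)) \<subseteq> H"
    and K: "transf_group K" "s \<in> K" "t \<in> K"
    and f: "f \<in> T (c j) (c (Suc j))" and st: "spread (c (Suc j) - c j) (branch j s t) \<in> H"
    and sub: "{f (x_word j), f (y_word j)} \<subseteq> insert (x_word j) S"
  shows "branch j s t (inverse_map f (x_word j)) \<in> reach H K (x_word j) S"
proof -
  let ?h = "\<lambda>v. branch j s t (inverse_map f v)"
  have bij: "bij f" by (rule T_closed(3)[OF f])
  have "c j + (c (Suc j) - c j) = c (Suc j)" using c_less[of j] by simp
  then have "f \<circ> spread (c (Suc j) - c j) (branch j s t) \<circ> inverse_map f = spread (c (Suc j) - c j) ?h"
    using T_conj_spread[of f "c j" "c (Suc j) - c j"] f by simp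
  moreover have "f \<in> H" using f top by blast
  ultimately have "spread (length (x_word j)) ?h \<in> H"
    using transf_groupD(2)[OF H transf_groupD(2)[OF H \<open>f \<in> H\<close> st] transf_groupD(4)[OF H \<open>f \<in> H\<close>]]
    by simp
  then show ?thesis
  proof (rule reachI)
    show "?h v \<in> K" for v using K transf_groupD(1)[OF K(1)] by (simp add: branch_def)
    show "?h v = id" if "v \<notin> insert (x_word j) S" for v
    proof -
      have "v \<noteq> f (x_word j)" "v \<noteq> f (y_word j)" using that sub by auto
      then have "inverse_map f v \<noteq> x_word j" "inverse_map f v \<noteq> y_word j"
        using bij_comp_inverse_map(3)[OF bij, of v] by auto
      then show ?thesis by (simp add: branch_def)
    qed
  qed
qed

end

section \<open>The induction over blocks\<close>

context block_tower
begin

lemma seqs_restrict: "g \<in> seqs \<Longrightarrow> (\<lambda>n. if P n then g n else \<one>\<^bsub>G n\<^esub>) \<in> seqs"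
  by (simp add: G_closed)

text \<open>\<open>derived_hom_in\<close> treats sequences with one nontrivial entry, and
  \<open>dir_mult\<close> multiplies finitely many of these together.\<close>

lemma dir_derived_in:
  assumes e: "e \<in> {a, b}" and E: "transf_group E"
    and comm: "\<And>s t. s \<in> T (c j) (c J) \<Longrightarrow> t \<in> T (c j) (c J) \<Longrightarrow> commutator_map s t \<in> E"
    and d: "\<And>n. d n \<in> derived (G n) (carrier (G n))"
  shows "dir {..<J} e j d \<in> E"
proof -
  have derived_closed: "g \<in> carrier (G n)" if "g \<in> derived (G n) (carrier (G n))" for g n
    using group.derived_in_carrier[OF group_G, of "carrier (G n)" n] that by blast
  define single where "single n g = (\<lambda>k. if k = n then g else \<one>\<^bsub>G k\<^esub>)" for n g
  define initial where "initial n = (\<lambda>k. if k < n then d k else \<one>\<^bsub>G k\<^esub>)" for n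
  have single: "single n g \<in> seqs" if "g \<in> carrier (G n)" for n g
    using that by (simp add: single_def G_closed)
  have initial: "initial n \<in> seqs" for n
    using derived_closed d by (simp add: initial_def G_closed)
  have "dir {..<J} e j (single n g) \<in> E" if g: "g \<in> derived (G n) (carrier (G n))" for n g
  proof (rule derived_hom_in[where K = "T (c j) (c J)" and f = "\<lambda>g. dir {..<J} e j (single n g)"
        and n = n, OF transf_group_T _ _ E comm g])
    show "dir {..<J} e j (single n h) \<in> T (c j) (c J)" if "h \<in> carrier (G n)" for h
      by (rule dir_in_T[OF e single[OF that]])
    show "dir {..<J} e j (single n (h \<otimes>\<^bsub>G n\<^esub> k)) = dir {..<J} e j (single n h) \<circ> dir {..<J} e j (single n k)"
      if hk: "h \<in> carrier (G n)" "k \<in> carrier (G n)" for h k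
    proof -
      have "single n (h \<otimes>\<^bsub>G n\<^esub> k) = (\<lambda>l. single n h l \<otimes>\<^bsub>G l\<^esub> single n k l)"
        using G_closed(2) group.is_monoid[OF group_G] by (auto simp: single_def monoid.r_one)
      then show ?thesis using dir_mult[OF e single[OF hk(1)] single[OF hk(2)]] by simp
    qed
  qed
  then have step: "dir {..<J} e j (single n (d n)) \<in> E" for n using d by blast
  have "dir {..<J} e j (initial n) \<in> E" for n
  proof (induction n)
    case 0
    have "initial 0 = (\<lambda>k. \<one>\<^bsub>G k\<^esub>)" by (simp add: initial_def)
    then have "dir {..<J} e j (initial 0) = id" by (simp only: dir_one)
    then show ?case by (simp only: transf_groupD(1)[OF E])
  next
    case (Suc n)
    have "initial (Suc n) = (\<lambda>k. initial n k \<otimes>\<^bsub>G k\<^esub> single n (d n) k)"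
    proof
      fix k
      have "d k \<in> carrier (G k)" "d n \<in> carrier (G n)" by (rule derived_closed[OF d])+
      then show "initial (Suc n) k = initial n k \<otimes>\<^bsub>G k\<^esub> single n (d n) k"
        using G_closed(2)[of k] group.is_monoid[OF group_G]
        by (simp add: initial_def single_def monoid.r_one monoid.l_one less_Suc_eq)
    qed
    then have "dir {..<J} e j (initial (Suc n)) =
        dir {..<J} e j (initial n) \<circ> dir {..<J} e j (single n (d n))"
      using dir_mult[OF e initial single[OF derived_closed[OF d]]] by simp
    then show ?case using transf_groupD(2)[OF E Suc.IH step] by (simp only:)
  qed
  \<comment> \<open>The truncated automorphism reads \<open>d\<close> only below level
    \<open>c J\<close>, so a finite product is enough.\<close>
  moreover have "dir {..<J} e j (initial (c J)) = dir {..<J} e j d"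
  proof (rule dir_cong[OF e])
    fix i assume "Suc i \<in> {..<J}"
    then have "e (Suc i) < c J"
      using block_level(2)[OF e, of "Suc i"] c_mono[of "Suc (Suc i)" J] by simp
    then show "initial (c J) (e (Suc i)) = d (e (Suc i))" by (simp add: initial_def)
  qed
  ultimately show ?thesis by metis
qed

lemma root_derived_in:
  assumes e: "e \<in> {a, b}" and E: "transf_group E" and N: "c (Suc j) \<le> N"
    and comm: "\<And>s t. s \<in> T (c j) N \<Longrightarrow> t \<in> T (c j) N \<Longrightarrow> commutator_map s t \<in> E"
    and d: "d \<in> derived (G (e j)) (carrier (G (e j)))"
  shows "root e j d \<in> E"
  by (rule derived_hom_in[where K = "T (c j) N" and f = "root e j" and n = "e j",
        OF transf_group_T _ _ E comm d])
    (simp_all add: root_in_T[OF e _ N] root_mult)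

text \<open>Downward induction on \<open>j\<close> with \<open>H\<close> arbitrary. The induction
  hypothesis is used twice: for the groups \<open>reach\<close>, which tolerate errors at other
  vertices, and then for the group \<open>E\<close> of maps available exactly below
  \<open>x_word j\<close>.\<close>

lemma generated_by_directed:
  assumes B: "B \<subseteq> seqs"
    and onto: "\<And>n g. g \<in> carrier (G n) \<Longrightarrow> \<exists>h\<in>B. h n = g"
    and dense: "\<And>g N. g \<in> seqs \<Longrightarrow>
      \<exists>h\<in>B. \<forall>n<N. g n \<otimes>\<^bsub>G n\<^esub> inv\<^bsub>G n\<^esub> (h n) \<in> derived (G n) (carrier (G n))"
    and "j \<le> J"
  shows "transf_group H \<Longrightarrow> (j < J \<Longrightarrow> T (c j) (c (Suc j)) \<subseteq> H) \<Longrightarrow>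
    (\<And>e g. e \<in> {a, b} \<Longrightarrow> g \<in> B \<Longrightarrow> dir {..<J} e j g \<in> H) \<Longrightarrow> T (c j) (c J) \<subseteq> H"
  using \<open>j \<le> J\<close>
proof (induction arbitrary: H rule: inc_induct)
  case base
  then show ?case using T_trivial[of "c J" "c J"] transf_groupD(1) by blast
next
  case (step j)
  note H = step.prems(1)
  have top: "T (c j) (c (Suc j)) \<subseteq> H" using step by blast
  define K where "K = T (c (Suc j)) (c J)"
  have K: "transf_group K" unfolding K_def by (rule transf_group_T)
  let ?x = "x_word j" and ?y = "y_word j" and ?c = "c (Suc j) - c j"
  have c: "c j + ?c = c (Suc j)" using c_less[of j] by simp
  have cJ: "c (Suc (Suc j)) \<le> c J" if "Suc j < J" using that c_mono[of "Suc (Suc j)" J] by simp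
  define D where "D e g = dir {..<J} e (Suc j) g" for e g
  \<comment> \<open>The default \<open>id\<close> covers \<open>Suc j = J\<close>, where the next
    block lies beyond the truncation level \<open>c J\<close>.\<close>
  define R where "R e g = (if Suc j < J then root e (Suc j) (g (e (Suc j))) else id)" for e and g :: "nat \<Rightarrow> 'g"
  have dir: "dir {..<J} e j g = spread ?c (branch j (D e g) (R e g))"
    "dir {..<J} e j g = at_vertex ?x (D e g) \<circ> at_vertex ?y (R e g)" if "e \<in> {a, b}" for e g
    using dir_eq_spread[OF that, of "{..<J}" j g] by (simp_all add: D_def R_def spread_branch)
  have DK: "D e g \<in> K" if "e \<in> {a, b}" "g \<in> seqs" for e g
    unfolding D_def K_def by (rule dir_in_T[OF that])
  have rootK: "root e (Suc j) g \<in> K" if "e \<in> {a, b}" "g \<in> carrier (G (e (Suc j)))" "Suc j < J" for e g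
    unfolding K_def by (rule root_in_T[OF that(1,2) cJ[OF that(3)]])
  have RK: "R e g \<in> K" if "e \<in> {a, b}" "g \<in> seqs" for e g
    using that rootK transf_groupD(1)[OF K] by (auto simp: R_def)

  obtain S S' where SS': "S \<inter> S' = {}"
    and r: "\<And>Z. Z \<in> {S, S'} \<Longrightarrow> \<exists>r\<in>T (c j) (c (Suc j)). r ?x = ?x \<and> r ?y \<in> Z"
    and q: "\<And>Z. Z \<in> {S, S'} \<Longrightarrow> \<exists>q\<in>T (c j) (c (Suc j)). q ?y = ?x \<and> q ?x \<in> Z"
    using separation[of j] by blast

  \<comment> \<open>Elements of block \<open>j\<close> fixing \<open>x_word j\<close> keep
    \<open>D\<close> at this vertex, and elements sending \<open>y_word j\<close> there bring
    \<open>R\<close>; in both cases the other section lands in \<open>Z\<close>. These sections meet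
    the requirements of the induction hypothesis.\<close>
  have reach: "K \<subseteq> reach H K ?x Z" if Z: "Z \<in> {S, S'}" for Z
  proof -
    have V: "transf_group (reach H K ?x Z)" by (rule transf_group_reach[OF H K])
    have *: "branch j (D e g) (R e g) (inverse_map f ?x) \<in> reach H K ?x Z"
      if e: "e \<in> {a, b}" and g: "g \<in> B" and f: "f \<in> T (c j) (c (Suc j))"
        "{f ?x, f ?y} \<subseteq> insert ?x Z" for e g f
    proof (rule branch_reach[OF H top K _ _ f(1) _ f(2)])
      have "g \<in> seqs" by (rule subsetD[OF B g])
      then show "D e g \<in> K" "R e g \<in> K" by (rule DK[OF e], rule RK[OF e])
      show "spread ?c (branch j (D e g) (R e g)) \<in> H"
        using step.prems(3)[OF e g] by (simp only: dir(1)[OF e])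
    qed
    have D: "D e g \<in> reach H K ?x Z" if e: "e \<in> {a, b}" and g: "g \<in> B" for e g
    proof -
      obtain f where f: "f \<in> T (c j) (c (Suc j))" "f ?x = ?x" "f ?y \<in> Z" using r[OF Z] by blast
      then have "inverse_map f ?x = ?x" using bij_comp_inverse_map(4)[OF T_closed(3)[OF f(1)]] by metis
      then show ?thesis using *[OF e g f(1)] f by (simp add: branch_def)
    qed
    have R: "R e g \<in> reach H K ?x Z" if e: "e \<in> {a, b}" and g: "g \<in> B" for e g
    proof -
      obtain f where f: "f \<in> T (c j) (c (Suc j))" "f ?y = ?x" "f ?x \<in> Z" using q[OF Z] by blast
      then have "inverse_map f ?x = ?y" using bij_comp_inverse_map(4)[OF T_closed(3)[OF f(1)]] by metis
      then show ?thesis using *[OF e g f(1)] f y_word_neq[of j] by (simp add: branch_def)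
    qed
    have "T (c (Suc j)) (c (Suc (Suc j))) \<subseteq> reach H K ?x Z" if "Suc j < J"
    proof (rule block_generated[OF V])
      fix e g assume e: "e \<in> {a, b}" and g: "g \<in> carrier (G (e (Suc j)))"
      obtain h where "h \<in> B" "h (e (Suc j)) = g" using onto[OF g] by blast
      then show "root e (Suc j) g \<in> reach H K ?x Z" using R[OF e, of h] that by (simp add: R_def)
    qed
    then show ?thesis
      unfolding K_def using step.IH[OF V] D by (simp add: D_def K_def)
  qed

  define E where "E = {t \<in> K. at_vertex ?x t \<in> H}"
  have E: "transf_group E" unfolding E_def by (rule transf_group_exact[OF H K])
  have EI: "t \<in> E" if "t \<in> K" "at_vertex ?x t \<in> H" for t using that by (simp add: E_def)
  have y_to_x: "at_vertex ?x t \<in> H" if "at_vertex ?y t \<in> H" for t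
    by (rule at_vertex_transport[of H "c j" ?c ?y ?x t]) (use H top c xy_in_W that in auto)
  have x_to_y: "at_vertex ?y t \<in> H" if "at_vertex ?x t \<in> H" for t
    by (rule at_vertex_transport[of H "c j" ?c ?x ?y t]) (use H top c xy_in_W that in auto)
  \<comment> \<open>Take one factor with errors in \<open>S\<close> and the other with errors in
    \<open>S'\<close>; their commutator acts below \<open>x_word j\<close> alone.\<close>
  have comm: "commutator_map s t \<in> E" if "s \<in> K" "t \<in> K" for s t
  proof (rule EI)
    show "commutator_map s t \<in> K" by (rule commutator_map_in[OF K that])
    show "at_vertex ?x (commutator_map s t) \<in> H"
      by (rule commutator_reach[OF H K _ _ SS']) (use reach that in blast)+
  qed

  \<comment> \<open>Up to level \<open>c J\<close>, density writes \<open>g\<close> as a sequence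
    \<open>d\<close> in the commutator subgroups times some \<open>h\<close> in \<open>B\<close>.
    Both sections of the automorphism of \<open>d\<close> lie in \<open>E\<close>, so it belongs to
    \<open>H\<close>.\<close>
  have all: "dir {..<J} e j g \<in> H" if e: "e \<in> {a, b}" and g: "g \<in> seqs" for e g
  proof -
    obtain h where h: "h \<in> B"
      "\<And>n. n < c J \<Longrightarrow> g n \<otimes>\<^bsub>G n\<^esub> inv\<^bsub>G n\<^esub> (h n) \<in> derived (G n) (carrier (G n))"
      using dense[OF g, of "c J"] by blast
    have hs: "h \<in> seqs" using h B by blast
    \<comment> \<open>From level \<open>c J\<close> on the quotient need not lie in the commutator
      subgroup and is replaced by the identity.\<close>
    define d where "d n = (if n < c J then g n \<otimes>\<^bsub>G n\<^esub> inv\<^bsub>G n\<^esub> (h n) else \<one>\<^bsub>G n\<^esub>)" for n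
    have d: "d n \<in> derived (G n) (carrier (G n))" for n
      using h(2)[of n] generate.one by (auto simp: d_def derived_def)
    have ds: "d \<in> seqs" using g hs G_closed by (auto simp: d_def)
    have "D e d \<in> E"
      unfolding D_def by (rule dir_derived_in[OF e E]) (use comm d in \<open>auto simp: K_def\<close>)
    moreover have "R e d \<in> E"
    proof (cases "Suc j < J")
      case True
      have "root e (Suc j) (d (e (Suc j))) \<in> E"
        by (rule root_derived_in[OF e E cJ[OF True]]) (use comm d in \<open>auto simp: K_def\<close>)
      then show ?thesis using True by (simp add: R_def)
    qed (use transf_groupD(1)[OF E] in \<open>simp add: R_def\<close>)
    ultimately have "at_vertex ?x (D e d) \<in> H" "at_vertex ?y (R e d) \<in> H"
      using x_to_y by (simp_all add: E_def)
    then have "dir {..<J} e j d \<in> H" using transf_groupD(2)[OF H] by (simp only: dir(2)[OF e])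
    then have "dir {..<J} e j d \<circ> dir {..<J} e j h \<in> H"
      using step.prems(3)[OF e h(1)] transf_groupD(2)[OF H] by blast
    moreover have "dir {..<J} e j g = dir {..<J} e j (\<lambda>n. d n \<otimes>\<^bsub>G n\<^esub> h n)"
    proof (rule dir_cong[OF e])
      fix i assume "Suc i \<in> {..<J}"
      then have n: "e (Suc i) < c J"
        using block_level(2)[OF e, of "Suc i"] c_mono[of "Suc (Suc i)" J] by simp
      interpret group "G (e (Suc i))" by (rule group_G)
      have "g (e (Suc i)) \<in> carrier (G (e (Suc i)))" "h (e (Suc i)) \<in> carrier (G (e (Suc i)))"
        using g hs by auto
      then show "g (e (Suc i)) = d (e (Suc i)) \<otimes>\<^bsub>G (e (Suc i))\<^esub> h (e (Suc i))"
        using n by (simp add: d_def m_assoc)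
    qed
    ultimately show ?thesis by (simp only: dir_mult[OF e ds hs])
  qed

  have D_E: "D e g \<in> E" if e: "e \<in> {a, b}" and g: "g \<in> seqs" for e g
  proof (rule EI[OF DK[OF e g]])
    \<comment> \<open>Erasing the entry in block \<open>Suc j\<close> trivializes the section at
      \<open>y_word j\<close>. The section at \<open>x_word j\<close> depends on later blocks only
      and is unchanged.\<close>
    define h where "h = (\<lambda>n. if n \<noteq> e (Suc j) then g n else \<one>\<^bsub>G n\<^esub>)"
    have h: "h \<in> seqs" unfolding h_def by (rule seqs_restrict[OF g])
    have "R e h = id" by (simp add: R_def h_def root_one)
    moreover have "D e h = D e g"
      unfolding D_def
    proof (rule dir_cong[OF e])
      fix i assume "Suc j \<le> i"
      then have "e (Suc i) \<noteq> e (Suc j)"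
        using block_level[OF e, of "Suc i"] block_level[OF e, of "Suc j"] c_mono[of "Suc (Suc j)" "Suc i"]
        by simp
      then show "h (e (Suc i)) = g (e (Suc i))" by (simp add: h_def)
    qed
    ultimately have "dir {..<J} e j h = at_vertex ?x (D e g)"
      by (simp only: dir(2)[OF e] at_vertex_id comp_id)
    then show "at_vertex ?x (D e g) \<in> H" using all[OF e h] by (simp only:)
  qed
  have R_E: "R e g \<in> E" if e: "e \<in> {a, b}" and g: "g \<in> seqs" for e g
  proof (rule EI[OF RK[OF e g]], rule y_to_x)
    have x: "at_vertex ?x (D e g) \<in> H" using D_E[OF e g] by (simp add: E_def)
    \<comment> \<open>Cancelling the section at \<open>x_word j\<close> isolates the one at
      \<open>y_word j\<close>, which \<open>y_to_x\<close> transports.\<close>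
    have "inverse_map (at_vertex ?x (D e g)) \<circ> dir {..<J} e j g = at_vertex ?y (R e g)"
      using bij_comp_inverse_map(2)[OF transf_groupD(3)[OF H x]]
      by (simp only: dir(2)[OF e] comp_assoc[symmetric] id_comp)
    then show "at_vertex ?y (R e g) \<in> H"
      using transf_groupD(2)[OF H transf_groupD(4)[OF H x] all[OF e g]] by (simp only:)
  qed

  \<comment> \<open>The second use of the induction hypothesis, now with \<open>E\<close> in place
    of \<open>H\<close>.\<close>
  have "K \<subseteq> E"
    unfolding K_def
  proof (rule step.IH[OF E])
    show "dir {..<J} e (Suc j) g \<in> E" if "e \<in> {a, b}" "g \<in> B" for e g
      using D_E[OF that(1), of g] that(2) B by (auto simp: D_def)
    assume J: "Suc j < J"
    show "T (c (Suc j)) (c (Suc (Suc j))) \<subseteq> E"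
    proof (rule block_generated[OF E])
      fix e g assume e: "e \<in> {a, b}" and g: "g \<in> carrier (G (e (Suc j)))"
      obtain h where "h \<in> B" "h (e (Suc j)) = g" using onto[OF g] by blast
      then show "root e (Suc j) g \<in> E" using R_E[OF e, of h] J B by (auto simp: R_def)
    qed
  qed
  then have exact: "at_vertex ?x t \<in> H" if "t \<in> T (c j + ?c) (c J)" for t
    using that by (auto simp: E_def K_def c)
  show ?case
    by (rule T_subset_if_vertex[OF H _ xy_in_W(1) exact])
      (use top c c_mono[of "Suc j" J] step.hyps in auto)
qed

end

section \<open>Density in inverse limits\<close>

text \<open>Basic open sets restrict finitely many coordinates, and these are discrete; density is
  therefore agreement on arbitrarily long initial segments.\<close>

lemma closure_of_prodiscrete:
  assumes C: "C \<subseteq> carrier (product_group UNIV G)" and A: "A \<subseteq> C"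
  shows "subtopology (prodiscrete_topology G) C closure_of A = C \<longleftrightarrow>
    (\<forall>w\<in>C. \<forall>N. \<exists>s\<in>A. \<forall>n<N. s n = w n)"
proof -
  let ?T = "prodiscrete_topology G"
  have top: "topspace (subtopology ?T C) = C" using C by auto
  have dense: "subtopology ?T C closure_of A = C \<longleftrightarrow> (\<forall>w\<in>C. w \<in> subtopology ?T C closure_of A)"
    using closure_of_subset_topspace[of "subtopology ?T C" A] unfolding top by blast
  have "w \<in> subtopology ?T C closure_of A \<longleftrightarrow> (\<forall>N. \<exists>s\<in>A. \<forall>n<N. s n = w n)" if w: "w \<in> C" for w
  proof
    assume cl: "w \<in> subtopology ?T C closure_of A"
    show "\<forall>N. \<exists>s\<in>A. \<forall>n<N. s n = w n"
    proof
      fix N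
      define V where "V n = (if n < N then {w n} else carrier (G n))" for n
      have wn: "w n \<in> carrier (G n)" for n using w C by (auto simp: PiE_iff)
      have "finite {n \<in> UNIV. V n \<noteq> topspace (discrete_topology (carrier (G n)))}"
        by (rule finite_subset[of _ "{..<N}"]) (auto simp: V_def)
      moreover have "openin (discrete_topology (carrier (G n))) (V n)" for n
        using wn by (simp add: V_def)
      ultimately have "openin ?T (PiE UNIV V)"
        unfolding prodiscrete_topology_def by (simp add: openin_PiE_gen)
      then have "openin (subtopology ?T C) (PiE UNIV V \<inter> C)"
        by (auto simp: openin_subtopology)
      moreover have "w \<in> PiE UNIV V \<inter> C" using w wn by (auto simp: V_def)
      ultimately obtain s where s: "s \<in> A" "s \<in> PiE UNIV V" using cl by (auto simp: in_closure_of)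
      have "s n = w n" if "n < N" for n
      proof -
        have "s n \<in> V n" using s(2) by (auto simp: PiE_iff)
        then show ?thesis using that by (simp add: V_def)
      qed
      then show "\<exists>s\<in>A. \<forall>n<N. s n = w n" using s(1) by blast
    qed
  next
    assume approx: "\<forall>N. \<exists>s\<in>A. \<forall>n<N. s n = w n"
    show "w \<in> subtopology ?T C closure_of A"
      unfolding in_closure_of top
    proof (intro conjI allI impI w)
      fix U assume U: "w \<in> U \<and> openin (subtopology ?T C) U"
      then obtain U' where U': "openin ?T U'" "U = U' \<inter> C" by (auto simp: openin_subtopology)
      then have "w \<in> U'" using U by blast
      then obtain V where V: "finite {n \<in> UNIV. V n \<noteq> topspace (discrete_topology (carrier (G n)))}"
        "w \<in> PiE UNIV V" "PiE UNIV V \<subseteq> U'"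
        using U'(1) unfolding prodiscrete_topology_def openin_product_topology_alt by blast
      obtain N where N: "{n \<in> UNIV. V n \<noteq> topspace (discrete_topology (carrier (G n)))} \<subseteq> {..<N}"
        using finite_nat_iff_bounded[THEN iffD1, OF V(1)] by blast
      obtain s where s: "s \<in> A" "\<forall>n<N. s n = w n" using approx by blast
      have sC: "s \<in> C" using s(1) A by blast
      have "s n \<in> V n" for n
      proof (cases "n < N")
        case True
        then show ?thesis using s(2) V(2) by (auto simp: PiE_iff)
      next
        case False
        then have "V n = carrier (G n)" using N by auto
        then show ?thesis using sC C by (auto simp: PiE_iff)
      qed
      then have "s \<in> PiE UNIV V" by auto
      then show "\<exists>y. y \<in> A \<and> y \<in> U" using s(1) sC V(3) U'(2) by blast
    qed
  qed
  then show ?thesis unfolding dense by blast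
qed

section \<open>Portraits and coherent sequences of permutations\<close>

context perm_tower
begin

text \<open>The portrait values at words of length \<open>n\<close> form the base component of the
  wreath product at the next level.\<close>

lemma restrict_aut_in_iter_wreath:
  assumes p: "portrait 0 p"
  shows "restrict (aut p) (words X n) \<in> iter_wreath_perms G X \<phi> n"
proof (induction n)
  case 0
  have "words X 0 = {[]}" by (auto simp: words_def)
  then show ?case by (simp add: BijGroup_def Bij_def bij_betw_def extensional_def)
next
  case (Suc n)
  let ?g = "restrict (aut p) (words X n)" and ?h = "\<lambda>u. restrict (p u) (X n)"
  have h: "?h u \<in> \<phi> n ` carrier (G n)" if u: "u \<in> words X n" for u
  proof -
    have "length u = n" using u by (simp add: words_def)
    then obtain g where "g \<in> carrier (G n)" "p u = act n g" using portraitD(3)[OF p, of u] by auto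
    then show ?thesis using restrict_act by auto
  qed
  have "restrict (aut p) (words X (Suc n)) =
      snoc_conj (words X (Suc n)) (\<lambda>(u, x) \<in> words X n \<times> X n. (?g u, ?h u x))"
  proof (rule extensionalityI[of _ "words X (Suc n)"])
    fix w assume w: "w \<in> words X (Suc n)"
    then obtain u x where "w = u @ [x]" "u \<in> words X n" "x \<in> X n" by (auto simp: words_Suc)
    then show "restrict (aut p) (words X (Suc n)) w =
        snoc_conj (words X (Suc n)) (\<lambda>(u, x) \<in> words X n \<times> X n. (?g u, ?h u x)) w"
      using w by (simp add: snoc_conj_def aut_append)
  qed (simp_all add: snoc_conj_def)
  moreover have "(\<lambda>(u, x) \<in> words X n \<times> X n. (?g u, ?h u x)) \<in>
      wreath (words X n) (iter_wreath_perms G X \<phi> n) (X n) (\<phi> n ` carrier (G n))"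
    unfolding wreath_def mem_Collect_eq
    by (intro exI[of _ ?g] exI[of _ ?h] conjI refl Suc) (use h in blast)
  ultimately show ?case by simp
qed

text \<open>The base component of the outermost wreath product supplies the portrait values at words
  of length \<open>n\<close>; the rest of the portrait comes from the induction.\<close>

lemma iter_wreath_portrait:
  assumes "w \<in> iter_wreath_perms G X \<phi> n"
  shows "\<exists>p. portrait 0 p \<and> (\<forall>u. n \<le> length u \<longrightarrow> p u = id) \<and> w = restrict (aut p) (words X n)"
  using assms
proof (induction n arbitrary: w)
  case 0
  have "words X 0 = {[]}" by (auto simp: words_def)
  then have "w = restrict id (words X 0)"
    using 0 by (auto simp: BijGroup_def Bij_def bij_betw_def extensional_def fun_eq_iff)
  then have "w = restrict (aut (\<lambda>_. id)) (words X 0)" by (simp only: aut_id)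
  then show ?case using portrait_id by blast
next
  case (Suc n)
  obtain g h where g: "g \<in> iter_wreath_perms G X \<phi> n"
    and h: "h \<in> words X n \<rightarrow> \<phi> n ` carrier (G n)"
    and ext: "w \<in> extensional (words X (Suc n))"
    and w: "\<And>u x. u \<in> words X n \<Longrightarrow> x \<in> X n \<Longrightarrow> w (u @ [x]) = g u @ [h u x]"
    by (rule iter_wreath_perms_Suc_cases[where G = G and X = X and \<phi> = \<phi>, OF action Suc.prems]) (rule that)
  from Suc.IH[OF g] obtain p
    where "portrait 0 p \<and> (\<forall>u. n \<le> length u \<longrightarrow> p u = id) \<and> g = restrict (aut p) (words X n)" ..
  then have p: "portrait 0 p" "\<And>u. n \<le> length u \<Longrightarrow> p u = id" "g = restrict (aut p) (words X n)"
    by simp_all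
  \<comment> \<open>The values \<open>h u\<close> are undefined outside \<open>X n\<close>, hence
    the extension by the identity.\<close>
  define q where "q u = (if u \<in> words X n then (\<lambda>x. if x \<in> X n then h u x else x) else p u)" for u
  have q_act: "\<exists>k\<in>carrier (G n). q u = act n k" if u: "u \<in> words X n" for u
  proof -
    obtain k where "k \<in> carrier (G n)" "h u = \<phi> n k" using h u by blast
    then show ?thesis using u by (intro bexI[of _ k]) (auto simp: q_def act_def)
  qed
  have len: "length u = n" if "u \<in> words X n" for u using that by (simp add: words_def)
  have "portrait 0 q"
    unfolding portrait_def
  proof (intro allI conjI impI)
    fix u
    show "q u \<in> act (0 + length u) ` carrier (G (0 + length u))"
      using q_act[of u] len[of u] portraitD(3)[OF p(1), of u] by (cases "u \<in> words X n") (auto simp: q_def)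
    assume "u \<notin> W 0 (length u)"
    then have "u \<notin> words X n" using len[of u] by auto
    then show "q u = id" using portraitD(2)[OF p(1), of u] \<open>u \<notin> W 0 (length u)\<close> by (simp add: q_def)
  qed
  moreover have "q u = id" if "Suc n \<le> length u" for u
    using that len[of u] p(2)[of u] by (auto simp: q_def)
  moreover have "w = restrict (aut q) (words X (Suc n))"
  proof (rule extensionalityI[OF ext])
    fix v assume v: "v \<in> words X (Suc n)"
    then obtain u x where ux: "v = u @ [x]" "u \<in> words X n" "x \<in> X n" by (auto simp: words_Suc)
    \<comment> \<open>Only proper prefixes of \<open>u\<close> influence its image, and these are
      too short to be affected by the new values.\<close>
    have "take i u \<notin> words X n" if "i < length u" for i
      using len[of "take i u"] that len[OF ux(2)] by auto
    then have "aut q u = aut p u" by (intro aut_cong) (simp add: q_def)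
    then show "w v = restrict (aut q) (words X (Suc n)) v"
      using v ux w[OF ux(2,3)] p(3) by (simp add: aut_append q_def)
  qed simp
  ultimately show ?case by blast
qed

lemma iter_wreath_T:
  assumes "w \<in> iter_wreath_perms G X \<phi> n"
  shows "\<exists>f\<in>T 0 n. w = restrict f (words X n)"
proof -
  from iter_wreath_portrait[OF assms] obtain p
    where "portrait 0 p \<and> (\<forall>u. n \<le> length u \<longrightarrow> p u = id) \<and> w = restrict (aut p) (words X n)" ..
  then show ?thesis using aut_in_T[of 0 p n] by auto
qed

abbreviation Winf :: "(nat \<Rightarrow> 'a list \<Rightarrow> 'a list) monoid"
  where "Winf \<equiv> infinite_wreath G X \<phi>"

lemma group_Winf: "group Winf"
  by (rule group_infinite_wreath[where G = G and X = X and \<phi> = \<phi>, OF perm])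

lemma carrier_Winf: "w \<in> carrier Winf \<longleftrightarrow>
    (\<forall>n. w n \<in> iter_wreath_perms G X \<phi> n) \<and> (\<forall>n. iter_wreath_proj X n (w (Suc n)) = w n)"
  by (auto simp: infinite_wreath_def inverse_limit_def iter_wreath_def perm_group_def PiE_iff)

lemma Winf_Bij: "w \<in> carrier Winf \<Longrightarrow> w n \<in> Bij (words X n)"
  using subgroup.mem_carrier[OF subgroup_iter_wreath_perms[where G = G and X = X and \<phi> = \<phi>, OF action]]
  by (auto simp: carrier_Winf BijGroup_def)

lemma mult_Winf:
  assumes "v \<in> carrier Winf" "w \<in> carrier Winf"
  shows "(v \<otimes>\<^bsub>Winf\<^esub> w) n = compose (words X n) (v n) (w n)"
  using Winf_Bij[OF assms(1), of n] Winf_Bij[OF assms(2), of n]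
  by (simp add: infinite_wreath_def inverse_limit_def iter_wreath_def perm_group_def mult_BijGroup)

lemma one_Winf: "\<one>\<^bsub>Winf\<^esub> n = restrict id (words X n)"
  by (simp add: infinite_wreath_def inverse_limit_def iter_wreath_def perm_group_def one_BijGroup
      restrict_def fun_eq_iff)

lemma Winf_coord_mono:
  assumes v: "v \<in> carrier Winf" and w: "w \<in> carrier Winf" and eq: "v n = w n" and "m \<le> n"
  shows "v m = w m"
  using \<open>m \<le> n\<close>
proof (induction rule: inc_induct)
  case base
  show ?case by (rule eq)
next
  case (step m)
  then show ?case using v w by (metis carrier_Winf)
qed

definition lift :: "('a list \<Rightarrow> 'a \<Rightarrow> 'a) \<Rightarrow> nat \<Rightarrow> 'a list \<Rightarrow> 'a list"
  where "lift p n = restrict (aut p) (words X n)"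

lemma lift_in_Winf:
  assumes "portrait 0 p"
  shows "lift p \<in> carrier Winf"
  unfolding carrier_Winf
proof (intro conjI allI)
  fix n
  show "lift p n \<in> iter_wreath_perms G X \<phi> n"
    unfolding lift_def by (rule restrict_aut_in_iter_wreath[OF assms])
  show "iter_wreath_proj X n (lift p (Suc n)) = lift p n"
  proof (rule extensionalityI[of _ "words X n"])
    fix u assume u: "u \<in> words X n"
    have "(SOME x. x \<in> X n) \<in> X n" using X_nonempty[of n] by (simp add: some_in_eq)
    then have "u @ [SOME x. x \<in> X n] \<in> words X (Suc n)" using u by (auto simp: words_Suc)
    then show "iter_wreath_proj X n (lift p (Suc n)) u = lift p n u"
      using u by (simp add: iter_wreath_proj_def lift_def aut_append)
  qed (simp_all add: iter_wreath_proj_def lift_def)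
qed

lemma Winf_tfg_iff:
  "topologically_finitely_generated Winf (infinite_wreath_topology G X \<phi>) \<longleftrightarrow>
    (\<exists>S. finite S \<and> S \<subseteq> carrier Winf \<and>
      (\<forall>w\<in>carrier Winf. \<forall>N. \<exists>s\<in>generate Winf S. \<forall>n<N. s n = w n))"
proof -
  have *: "infinite_wreath_topology G X \<phi> closure_of (generate Winf S) =
      topspace (infinite_wreath_topology G X \<phi>) \<longleftrightarrow>
      (\<forall>w\<in>carrier Winf. \<forall>N. \<exists>s\<in>generate Winf S. \<forall>n<N. s n = w n)"
    if "S \<subseteq> carrier Winf" for S
  proof -
    have "carrier Winf \<subseteq> carrier (product_group UNIV (iter_wreath G X \<phi>))"
      by (auto simp: infinite_wreath_def inverse_limit_def)
    moreover have "generate Winf S \<subseteq> carrier Winf"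
      by (rule group.generate_incl[OF group_Winf that])
    moreover have "infinite_wreath_topology G X \<phi> =
        subtopology (prodiscrete_topology (iter_wreath G X \<phi>)) (carrier Winf)"
      by (simp add: infinite_wreath_topology_def inverse_limit_topology_def infinite_wreath_def)
    ultimately show ?thesis
      using closure_of_prodiscrete[of "carrier Winf" "iter_wreath G X \<phi>" "generate Winf S"]
      unfolding topspace_infinite_wreath_topology by (simp only:)
  qed
  show ?thesis
    unfolding topologically_finitely_generated_def
    by (intro ex_cong1 conj_cong refl) (rule *)
qed

text \<open>Density is checked on finite levels. Arbitrarily deep levels suffice, because a
  coordinate of a coherent sequence determines all earlier ones.\<close>

lemma tfg_if_levels_generated:
  assumes S: "finite S" "\<And>p. p \<in> S \<Longrightarrow> portrait 0 p"
    and gen: "\<And>n. \<exists>N\<ge>n. \<forall>H. transf_group H \<longrightarrow>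
      (\<forall>p\<in>S. aut (\<lambda>u. if length u < N then p u else id) \<in> H) \<longrightarrow> T 0 N \<subseteq> H"
  shows "topologically_finitely_generated Winf (infinite_wreath_topology G X \<phi>)"
  unfolding Winf_tfg_iff
proof (intro exI[of _ "lift ` S"] conjI ballI allI)
  show "finite (lift ` S)" using S(1) by simp
  show sub: "lift ` S \<subseteq> carrier Winf" using lift_in_Winf S(2) by blast
  fix w n assume w: "w \<in> carrier Winf"
  interpret group Winf by (rule group_Winf)
  obtain N where N: "n \<le> N" "\<forall>H. transf_group H \<longrightarrow>
      (\<forall>p\<in>S. aut (\<lambda>u. if length u < N then p u else id) \<in> H) \<longrightarrow> T 0 N \<subseteq> H"
    using gen[of n] by blast
  let ?gen = "generate Winf (lift ` S)"
  \<comment> \<open>The finite-level maps realized at coordinate \<open>N\<close> by the generated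
    subgroup; the generation hypothesis is applied to this set.\<close>
  define H where "H = {f \<in> T 0 N. \<exists>s\<in>?gen. restrict f (words X N) = s N}"
  have gen_carrier: "s \<in> carrier Winf" if "s \<in> ?gen" for s
    using generate_in_carrier[OF sub that] .
  have maps: "f u \<in> words X N \<longleftrightarrow> u \<in> words X N" if f: "f \<in> T 0 N" for f u
  proof -
    obtain p where "f = aut p" "portrait 0 p" using f by (auto simp: T_def)
    then show ?thesis using aut_in_W[of 0 p u N] by simp
  qed
  have "transf_group H"
    unfolding transf_group_def
  proof (intro conjI ballI)
    show "id \<in> H"
      unfolding H_def using T_closed(1) generate.one[of Winf "lift ` S"] one_Winf[of N]
      by (metis (mono_tags, lifting) mem_Collect_eq)
  next
    fix f g assume "f \<in> H" "g \<in> H"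
    then obtain s t where f: "f \<in> T 0 N" "s \<in> ?gen" "restrict f (words X N) = s N"
      and g: "g \<in> T 0 N" "t \<in> ?gen" "restrict g (words X N) = t N" by (auto simp: H_def)
    have "restrict (f \<circ> g) (words X N) = compose (words X N) (s N) (t N)"
      unfolding f(3)[symmetric] g(3)[symmetric] using maps[OF g(1)]
      by (auto simp: compose_def fun_eq_iff)
    also have "\<dots> = (s \<otimes>\<^bsub>Winf\<^esub> t) N"
      by (rule mult_Winf[symmetric]) (use gen_carrier f g in auto)
    finally have "restrict (f \<circ> g) (words X N) = (s \<otimes>\<^bsub>Winf\<^esub> t) N" .
    moreover have "s \<otimes>\<^bsub>Winf\<^esub> t \<in> ?gen" by (rule generate.eng[OF f(2) g(2)])
    ultimately show "f \<circ> g \<in> H" unfolding H_def using T_closed(2)[OF f(1) g(1)] by blast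
  next
    fix f assume "f \<in> H"
    then obtain s where f: "f \<in> T 0 N" "s \<in> ?gen" "restrict f (words X N) = s N"
      by (auto simp: H_def)
    show bij: "bij f" by (rule T_closed(3)[OF f(1)])
    have inv: "inv\<^bsub>Winf\<^esub> s \<in> ?gen" by (rule generate_m_inv_closed[OF sub f(2)])
    have "compose (words X N) (s N) ((inv\<^bsub>Winf\<^esub> s) N) = restrict id (words X N)"
      using mult_Winf[OF gen_carrier[OF f(2)] gen_carrier[OF inv], of N]
        r_inv[OF gen_carrier[OF f(2)]] one_Winf[of N] by simp
    then have "f ((inv\<^bsub>Winf\<^esub> s) N u) = u" if u: "u \<in> words X N" for u
    proof -
      have "(inv\<^bsub>Winf\<^esub> s) N u \<in> words X N"
        using Bij_imp_funcset[OF Winf_Bij[OF gen_carrier[OF inv], of N]] u by blast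
      then show ?thesis
        using fun_cong[OF \<open>compose (words X N) (s N) ((inv\<^bsub>Winf\<^esub> s) N) = restrict id (words X N)\<close>, of u] u
        by (simp add: compose_def f(3)[symmetric])
    qed
    then have "inverse_map f u = (inv\<^bsub>Winf\<^esub> s) N u" if "u \<in> words X N" for u
      using bij_comp_inverse_map(4)[OF bij] that by metis
    then have "restrict (inverse_map f) (words X N) = (inv\<^bsub>Winf\<^esub> s) N"
      using Winf_Bij[OF gen_carrier[OF inv], of N]
      by (intro extensionalityI[of _ "words X N"]) (auto simp: Bij_def)
    then show "inverse_map f \<in> H" unfolding H_def using T_closed(4)[OF f(1)] inv by blast
  qed
  moreover have "aut (\<lambda>u. if length u < N then p u else id) \<in> H" if p: "p \<in> S" for p
  proof -
    let ?q = "\<lambda>u. if length u < N then p u else id"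
    have "portrait 0 ?q" using S(2)[OF p] id_in_act by (auto simp: portrait_def)
    then have "aut ?q \<in> T 0 N" by (rule aut_in_T) simp
    moreover have "restrict (aut ?q) (words X N) = lift p N"
      unfolding lift_def by (rule restrict_ext) (auto simp: words_def intro!: aut_cong)
    moreover have "lift p \<in> ?gen" using p by (intro generate.incl) simp
    ultimately show ?thesis unfolding H_def by blast
  qed
  ultimately have "T 0 N \<subseteq> H" using N(2) by blast
  moreover obtain f where f: "f \<in> T 0 N" "w N = restrict f (words X N)"
    using iter_wreath_T[of "w N" N] w by (auto simp: carrier_Winf)
  ultimately obtain s where s: "s \<in> ?gen" "s N = w N" by (auto simp: H_def)
  have "s k = w k" if "k < n" for k
    using Winf_coord_mono[OF gen_carrier[OF s(1)] w s(2), of k] that N(1) by simp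
  then show "\<exists>s\<in>?gen. \<forall>k<n. s k = w k" using s(1) by blast
qed

end

section \<open>From generators modulo commutators to generators\<close>

lemma prodiscrete_tfg_iff:
  assumes "\<And>n. group (G n)"
  shows "topologically_finitely_generated (product_group UNIV G) (prodiscrete_topology G) \<longleftrightarrow>
    (\<exists>S. finite S \<and> S \<subseteq> carrier (product_group UNIV G) \<and>
      (\<forall>w\<in>carrier (product_group UNIV G). \<forall>N.
        \<exists>s\<in>generate (product_group UNIV G) S. \<forall>n<N. s n = w n))"
proof -
  let ?P = "product_group UNIV G"
  have group: "group ?P" using assms by simp
  have "prodiscrete_topology G closure_of (generate ?P S) = topspace (prodiscrete_topology G) \<longleftrightarrow>
      (\<forall>w\<in>carrier ?P. \<forall>N. \<exists>s\<in>generate ?P S. \<forall>n<N. s n = w n)"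
    if "S \<subseteq> carrier ?P" for S
    using closure_of_prodiscrete[OF subset_refl group.generate_incl[OF group that]]
      subtopology_topspace[of "prodiscrete_topology G"]
    unfolding topspace_prodiscrete_topology by simp
  note * = this
  show ?thesis
    unfolding topologically_finitely_generated_def
    by (intro ex_cong1 conj_cong refl) (rule *)
qed

section \<open>Abelianizations and lifts of generators\<close>

context perm_tower
begin

text \<open>Generators of the limit are supplied as portraits, so one portrait is chosen for each
  element of the finite group \<open>T 0 N\<close>.\<close>

lemma finite_portraits:
  obtains P where "finite P" "aut ` P = T 0 N" "\<And>p. p \<in> P \<Longrightarrow> portrait 0 p"
    "\<And>p u. p \<in> P \<Longrightarrow> N \<le> length u \<Longrightarrow> p u = id"
proof -
  define pick where "pick f = (SOME p. f = aut p \<and> portrait 0 p \<and> (\<forall>u. N \<le> 0 + length u \<longrightarrow> p u = id))" for f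
  have pick: "f = aut (pick f) \<and> portrait 0 (pick f) \<and> (\<forall>u. N \<le> 0 + length u \<longrightarrow> pick f u = id)"
    if "f \<in> T 0 N" for f
  proof -
    have "\<exists>p. f = aut p \<and> portrait 0 p \<and> (\<forall>u. N \<le> 0 + length u \<longrightarrow> p u = id)"
      using that unfolding T_def by blast
    then show ?thesis unfolding pick_def by (rule someI_ex)
  qed
  show thesis
  proof (rule that)
    show "finite (pick ` T 0 N)" by (intro finite_imageI finite_T)
    show "aut ` pick ` T 0 N = T 0 N" using pick by (force simp: image_iff)
  qed (use pick in force)+
qed

abbreviation A :: "nat \<Rightarrow> 'g set monoid"
  where "A n \<equiv> abelianization (G n)"

definition cls :: "nat \<Rightarrow> 'g \<Rightarrow> 'g set"
  where "cls n g = derived (G n) (carrier (G n)) #>\<^bsub>G n\<^esub> g"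

lemma derived_normal: "derived (G n) (carrier (G n)) \<lhd> G n"
  by (rule group.derived_self_is_normal[OF group_G])

lemma comm_group_A: "comm_group (A n)"
  unfolding abelianization_def by (rule group.derived_quot_is_comm_group[OF group_G])

lemma group_A: "group (A n)"
  using comm_group_A comm_group.axioms(2) by blast

lemma group_hom_cls: "group_hom (G n) (A n) (cls n)"
  using normal.r_coset_hom_Mod[OF derived_normal, of n] group_G group_A
  by (simp add: group_hom_def group_hom_axioms_def abelianization_def cls_def[abs_def])

lemma carrier_A: "carrier (A n) = cls n ` carrier (G n)"
  by (auto simp: abelianization_def FactGroup_def RCOSETS_def cls_def)

lemma cls_eq_iff:
  assumes "g \<in> carrier (G n)" "h \<in> carrier (G n)" "cls n g = cls n h"
  shows "g \<otimes>\<^bsub>G n\<^esub> inv\<^bsub>G n\<^esub> h \<in> derived (G n) (carrier (G n))"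
proof -
  interpret group "G n" by (rule group_G)
  have sub: "subgroup (derived (G n) (carrier (G n))) (G n)"
    by (rule derived_is_subgroup) simp
  have "g \<in> cls n h" using rcos_self[OF assms(1) sub] assms(3) by (simp add: cls_def)
  then show ?thesis using subgroup.rcos_module[OF sub is_group assms(2,1)] by (simp add: cls_def)
qed

abbreviation PG :: "(nat \<Rightarrow> 'g) monoid"
  where "PG \<equiv> product_group UNIV G"

abbreviation PA :: "(nat \<Rightarrow> 'g set) monoid"
  where "PA \<equiv> product_group UNIV (\<lambda>n. A n)"

lemma group_PG: "group PG" and group_PA: "group PA"
  using group_G group_A by simp_all

lemma PG_simps: "g \<in> carrier PG \<longleftrightarrow> (\<forall>n. g n \<in> carrier (G n))"
  "g \<otimes>\<^bsub>PG\<^esub> h = (\<lambda>n. g n \<otimes>\<^bsub>G n\<^esub> h n)" "\<one>\<^bsub>PG\<^esub> = (\<lambda>n. \<one>\<^bsub>G n\<^esub>)"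
  by (auto simp: PiE_iff)

lemma PA_simps: "s \<in> carrier PA \<longleftrightarrow> (\<forall>n. s n \<in> carrier (A n))"
  "s \<otimes>\<^bsub>PA\<^esub> t = (\<lambda>n. s n \<otimes>\<^bsub>A n\<^esub> t n)"
  by (auto simp: PiE_iff)

lemma group_hom_coord: "group_hom PG (G n) (\<lambda>g. g n)"
  using group_PG group_G by (simp add: group_hom_def group_hom_axioms_def hom_def PiE_iff)

lemma group_hom_classes: "group_hom PG PA (\<lambda>g n. cls n (g n))"
  unfolding group_hom_def group_hom_axioms_def hom_def mem_Collect_eq PG_simps(2) PA_simps(2)
  using group_PG group_PA group_hom.hom_closed[OF group_hom_cls] group_hom.hom_mult[OF group_hom_cls]
  by (simp add: PiE_iff)

text \<open>Here the uniform bound enters: each generating set is listed with \<open>m\<close>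
  indices, padded by the identity, and the \<open>i\<close>-th entries of all lists form one
  sequence.\<close>

lemma common_generators:
  assumes "\<And>n. generated_by_at_most m (G n)"
  obtains B where "finite B" "B \<subseteq> carrier PG" "\<And>n. generate (G n) ((\<lambda>g. g n) ` B) = carrier (G n)"
proof -
  have "\<exists>f. (\<forall>i. f i \<in> carrier (G n)) \<and> generate (G n) (f ` {..<m}) = carrier (G n)" for n
  proof -
    interpret group "G n" by (rule group_G)
    obtain S where S: "S \<subseteq> carrier (G n)" "finite S" "card S \<le> m" "generate (G n) S = carrier (G n)"
      using assms[of n] by (auto simp: generated_by_at_most_def)
    obtain h where h: "bij_betw h {0..<card S} S" using ex_bij_betw_nat_finite[OF S(2)] by blast
    define f where "f i = (if i < card S then h i else \<one>\<^bsub>G n\<^esub>)" for i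
    have f: "f i \<in> carrier (G n)" for i
      using h S(1) by (auto simp: f_def bij_betw_def)
    have "S \<subseteq> f ` {..<m}"
    proof
      fix s assume "s \<in> S"
      then have "s \<in> h ` {0..<card S}" using h by (simp add: bij_betw_def)
      then obtain i where "i < card S" "s = h i" by auto
      then show "s \<in> f ` {..<m}" using S(3) by (intro image_eqI[of _ _ i]) (simp_all add: f_def)
    qed
    then have "carrier (G n) \<subseteq> generate (G n) (f ` {..<m})"
      using mono_generate[of S "f ` {..<m}"] S(4) by simp
    moreover have "generate (G n) (f ` {..<m}) \<subseteq> carrier (G n)"
      by (rule generate_incl) (use f in blast)
    ultimately show ?thesis using f by blast
  qed
  then obtain f where f: "\<And>n i. f n i \<in> carrier (G n)"
    "\<And>n. generate (G n) (f n ` {..<m}) = carrier (G n)" by metis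
  let ?B = "(\<lambda>i n. f n i) ` {..<m}"
  have "(\<lambda>g. g n) ` ?B = f n ` {..<m}" for n by (simp add: image_image)
  then show thesis using that[of ?B] f by (auto simp: PiE_iff)
qed

text \<open>Two finite sets are joined: sequences generating every coordinate, and lifts of
  topological generators of the product of the abelianizations. The first give surjectivity, the
  second approximation modulo commutators.\<close>

lemma generators_modulo_derived:
  assumes gen: "\<And>n. generated_by_at_most m (G n)"
    and ab: "topologically_finitely_generated PA (prodiscrete_topology (\<lambda>n. A n))"
  obtains B where "finite B" "B \<subseteq> carrier PG"
    "\<And>n g. g \<in> carrier (G n) \<Longrightarrow> \<exists>h\<in>generate PG B. h n = g"
    "\<And>g N. g \<in> carrier PG \<Longrightarrow> \<exists>h\<in>generate PG B. \<forall>n<N.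
      g n \<otimes>\<^bsub>G n\<^esub> inv\<^bsub>G n\<^esub> (h n) \<in> derived (G n) (carrier (G n))"
proof -
  let ?c = "\<lambda>g n. cls n (g n)"
  obtain B1 where B1: "finite B1" "B1 \<subseteq> carrier PG"
    "\<And>n. generate (G n) ((\<lambda>g. g n) ` B1) = carrier (G n)"
    by (rule common_generators[OF gen]) (rule that)
  obtain S where S: "finite S" "S \<subseteq> carrier PA"
    "\<forall>w\<in>carrier PA. \<forall>N. \<exists>s\<in>generate PA S. \<forall>n<N. s n = w n"
    using ab[unfolded prodiscrete_tfg_iff[of "\<lambda>n. A n", OF group_A]] by blast
  have "\<exists>g\<in>carrier PG. ?c g = s" if "s \<in> S" for s
  proof -
    have "\<exists>g. g \<in> carrier (G n) \<and> cls n g = s n" for n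
    proof -
      have "s n \<in> carrier (A n)" using subsetD[OF S(2) that] PA_simps(1) by blast
      then obtain g where "g \<in> carrier (G n)" "s n = cls n g" unfolding carrier_A by blast
      then show ?thesis by (intro exI[of _ g]) simp
    qed
    then obtain g where "\<And>n. g n \<in> carrier (G n)" "\<And>n. cls n (g n) = s n" by metis
    then show ?thesis by (intro bexI[of _ g]) (auto simp: PiE_iff)
  qed
  then have "S \<subseteq> ?c ` carrier PG" by blast
  then obtain B2 where B2: "finite B2" "B2 \<subseteq> carrier PG" "S = ?c ` B2"
    using finite_subset_image[OF S(1)] by metis
  let ?B = "B1 \<union> B2"
  have B: "?B \<subseteq> carrier PG" using B1(2) B2(2) by blast
  show thesis
  proof (rule that[of ?B])
    show "finite ?B" "?B \<subseteq> carrier PG" using B1(1) B2(1) B by simp_all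
    fix n g assume g: "g \<in> carrier (G n)"
    have "generate (G n) ((\<lambda>g. g n) ` B1) \<subseteq> generate (G n) ((\<lambda>g. g n) ` ?B)"
      by (rule group.mono_generate[OF group_G]) blast
    moreover have "(\<lambda>g. g n) ` generate PG ?B = generate (G n) ((\<lambda>g. g n) ` ?B)"
      by (rule group_hom.generate_img[OF group_hom_coord B, symmetric])
    ultimately have "g \<in> (\<lambda>g. g n) ` generate PG ?B" using g B1(3)[of n] by blast
    then show "\<exists>h\<in>generate PG ?B. h n = g" by blast
  next
    fix g N assume g: "g \<in> carrier PG"
    then have "?c g \<in> carrier PA" by (rule group_hom.hom_closed[OF group_hom_classes])
    from S(3)[THEN bspec, OF this, THEN spec, of N] obtain s
      where "s \<in> generate PA S" "\<forall>n<N. s n = cls n (g n)" ..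
    then have s: "s \<in> generate PA S" "\<And>n. n < N \<Longrightarrow> s n = cls n (g n)" by simp_all
    have "generate PA S \<subseteq> generate PA (?c ` ?B)"
      by (rule group.mono_generate[OF group_PA]) (use B2(3) in blast)
    moreover have "?c ` generate PG ?B = generate PA (?c ` ?B)"
      by (rule group_hom.generate_img[OF group_hom_classes B, symmetric])
    ultimately obtain h where h: "h \<in> generate PG ?B" "s = ?c h" using s(1) by blast
    have "g n \<otimes>\<^bsub>G n\<^esub> inv\<^bsub>G n\<^esub> (h n) \<in> derived (G n) (carrier (G n))" if "n < N" for n
    proof (rule cls_eq_iff)
      have "h \<in> carrier PG" by (rule group.generate_in_carrier[OF group_PG B h(1)])
      then show "g n \<in> carrier (G n)" "h n \<in> carrier (G n)" using g PG_simps(1) by blast+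
      show "cls n (g n) = cls n (h n)" using s(2)[OF that] h(2) by simp
    qed
    then show "\<exists>h\<in>generate PG ?B. \<forall>n<N.
        g n \<otimes>\<^bsub>G n\<^esub> inv\<^bsub>G n\<^esub> (h n) \<in> derived (G n) (carrier (G n))"
      using h(1) by blast
  qed
qed

text \<open>From level \<open>M\<close> on all local permutations are trivial, so deeper truncations
  add nothing to the finite group \<open>T 0 M\<close>, whose elements all serve as
  generators.\<close>

lemma Winf_tfg_if_finitely_many_levels:
  assumes triv: "\<And>n. M \<le> n \<Longrightarrow> \<exists>x. X n = {x}"
  shows "topologically_finitely_generated Winf (infinite_wreath_topology G X \<phi>)"
proof -
  obtain P where P: "finite P" "aut ` P = T 0 M" "\<And>p. p \<in> P \<Longrightarrow> portrait 0 p"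
    "\<And>p u. p \<in> P \<Longrightarrow> M \<le> length u \<Longrightarrow> p u = id"
    using finite_portraits[of M] by blast
  show ?thesis
  proof (rule tfg_if_levels_generated[OF P(1,3)])
    fix n
    show "\<exists>N\<ge>n. \<forall>H. transf_group H \<longrightarrow>
        (\<forall>p\<in>P. aut (\<lambda>u. if length u < N then p u else id) \<in> H) \<longrightarrow> T 0 N \<subseteq> H"
    proof (intro exI[of _ "max n M"] conjI allI impI subsetI)
      fix H f
      assume H: "\<forall>p\<in>P. aut (\<lambda>u. if length u < max n M then p u else id) \<in> H"
        and f: "f \<in> T 0 (max n M)"
      obtain p where p: "f = aut p" "portrait 0 p" using f by (auto simp: T_def)
      have "p u = id" if "M \<le> length u" for u
        using portraitD(3)[OF p(2), of u] act_singleton triv[OF that] by auto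
      then have "f \<in> T 0 M" using aut_in_T[OF p(2)] p(1) by simp
      then obtain q where q: "q \<in> P" "f = aut q" using P(2) by blast
      have "(\<lambda>u. if length u < max n M then q u else id) = q"
        using P(4)[OF q(1)] by (auto simp: fun_eq_iff)
      then show "f \<in> H" using H q by metis
    qed simp
  qed
qed

end

section \<open>Generators of the infinite wreath product\<close>

context block_tower
begin

text \<open>The generators are the finite wreath product of block 0, in \<open>P\<close>, and the
  infinite directed automorphisms of the sequences in \<open>B\<close> for both level types, in
  \<open>Q\<close>. At each block boundary \<open>generated_by_directed\<close> applies.\<close>

lemma Winf_tfg_if_blocks:
  assumes c0: "c 0 = 0" and B: "finite B" "B \<subseteq> carrier PG"
    and onto: "\<And>n g. g \<in> carrier (G n) \<Longrightarrow> \<exists>h\<in>generate PG B. h n = g"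
    and dense: "\<And>g N. g \<in> carrier PG \<Longrightarrow> \<exists>h\<in>generate PG B. \<forall>n<N.
      g n \<otimes>\<^bsub>G n\<^esub> inv\<^bsub>G n\<^esub> (h n) \<in> derived (G n) (carrier (G n))"
  shows "topologically_finitely_generated Winf (infinite_wreath_topology G X \<phi>)"
proof -
  have seqs: "carrier PG = seqs" by (auto simp: PG_simps(1) simp del: carrier_product_group)
  obtain P where P: "finite P" "aut ` P = T 0 (c 1)" "\<And>p. p \<in> P \<Longrightarrow> portrait 0 p"
    "\<And>p u. p \<in> P \<Longrightarrow> c 1 \<le> length u \<Longrightarrow> p u = id"
    using finite_portraits[of "c 1"] by blast
  define Q where "Q = (\<lambda>(e, g). dir_portrait UNIV e 0 g) ` ({a, b} \<times> B)"
  have dirs: "portrait 0 (dir_portrait UNIV e 0 g)" if "e \<in> {a, b}" "g \<in> B" for e g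
    using portrait_dir[OF that(1), of g 0 UNIV] that(2) B(2) seqs c0 by auto
  show ?thesis
  proof (rule tfg_if_levels_generated[of "P \<union> Q"])
    show "finite (P \<union> Q)" using P(1) B(1) by (simp add: Q_def)
    show "portrait 0 p" if "p \<in> P \<union> Q" for p using that P(3) dirs by (auto simp: Q_def)
    fix n
    let ?N = "c (Suc n)"
    have "k \<le> c k" for k
    proof (induction k)
      case (Suc k)
      then show ?case using c_less[of k] by simp
    qed simp
    then have "n \<le> ?N" using Suc_leD by blast
    moreover have "T 0 ?N \<subseteq> H" if H: "transf_group H"
      and gens: "\<forall>p\<in>P \<union> Q. aut (\<lambda>u. if length u < ?N then p u else id) \<in> H" for H
    proof -
      have c1: "c 1 \<le> ?N" by (rule c_mono) simp
      have top: "T 0 (c 1) \<subseteq> H"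
      proof
        fix f assume "f \<in> T 0 (c 1)"
        then obtain q where q: "q \<in> P" "f = aut q" using P(2) by blast
        have eq: "(\<lambda>u. if length u < ?N then q u else id) = q"
          using P(4)[OF q(1)] c1 by (auto simp: fun_eq_iff)
        have "aut (\<lambda>u. if length u < ?N then q u else id) \<in> H" using gens q(1) by blast
        then show "f \<in> H" unfolding eq q(2) .
      qed
      have dirB: "dir {..<Suc n} e 0 g \<in> H" if e: "e \<in> {a, b}" and g: "g \<in> B" for e g
      proof -
        \<comment> \<open>Cutting the infinite automorphism at the block boundary \<open>?N\<close>
          leaves exactly the blocks below \<open>Suc n\<close>, the form used in the induction over
          blocks.\<close>
        have act: "active {..<Suc n} e 0 u \<longleftrightarrow> length u < ?N \<and> active UNIV e 0 u" for u
        proof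
          assume *: "active {..<Suc n} e 0 u"
          then obtain i where "Suc i < Suc n" "length u = e (Suc i)"
            using active_level[OF e *] c0 by auto
          then have "length u < ?N"
            using block_level(2)[OF e, of "Suc i"] c_mono[of "Suc (Suc i)" "Suc n"] by simp
          then show "length u < ?N \<and> active UNIV e 0 u" using * by (auto simp: active_def)
        next
          assume *: "length u < ?N \<and> active UNIV e 0 u"
          then obtain i where i: "length u = e (Suc i)" "u = offspine (c 0) (a i) (e (Suc i))"
            using active_level[OF e, of UNIV 0 u] c0 by auto
          have "Suc i < Suc n"
          proof (rule ccontr)
            assume "\<not> Suc i < Suc n"
            then have "?N \<le> e (Suc i)"
              using block_level(1)[OF e, of "Suc i"] c_mono[of "Suc n" "Suc i"] by simp
            then show False using * i(1) by simp
          qed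
          then show "active {..<Suc n} e 0 u" using i(2) by (auto simp: active_def)
        qed
        have "(\<lambda>u. if length u < ?N then dir_portrait UNIV e 0 g u else id) = dir_portrait {..<Suc n} e 0 g"
          by (rule ext) (simp add: dir_portrait_def act)
        moreover have "dir_portrait UNIV e 0 g \<in> P \<union> Q"
          using e g by (auto simp: Q_def)
        ultimately show ?thesis unfolding dir_def using gens by metis
      qed
      \<comment> \<open>The approximating sequences come from the subgroup generated by
        \<open>B\<close>; multiplicativity carries membership in \<open>H\<close> over to
        it.\<close>
      have "dir {..<Suc n} e 0 g \<in> H" if e: "e \<in> {a, b}" and g: "g \<in> generate PG B" for e g
        using g
      proof induction
        case one
        have "dir {..<Suc n} e 0 \<one>\<^bsub>PG\<^esub> = id" unfolding PG_simps(3) by (rule dir_one)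
        then show ?case using transf_groupD(1)[OF H] by (simp only:)
      next
        case (incl h)
        then show ?case by (rule dirB[OF e])
      next
        case (inv h)
        interpret PG: group PG by (rule group_PG)
        have h: "h \<in> carrier PG" using inv B(2) by blast
        let ?d = "dir {..<Suc n} e 0"
        have mult: "?d (g \<otimes>\<^bsub>PG\<^esub> k) = ?d g \<circ> ?d k" if "g \<in> carrier PG" "k \<in> carrier PG" for g k
          unfolding PG_simps(2) by (rule dir_mult[OF e]) (use that seqs in blast)+
        have one: "?d \<one>\<^bsub>PG\<^esub> = id" unfolding PG_simps(3) by (rule dir_one)
        have "?d h \<circ> ?d (inv\<^bsub>PG\<^esub> h) = id" "?d (inv\<^bsub>PG\<^esub> h) \<circ> ?d h = id"
          unfolding mult[OF h PG.inv_closed[OF h], symmetric] mult[OF PG.inv_closed[OF h] h, symmetric]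
            PG.r_inv[OF h] PG.l_inv[OF h] by (rule one)+
        then have "?d (inv\<^bsub>PG\<^esub> h) = inverse_map (?d h)" by (intro inv_unique_comp[symmetric])
        then show ?case using transf_groupD(4)[OF H dirB[OF e inv]] by (simp only:)
      next
        case (eng h k)
        have "h \<in> seqs" "k \<in> seqs"
          using group.generate_in_carrier[OF group_PG B(2)] eng.hyps seqs by blast+
        then have "dir {..<Suc n} e 0 (h \<otimes>\<^bsub>PG\<^esub> k) = dir {..<Suc n} e 0 h \<circ> dir {..<Suc n} e 0 k"
          unfolding PG_simps(2) by (rule dir_mult[OF e])
        then show ?case using transf_groupD(2)[OF H eng.IH] by (simp only:)
      qed
      moreover have "generate PG B \<subseteq> seqs"
        using group.generate_incl[OF group_PG B(2)] seqs by blast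
      ultimately have "T (c 0) (c (Suc n)) \<subseteq> H"
        using generated_by_directed[of "generate PG B" 0 "Suc n" H] onto dense H top c0 seqs by simp
      then show ?thesis by (simp add: c0)
    qed
    ultimately show "\<exists>N\<ge>n. \<forall>H. transf_group H \<longrightarrow>
        (\<forall>p\<in>P \<union> Q. aut (\<lambda>u. if length u < N then p u else id) \<in> H) \<longrightarrow> T 0 N \<subseteq> H"
      by blast
  qed
qed

end

section \<open>Cutting the levels into blocks\<close>

context perm_tower
begin

lemma Winf_tfg_if_abelianization:
  assumes gen: "\<And>n. generated_by_at_most m (G n)"
    and ab: "topologically_finitely_generated PA (prodiscrete_topology (\<lambda>n. A n))"
  shows "topologically_finitely_generated Winf (infinite_wreath_topology G X \<phi>)"
proof -
  define Z where "Z = {n. \<exists>x\<in>X n. \<exists>y\<in>X n. x \<noteq> y}"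
  define o1 where "o1 n = (SOME x. x \<in> X n)" for n
  have o1: "o1 n \<in> X n" for n using X_nonempty[of n] by (simp add: o1_def some_in_eq)
  have triv: "X n = {o1 n}" if "n \<notin> Z" for n using that o1[of n] by (auto simp: Z_def)
  show ?thesis
  proof (cases "finite Z")
    case True
    then obtain M where "Z \<subseteq> {..<M}" using finite_nat_iff_bounded by blast
    then have "X n = {o1 n}" if "M \<le> n" for n using triv[of n] that by force
    then show ?thesis using Winf_tfg_if_finitely_many_levels[of M] by blast
  next
    case False
    define z where "z = enumerate Z"
    have z_less: "z i < z j \<longleftrightarrow> i < j" for i j using False by (simp add: z_def)
    have z_Z: "z i \<in> Z" for i using False by (simp add: z_def enumerate_in_set)
    \<comment> \<open>With \<open>z\<close> enumerating the levels with several letters, each block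
      contains two of them. Block 0 starts at level 0 to absorb the singleton levels before
      \<open>z 0\<close>.\<close>
    define c where "c j = (if j = 0 then 0 else z (2 * j))" for j
    define a where "a j = z (2 * j)" for j
    define b where "b j = z (2 * j + 1)" for j
    \<comment> \<open>Outside \<open>Z\<close> no second letter exists and \<open>o2\<close> falls
      back to \<open>o1\<close>. The levels \<open>a j\<close> and \<open>b j\<close>, where the
      letters must differ, belong to \<open>Z\<close>.\<close>
    define o2 where "o2 n = (if n \<in> Z then SOME y. y \<in> X n \<and> y \<noteq> o1 n else o1 n)" for n
    have o2_Z: "o2 n \<in> X n \<and> o2 n \<noteq> o1 n" if "n \<in> Z" for n
    proof -
      have "\<exists>y. y \<in> X n \<and> y \<noteq> o1 n" using that by (auto simp: Z_def)
      then show ?thesis using someI_ex[of "\<lambda>y. y \<in> X n \<and> y \<noteq> o1 n"] that by (simp add: o2_def)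
    qed
    interpret block_tower G X \<phi> c a b o1 o2
    proof
      show "c j \<le> a j" "a j < b j" "b j < c (Suc j)" for j
        by (simp_all add: c_def a_def b_def z_less)
      show "o1 n \<in> X n" "o2 n \<in> X n" for n
        using o1 o2_Z by (cases "n \<in> Z"; simp add: o2_def)+
      show "o1 (a j) \<noteq> o2 (a j)" "o1 (b j) \<noteq> o2 (b j)" for j
        using o2_Z z_Z by (metis a_def, metis b_def)
      show "X n = {o1 n}" if n: "c j \<le> n" "n < c (Suc j)" "n \<noteq> a j" "n \<noteq> b j" for j n
      proof (rule triv, rule notI)
        assume "n \<in> Z"
        then obtain i where i: "n = z i" using False enumerate_Ex by (metis z_def)
        have "i < 2 * j + 2" using n(2) i by (simp add: c_def z_less)
        moreover have "2 * j \<le> i"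
          using n(1) i z_less[of i "2 * j"] by (cases "j = 0") (auto simp: c_def)
        ultimately have "i = 2 * j \<or> i = 2 * j + 1" by auto
        then show False using n(3,4) i by (auto simp: a_def b_def)
      qed
    qed
    obtain B where B: "finite B" "B \<subseteq> carrier PG"
      "\<And>n g. g \<in> carrier (G n) \<Longrightarrow> \<exists>h\<in>generate PG B. h n = g"
      "\<And>g N. g \<in> carrier PG \<Longrightarrow> \<exists>h\<in>generate PG B. \<forall>n<N.
        g n \<otimes>\<^bsub>G n\<^esub> inv\<^bsub>G n\<^esub> (h n) \<in> derived (G n) (carrier (G n))"
      by (rule generators_modulo_derived[OF gen ab]) (rule that)
    show ?thesis by (rule Winf_tfg_if_blocks[OF _ B]) (simp add: c_def)
  qed
qed

end

section \<open>The homomorphism onto the product of the abelianizations\<close>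

context perm_tower
begin

text \<open>Recovers the group element acting at \<open>u\<close> from the permutation of words;
  faithfulness makes it unique, see \<open>act_inj\<close>.\<close>

definition local_elt :: "nat \<Rightarrow> ('a list \<Rightarrow> 'a list) \<Rightarrow> 'a list \<Rightarrow> 'g"
  where "local_elt n w u =
    (SOME g. g \<in> carrier (G n) \<and> (\<forall>x\<in>X n. last (w (u @ [x])) = \<phi> n g x))"

text \<open>The target is abelian, so no order of the vertices has to be chosen.\<close>

definition level_class :: "nat \<Rightarrow> ('a list \<Rightarrow> 'a list) \<Rightarrow> 'g set"
  where "level_class n w = finprod (A n) (\<lambda>u. cls n (local_elt n w u)) (words X n)"

lemma act_inj:
  assumes "g \<in> carrier (G n)" "h \<in> carrier (G n)" "\<And>x. x \<in> X n \<Longrightarrow> \<phi> n g x = \<phi> n h x"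
  shows "g = h"
proof -
  have "\<phi> n g = \<phi> n h"
    using assms(3) Bij_imp_extensional[OF action_Bij[OF assms(1)]]
      Bij_imp_extensional[OF action_Bij[OF assms(2)]]
    by (rule_tac extensionalityI[of _ "X n"]) auto
  then show ?thesis using inj_onD[OF inj_action _ assms(1,2)] by blast
qed

lemma local_elt_aut:
  assumes u: "u \<in> words X n" and g: "g \<in> carrier (G n)" "p u = act n g"
  shows "local_elt n (restrict (aut p) (words X (Suc n))) u = g"
proof -
  have last: "last (restrict (aut p) (words X (Suc n)) (u @ [x])) = \<phi> n g x" if "x \<in> X n" for x
  proof -
    have "u @ [x] \<in> words X (Suc n)" using u that by (auto simp: words_Suc)
    then show ?thesis using g(2) that by (simp add: aut_append act_def)
  qed
  show ?thesis
    unfolding local_elt_def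
  proof (rule some_equality)
    show "g \<in> carrier (G n) \<and>
        (\<forall>x\<in>X n. last (restrict (aut p) (words X (Suc n)) (u @ [x])) = \<phi> n g x)"
      using g(1) last by blast
    fix h assume h: "h \<in> carrier (G n) \<and>
        (\<forall>x\<in>X n. last (restrict (aut p) (words X (Suc n)) (u @ [x])) = \<phi> n h x)"
    show "h = g"
      by (rule act_inj[OF _ g(1)]) (use h last in auto)
  qed
qed

lemma local_elt_portrait:
  assumes "portrait 0 p" "u \<in> words X n"
  shows "local_elt n (restrict (aut p) (words X (Suc n))) u \<in> carrier (G n)"
    "p u = act n (local_elt n (restrict (aut p) (words X (Suc n))) u)"
proof -
  have "length u = n" using assms(2) by (simp add: words_def)
  then obtain g where "g \<in> carrier (G n)" "p u = act n g" using portraitD(3)[OF assms(1), of u] by auto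
  then show "local_elt n (restrict (aut p) (words X (Suc n))) u \<in> carrier (G n)"
    "p u = act n (local_elt n (restrict (aut p) (words X (Suc n))) u)"
    using local_elt_aut[of u n g p] assms(2) by simp_all
qed

lemma cls_closed: "g \<in> carrier (G n) \<Longrightarrow> cls n g \<in> carrier (A n)"
  and cls_mult: "g \<in> carrier (G n) \<Longrightarrow> h \<in> carrier (G n) \<Longrightarrow>
    cls n (g \<otimes>\<^bsub>G n\<^esub> h) = cls n g \<otimes>\<^bsub>A n\<^esub> cls n h"
  and cls_one: "cls n \<one>\<^bsub>G n\<^esub> = \<one>\<^bsub>A n\<^esub>"
  by (rule group_hom.hom_closed[OF group_hom_cls] group_hom.hom_mult[OF group_hom_cls]
      group_hom.hom_one[OF group_hom_cls]; assumption)+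

lemma level_class_closed:
  assumes "w \<in> iter_wreath_perms G X \<phi> (Suc n)"
  shows "level_class n w \<in> carrier (A n)"
proof -
  interpret comm_group "A n" by (rule comm_group_A)
  from iter_wreath_portrait[OF assms] obtain p where
    "portrait 0 p \<and> (\<forall>u. Suc n \<le> length u \<longrightarrow> p u = id) \<and> w = restrict (aut p) (words X (Suc n))" ..
  then have "local_elt n w u \<in> carrier (G n)" if "u \<in> words X n" for u
    using local_elt_portrait(1) that by blast
  then show ?thesis unfolding level_class_def by (intro finprod_closed) (auto intro: cls_closed)
qed

text \<open>By the cocycle rule the local elements of a product involve vertices shifted by the
  second factor. A product over a whole level does not see this shift.\<close>

lemma level_class_mult:
  assumes v: "v \<in> iter_wreath_perms G X \<phi> (Suc n)" and w: "w \<in> iter_wreath_perms G X \<phi> (Suc n)"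
  shows "level_class n (compose (words X (Suc n)) v w) = level_class n v \<otimes>\<^bsub>A n\<^esub> level_class n w"
proof -
  interpret comm_group "A n" by (rule comm_group_A)
  let ?U = "words X n" and ?U' = "words X (Suc n)"
  from iter_wreath_portrait[OF v] obtain p where
    "portrait 0 p \<and> (\<forall>u. Suc n \<le> length u \<longrightarrow> p u = id) \<and> v = restrict (aut p) ?U'" ..
  then have p: "portrait 0 p" "v = restrict (aut p) ?U'" by simp_all
  from iter_wreath_portrait[OF w] obtain q where
    "portrait 0 q \<and> (\<forall>u. Suc n \<le> length u \<longrightarrow> q u = id) \<and> w = restrict (aut q) ?U'" ..
  then have q: "portrait 0 q" "w = restrict (aut q) ?U'" by simp_all
  define r where "r = (\<lambda>u. p (aut q u) \<circ> q u)"
  have maps: "aut q u \<in> words X k \<longleftrightarrow> u \<in> words X k" for u k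
    using aut_in_W[OF q(1), of u k] by simp
  have vw: "compose ?U' v w = restrict (aut r) ?U'"
    unfolding r_def aut_comp[symmetric] p(2) q(2)
    using maps by (auto simp: compose_def fun_eq_iff)
  have le: "local_elt n (compose ?U' v w) u = local_elt n v (aut q u) \<otimes>\<^bsub>G n\<^esub> local_elt n w u"
    if u: "u \<in> ?U" for u
  proof -
    have "aut q u \<in> ?U" using u maps by blast
    note 1 = local_elt_portrait[OF p(1) this] and 2 = local_elt_portrait[OF q(1) u]
    show ?thesis
      unfolding vw
    proof (rule local_elt_aut[OF u])
      show "local_elt n v (aut q u) \<otimes>\<^bsub>G n\<^esub> local_elt n w u \<in> carrier (G n)"
        unfolding p(2) q(2) by (rule G_closed(1)[OF 1(1) 2(1)])
      show "r u = act n (local_elt n v (aut q u) \<otimes>\<^bsub>G n\<^esub> local_elt n w u)"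
        unfolding p(2) q(2) act_mult[OF 1(1) 2(1)] r_def
        by (rule arg_cong2[where f = "(\<circ>)", OF 1(2) 2(2)])
    qed
  qed
  let ?f = "\<lambda>u. cls n (local_elt n v u)" and ?g = "\<lambda>u. cls n (local_elt n w u)"
  have fv: "local_elt n v u \<in> carrier (G n)" and gw: "local_elt n w u \<in> carrier (G n)" if "u \<in> ?U" for u
    using local_elt_portrait(1)[OF p(1) that] local_elt_portrait(1)[OF q(1) that]
    by (simp_all only: p(2) q(2))
  have f: "?f \<in> ?U \<rightarrow> carrier (A n)" and g: "?g \<in> ?U \<rightarrow> carrier (A n)"
    using cls_closed fv gw by blast+
  have fq: "(\<lambda>u. ?f (aut q u)) \<in> ?U \<rightarrow> carrier (A n)" using f maps by blast
  have inj: "inj_on (aut q) ?U"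
    using bij_is_inj[OF bij_aut_portrait[OF q(1)]] inj_on_subset by blast
  have img: "aut q ` ?U = ?U"
    by (rule endo_inj_surj[OF _ _ inj]) (use finite_W[of 0 n] maps in auto)
  have "level_class n (compose ?U' v w) = finprod (A n) (\<lambda>u. ?f (aut q u) \<otimes>\<^bsub>A n\<^esub> ?g u) ?U"
    unfolding level_class_def
  proof (rule finprod_cong')
    show "(\<lambda>u. ?f (aut q u) \<otimes>\<^bsub>A n\<^esub> ?g u) \<in> ?U \<rightarrow> carrier (A n)" using fq g by auto
    fix u assume u: "u \<in> ?U"
    then have "aut q u \<in> ?U" using maps by blast
    then show "cls n (local_elt n (compose ?U' v w) u) = ?f (aut q u) \<otimes>\<^bsub>A n\<^esub> ?g u"
      unfolding le[OF u] by (intro cls_mult fv gw u)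
  qed simp
  also have "\<dots> = finprod (A n) (\<lambda>u. ?f (aut q u)) ?U \<otimes>\<^bsub>A n\<^esub> finprod (A n) ?g ?U"
    by (rule finprod_multf[OF fq g])
  \<comment> \<open>Reindexing along \<open>aut q\<close>, which permutes the words of length
    \<open>n\<close>, removes the twist.\<close>
  also have "finprod (A n) (\<lambda>u. ?f (aut q u)) ?U = finprod (A n) ?f ?U"
    using finprod_reindex[of ?f "aut q" ?U] f inj unfolding img by simp
  finally show ?thesis by (simp only: level_class_def)
qed

lemma group_hom_level_classes: "group_hom Winf PA (\<lambda>w n. level_class n (w (Suc n)))"
  unfolding group_hom_def group_hom_axioms_def
proof (intro conjI group_Winf group_PA homI)
  fix w assume "w \<in> carrier Winf"
  then show "(\<lambda>n. level_class n (w (Suc n))) \<in> carrier PA"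
    unfolding PA_simps(1) carrier_Winf by (intro allI level_class_closed) blast
next
  fix v w assume vw: "v \<in> carrier Winf" "w \<in> carrier Winf"
  then show "(\<lambda>n. level_class n ((v \<otimes>\<^bsub>Winf\<^esub> w) (Suc n))) =
      (\<lambda>n. level_class n (v (Suc n))) \<otimes>\<^bsub>PA\<^esub> (\<lambda>n. level_class n (w (Suc n)))"
    unfolding PA_simps(2) mult_Winf[OF vw] carrier_Winf by (intro ext level_class_mult) blast+
qed

text \<open>Place a representative of each prescribed class at one vertex of its level; all other
  factors of the level product are trivial.\<close>

lemma level_classes_surj:
  assumes "t \<in> carrier PA"
  obtains w where "w \<in> carrier Winf" "\<And>n. level_class n (w (Suc n)) = t n"
proof -
  have "\<exists>g. g \<in> carrier (G n) \<and> t n = cls n g" for n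
  proof -
    have "t n \<in> carrier (A n)" using assms PA_simps(1) by blast
    then show ?thesis unfolding carrier_A by blast
  qed
  then obtain g where g: "\<And>n. g n \<in> carrier (G n)" "\<And>n. t n = cls n (g n)" by metis
  define v where "v n = map (\<lambda>i. SOME x. x \<in> X i) [0..<n]" for n
  have v: "v n \<in> words X n" for n
    using map_upt_in_words[of 0 n "\<lambda>i. SOME x. x \<in> X i" X] X_nonempty by (simp add: v_def some_in_eq)
  define p where "p u = (if u = v (length u) then act (length u) (g (length u)) else id)" for u
  have "u \<in> W 0 (length u)" if "u = v (length u)" for u
    using v[of "length u"] that by simp
  then have p: "portrait 0 p" using g(1) id_in_act by (auto simp: portrait_def p_def)
  have "level_class n (lift p (Suc n)) = t n" for n
  proof -
    interpret comm_group "A n" by (rule comm_group_A)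
    have len: "length u = n" if "u \<in> words X n" for u using that by (simp add: words_def)
    have le: "local_elt n (lift p (Suc n)) u = (if v n = u then g n else \<one>\<^bsub>G n\<^esub>)" if u: "u \<in> words X n" for u
      unfolding lift_def
      by (rule local_elt_aut[OF u]) (use g(1) G_closed len[OF u] act_one in \<open>auto simp: p_def\<close>)
    have "level_class n (lift p (Suc n)) = finprod (A n) (\<lambda>u. if v n = u then cls n (g n) else \<one>\<^bsub>A n\<^esub>) (words X n)"
      unfolding level_class_def
      by (rule finprod_cong') (use cls_closed[OF g(1)] cls_one le in auto)
    also have "\<dots> = cls n (g n)"
      using finprod_singleton[OF v finite_words[OF finite_X], of "\<lambda>_. cls n (g n)" n] cls_closed[OF g(1)]
      by simp
    finally show ?thesis using g(2) by simp
  qed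
  then show thesis using that[of "lift p"] lift_in_Winf[OF p] by blast
qed

text \<open>The homomorphism is onto and each class depends on a single coordinate, so it carries a
  dense finitely generated subgroup to a dense one.\<close>

lemma abelianization_tfg_if_Winf:
  assumes "topologically_finitely_generated Winf (infinite_wreath_topology G X \<phi>)"
  shows "topologically_finitely_generated PA (prodiscrete_topology (\<lambda>n. A n))"
proof -
  let ?f = "\<lambda>w n. level_class n (w (Suc n))"
  obtain S where S: "finite S" "S \<subseteq> carrier Winf"
    "\<forall>w\<in>carrier Winf. \<forall>N. \<exists>s\<in>generate Winf S. \<forall>n<N. s n = w n"
    using assms unfolding Winf_tfg_iff by (elim exE conjE) (rule that)
  show ?thesis
    unfolding prodiscrete_tfg_iff[of "\<lambda>n. A n", OF group_A]
  proof (intro exI[of _ "?f ` S"] conjI ballI allI)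
    show "finite (?f ` S)" using S(1) by simp
    show "?f ` S \<subseteq> carrier PA" using S(2) group_hom.hom_closed[OF group_hom_level_classes] by blast
    fix t N assume "t \<in> carrier PA"
    then obtain w where w: "w \<in> carrier Winf" "\<And>n. level_class n (w (Suc n)) = t n"
      by (rule level_classes_surj) (rule that)
    \<comment> \<open>The class at level \<open>n\<close> is read from coordinate
      \<open>Suc n\<close>, hence the bound \<open>Suc N\<close>.\<close>
    from S(3)[THEN bspec, OF w(1), THEN spec, of "Suc N"] obtain s
      where s: "s \<in> generate Winf S" "\<forall>n<Suc N. s n = w n" ..
    have "?f s n = t n" if "n < N" for n using s(2) that w(2) by simp
    moreover have "?f s \<in> generate PA (?f ` S)"
      using group_hom.generate_img[OF group_hom_level_classes S(2)] s(1) by blast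
    ultimately show "\<exists>s\<in>generate PA (?f ` S). \<forall>n<N. s n = t n"
      by (intro bexI[of _ "?f s"] allI impI)
  qed
qed

end

theorem theorem1:
  fixes G :: "nat \<Rightarrow> ('g, 'm) monoid_scheme"
    and X :: "nat \<Rightarrow> 'a set"
    and \<phi> :: "nat \<Rightarrow> 'g \<Rightarrow> 'a \<Rightarrow> 'a"
    and m :: nat
  assumes "\<And>n. finite_transitive_perm_group (G n) (X n) (\<phi> n)"
    and "\<And>n. generated_by_at_most m (G n)"
  shows "topologically_finitely_generated (infinite_wreath G X \<phi>) (infinite_wreath_topology G X \<phi>)
    \<longleftrightarrow> topologically_finitely_generated
      (product_group UNIV (\<lambda>n. abelianization (G n)))
      (prodiscrete_topology (\<lambda>n. abelianization (G n)))"
proof -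
  interpret perm_tower G X \<phi> by unfold_locales (rule assms(1))
  show ?thesis
    using abelianization_tfg_if_Winf Winf_tfg_if_abelianization[OF assms(2)] by blast
qed

end
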